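(* Let $1<j\le N-2$. Assume that $\lambda_{j-1}<\lambda_j=\lambda_{j+1}<\lambda_{j+2}$ and $$I''(V)=\sum_{m=1}^{j-1}\sum_{l=j}^{j+1}|\lambda_l-\lambda_m|^{-1}\int_0^\infty|V_{ml}(\tau)|^2d\tau+\sum_{m=1}^{j+1}\sum_{l=j+2}^{N}|\lambda_l-\lambda_m|^{-1}\int_0^\infty|V_{ml}(\tau)|^2d\tau<\infty .$$ Let $Y(t,k)$ be the $2\times2$ block of $X(t,k)$ formed by rows and columns $j,j+1$. Then there is an absolute constant $C$ such that for all $t\ge 0$ $$\int_{\mathbb{R}}\|Y(t,k)-\Psi(0,t,k)\|^2dk\le C\,I''(V).$$ Moreover, there is a $2\times 2$ matrix function $\tilde Y(\infty,k)$ on $\mathbb{R}$ such that $\|\Psi^{-1}(0,t,k)Y(t,k)-\tilde{Y}(\infty,k)\|\to 0$ in $L^2(\mathbb{R},dk)$ as $t\to\infty$, and $$\int_{\mathbb{R}}\|\tilde{Y}(\infty,k)-I\|^2dk\le C\,I''(V).$$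
   Context: Setting: $\Lambda=\mathrm{diag}(\lambda_1,\dots,\lambda_N)$ with real $0=\lambda_1\le\lambda_2\le\dots\le\lambda_N$ (eigenvalues may coincide). $V(t)=(V_{ml}(t))$, $t\ge0$, is an $N\times N$ Hermitian matrix function with $V_{mm}(t)=0$ for all $m$ and $\|V\|\in L^2_{\rm loc}(\mathbb{R}^+)$. For $k\in\mathbb{R}$, $X(t,k)$ is the $N\times N$ matrix solution of $X_t=i(k\Lambda+V(t))X$, $X(0,k)=I$. The $2\times 2$ matrix $\Psi(\tau,t,k)$ solves $$\frac{d}{dt}\Psi(\tau,t,k)=i\left(k\lambda_j I_{2\times 2}+\begin{bmatrix} 0 & V_{j,j+1}(t) \\ {V_{j+1,j}(t)} & 0 \end{bmatrix}\right)\Psi(\tau,t,k),\qquad \Psi(\tau,\tau,k)=I_{2\times 2}.$$ *)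

theory Defs
  imports "HOL-Analysis.Analysis"
begin

text \<open>
  The constant in the theorem must not depend on the size \<open>N\<close>, so \<open>N\<close> is quantified inside the
  statement and cannot be a type: \<open>N \<times> N\<close> matrices are functions \<open>nat \<Rightarrow> nat \<Rightarrow> complex\<close>
  (row, then column) of which only the entries with indices in \<open>{1..N}\<close> matter.
  The \<open>2 \<times> 2\<close> blocks have type \<open>complex^2^2\<close>.  Matrix norms are operator norms with respect to
  the Euclidean norm.
\<close>

definition opnorm :: "nat \<Rightarrow> (nat \<Rightarrow> nat \<Rightarrow> complex) \<Rightarrow> real" where
  "opnorm N A =
     (SUP x\<in>{x. L2_set (\<lambda>l. cmod (x l)) {1..N} \<le> 1}.
        L2_set (\<lambda>m. cmod (\<Sum>l=1..N. A m l * x l)) {1..N})"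

definition mnorm :: "complex^2^2 \<Rightarrow> real" where
  "mnorm A = onorm (\<lambda>x. A *v x)"

definition block :: "nat \<Rightarrow> (nat \<Rightarrow> nat \<Rightarrow> complex) \<Rightarrow> complex^2^2" where
  "block j A = vector [vector [A j j, A j (j + 1)], vector [A (j + 1) j, A (j + 1) (j + 1)]]"

text \<open>
  \<open>\<parallel>V\<parallel> \<in> L\<^sup>2\<^sub>l\<^sub>o\<^sub>c\<close> on the closed half-line, for a Lebesgue measurable matrix function.
\<close>

definition L2_loc :: "nat \<Rightarrow> (real \<Rightarrow> nat \<Rightarrow> nat \<Rightarrow> complex) \<Rightarrow> bool" where
  "L2_loc N V \<longleftrightarrow>
     (\<forall>m\<in>{1..N}. \<forall>l\<in>{1..N}. set_borel_measurable lebesgue {0..} (\<lambda>t. V t m l)) \<and>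
     (\<forall>T\<ge>0. set_integrable lebesgue {0..T} (\<lambda>t. (opnorm N (V t))\<^sup>2))"

definition zero_diag_hermitian :: "nat \<Rightarrow> (nat \<Rightarrow> nat \<Rightarrow> complex) \<Rightarrow> bool" where
  "zero_diag_hermitian N A \<longleftrightarrow>
     (\<forall>m\<in>{1..N}. \<forall>l\<in>{1..N}. A l m = cnj (A m l)) \<and> (\<forall>m\<in>{1..N}. A m m = 0)"

text \<open>
  Since the coefficients are only locally integrable in time, \<open>X' = \<i> H X\<close>, \<open>X(\<tau>) = I\<close> on \<open>[0,\<infinity>)\<close>
  is understood in the sense of Caratheodory, i.e. as the integral equation (with a signed
  integral when \<open>t < \<tau>\<close>); this forces \<open>X\<close> to be locally absolutely continuous.  The set \<open>I\<close>
  is the index set of the rows and columns.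
\<close>

definition solves_ivp ::
  "'i set \<Rightarrow> (real \<Rightarrow> 'i \<Rightarrow> 'i \<Rightarrow> complex) \<Rightarrow> real \<Rightarrow> (real \<Rightarrow> 'i \<Rightarrow> 'i \<Rightarrow> complex) \<Rightarrow> bool" where
  "solves_ivp I H \<tau> X \<longleftrightarrow>
     (\<forall>t\<ge>0. \<forall>m\<in>I. \<forall>l\<in>I.
        interval_lebesgue_integrable lebesgue (ereal \<tau>) (ereal t)
          (\<lambda>s. \<i> * (\<Sum>p\<in>I. H s m p * X s p l)) \<and>
        X t m l = (if m = l then 1 else 0) +
          interval_lebesgue_integral lebesgue (ereal \<tau>) (ereal t)
            (\<lambda>s. \<i> * (\<Sum>p\<in>I. H s m p * X s p l)))"

definition full_gen ::
  "(nat \<Rightarrow> real) \<Rightarrow> (real \<Rightarrow> nat \<Rightarrow> nat \<Rightarrow> complex) \<Rightarrow> real \<Rightarrow> real \<Rightarrow> nat \<Rightarrow> nat \<Rightarrow> complex" where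
  "full_gen lam V k t m l = (if m = l then of_real (k * lam m) else 0) + V t m l"

definition block_gen ::
  "(nat \<Rightarrow> real) \<Rightarrow> (real \<Rightarrow> nat \<Rightarrow> nat \<Rightarrow> complex) \<Rightarrow> nat \<Rightarrow> real \<Rightarrow> real \<Rightarrow> complex^2^2" where
  "block_gen lam V j k t =
     mat (of_real (k * lam j)) + vector [vector [0, V t j (j + 1)], vector [V t (j + 1) j, 0]]"

definition is_X ::
  "nat \<Rightarrow> (nat \<Rightarrow> real) \<Rightarrow> (real \<Rightarrow> nat \<Rightarrow> nat \<Rightarrow> complex) \<Rightarrow>
   (real \<Rightarrow> real \<Rightarrow> nat \<Rightarrow> nat \<Rightarrow> complex) \<Rightarrow> bool" where
  "is_X N lam V X \<longleftrightarrow> (\<forall>k. solves_ivp {1..N} (full_gen lam V k) 0 (\<lambda>t. X t k))"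

definition is_Psi ::
  "(nat \<Rightarrow> real) \<Rightarrow> (real \<Rightarrow> nat \<Rightarrow> nat \<Rightarrow> complex) \<Rightarrow> nat \<Rightarrow>
   (real \<Rightarrow> real \<Rightarrow> real \<Rightarrow> complex^2^2) \<Rightarrow> bool" where
  "is_Psi lam V j \<Psi> \<longleftrightarrow>
     (\<forall>k. \<forall>\<tau>\<ge>0. solves_ivp (UNIV :: 2 set)
        (\<lambda>t m l. block_gen lam V j k t $ m $ l) \<tau> (\<lambda>t m l. \<Psi> \<tau> t k $ m $ l))"

definition I2 ::
  "nat \<Rightarrow> (nat \<Rightarrow> real) \<Rightarrow> (real \<Rightarrow> nat \<Rightarrow> nat \<Rightarrow> complex) \<Rightarrow> nat \<Rightarrow> ennreal" where
  "I2 N lam V j =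
     (\<Sum>m=1..j-1. \<Sum>l=j..j+1. ennreal (inverse \<bar>lam l - lam m\<bar>) *
        (\<integral>\<^sup>+\<tau>\<in>{0..}. ennreal ((cmod (V \<tau> m l))\<^sup>2) \<partial>lebesgue)) +
     (\<Sum>m=1..j+1. \<Sum>l=j+2..N. ennreal (inverse \<bar>lam l - lam m\<bar>) *
        (\<integral>\<^sup>+\<tau>\<in>{0..}. ennreal ((cmod (V \<tau> m l))\<^sup>2) \<partial>lebesgue))"

text \<open>
  Squared \<open>L\<^sup>2(\<real>, dk)\<close> norm of a matrix function, with value \<open>\<infinity>\<close> if it is not square integrable.
\<close>

definition L2_sq :: "(real \<Rightarrow> complex^2^2) \<Rightarrow> ennreal" where
  "L2_sq F = (\<integral>\<^sup>+k. ennreal ((mnorm (F k))\<^sup>2) \<partial>lborel)"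

end

theory Submission
  imports Defs "HOL-Complex_Analysis.Cauchy_Integral_Formula" "HOL-Real_Asymp.Real_Asymp"
begin

text \<open>
  Subtract the energy \<open>k lam j\<close> from every level: the middle pair then has energy \<open>0\<close>, the levels
  below it have negative and those above it positive energy.  Two exterior powers move the middle
  pair to the bottom of the spectrum.  Among \<open>j - 1\<close> antisymmetric particles the state with
  occupied levels \<open>{1..j - 1}\<close> is the only one of least energy; among \<open>j\<close> particles the states of
  least energy are \<open>{1..j - 1}\<close> together with \<open>j\<close> or with \<open>j + 1\<close>.

  For a system \<open>u' = \<i> (k L + W) u\<close> with \<open>L \<ge> 0\<close> and \<open>W\<close> Hermitian, solutions are entire in \<open>k\<close> and do not
  grow in norm when \<open>Im k \<ge> 0\<close>.  Let \<open>h\<close> be a path in the kernel of \<open>L\<close>, driven by the compression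
  of \<open>W\<close> to this kernel; it does not depend on \<open>k\<close>.  If \<open>u\<close> starts where \<open>h\<close> does, then
  \<open>f k = \<langle>h, h\<rangle> - \<langle>h, u\<rangle>\<close> is bounded in the upper half plane, has \<open>Re f \<ge> 0\<close> there, and satisfies
  \<open>norm (u - h)^2 \<le> 2 Re f\<close>.  Energy estimates on the imaginary axis give
  \<open>y Re f (\<i> y) \<le> 3/2 \<Sum>\<^sub>l \<integral>cmod ((W h)\<^sub>l)^2 / L\<^sub>l + O(1 / y)\<close>, the sum running over the excited states \<open>l\<close>.
  Comparing with the Poisson integral as \<open>y \<rightarrow> \<infinity>\<close> turns this into a bound for \<open>\<integral>Re f dk\<close> over the real
  line, hence for \<open>\<integral>norm (u - h)^2 dk\<close>, with an absolute constant (\<open>boundary_integral_le\<close>,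
  \<open>adiabatic_estimate\<close>).  In the exterior powers the sum over excited states collapses to the
  density of \<open>I''\<close> because \<open>W\<close> moves a single particle at a time (\<open>hop_energy_le\<close>).

  To return to one particle, let \<open>x\<close> be a column of \<open>X\<close> (with its phase removed), \<open>\<omega>\<close> the solution
  with \<open>j - 1\<close> particles that starts in \<open>{1..j - 1}\<close>, and \<open>v\<close> the solution with \<open>j\<close> particles that
  starts on the path given by a column of \<open>\<Psi>\<close>.  The wedge product of \<open>x\<close> and \<open>\<omega>\<close> solves the
  \<open>j\<close>-particle system (\<open>dGamma_wedge\<close>), so its inner product with \<open>v\<close> is constant in time.  Since \<open>\<omega>\<close>
  and \<open>v\<close> stay close to their ground paths, this inner product is, up to the two errors, an entry
  of \<open>Q = \<Psi>\<^sup>-\<^sup>1 Y\<close>.  Thus \<open>Q\<close> drifts little between any two times (\<open>mid_pair_drift\<close>):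
  \<open>\<integral>norm (Q T - Q \<tau>)^2 dk\<close> is at most an absolute constant times the part of \<open>I''\<close> that comes from
  \<open>[\<tau>, T]\<close>.  As \<open>Q 0\<close> is the identity and \<open>Y - \<Psi> = \<Psi> (Q - I)\<close>, the choice \<open>\<tau> = 0\<close> gives the first claim;
  and as these bounds tend to \<open>0\<close>, \<open>Q\<close> is Cauchy in \<open>L\<^sup>2(dk)\<close>, which gives the limit.
\<close>

section \<open>Calculus of indefinite integrals\<close>

text \<open>
  A Caratheodory solution is the indefinite integral of its right-hand side, which need not be
  continuous.  Keeping the integrable derivative as an explicit second function allows calculus
  without derivatives that exist only almost everywhere.
\<close>

definition primitive :: "real \<Rightarrow> (real \<Rightarrow> complex) \<Rightarrow> (real \<Rightarrow> complex) \<Rightarrow> bool" where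
  "primitive \<tau> f f' \<longleftrightarrow>
     (\<forall>t\<ge>\<tau>. f' absolutely_integrable_on {\<tau>..t} \<and> f t = f \<tau> + integral {\<tau>..t} f')"

lemma primitiveD:
  assumes "primitive \<tau> f f'" "\<tau> \<le> t"
  shows "f' absolutely_integrable_on {\<tau>..t}" "f t = f \<tau> + integral {\<tau>..t} f'"
  using assms unfolding primitive_def by blast+

lemma primitive_continuous:
  assumes "primitive \<tau> f f'"
  shows "continuous_on {\<tau>..t} f"
proof (cases "\<tau> \<le> t")
  case True
  have "f' integrable_on {\<tau>..t}"
    using primitiveD(1)[OF assms True] by (simp add: absolutely_integrable_on_def)
  then have "continuous_on {\<tau>..t} (\<lambda>s. f \<tau> + integral {\<tau>..s} f')"
    by (intro continuous_on_add continuous_on_const indefinite_integral_continuous_1)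
  then show ?thesis
    by (rule continuous_on_eq) (metis primitiveD(2)[OF assms] atLeastAtMost_iff)
qed simp

lemma primitive_restart:
  assumes "primitive \<tau> f f'" "\<tau> \<le> \<sigma>"
  shows "primitive \<sigma> f f'"
  unfolding primitive_def
proof (intro allI impI)
  fix t assume "\<sigma> \<le> t"
  note a = primitiveD[OF assms(1), of t] primitiveD(2)[OF assms]
  have ai: "f' absolutely_integrable_on {\<tau>..t}" using a assms \<open>\<sigma> \<le> t\<close> by simp
  then have "integral {\<tau>..\<sigma>} f' + integral {\<sigma>..t} f' = integral {\<tau>..t} f'"
    using assms \<open>\<sigma> \<le> t\<close> by (intro Henstock_Kurzweil_Integration.integral_combine)
       (auto simp: absolutely_integrable_on_def)
  moreover have "f' absolutely_integrable_on {\<sigma>..t}"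
    using ai assms by (auto intro: absolutely_integrable_on_subinterval)
  ultimately show "f' absolutely_integrable_on {\<sigma>..t} \<and> f t = f \<sigma> + integral {\<sigma>..t} f'"
    using a assms \<open>\<sigma> \<le> t\<close> by (simp add: algebra_simps)
qed

lemma primitive_cong:
  assumes "primitive \<tau> f f'" "\<And>t. \<tau> \<le> t \<Longrightarrow> f t = g t" "\<And>t. \<tau> \<le> t \<Longrightarrow> f' t = g' t"
  shows "primitive \<tau> g g'"
  unfolding primitive_def
proof (intro allI impI)
  fix t assume t: "\<tau> \<le> t"
  have "g' absolutely_integrable_on {\<tau>..t}"
    using primitiveD(1)[OF assms(1) t] assms(3)
    by (subst set_integrable_cong[where f' = f']) auto
  moreover have "integral {\<tau>..t} g' = integral {\<tau>..t} f'"
    using assms(3) by (intro integral_cong) auto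
  ultimately show "g' absolutely_integrable_on {\<tau>..t} \<and> g t = g \<tau> + integral {\<tau>..t} g'"
    using primitiveD(2)[OF assms(1) t] assms(2) t by auto
qed

lemma primitive_const: "primitive \<tau> (\<lambda>t. c) (\<lambda>t. 0)"
  by (auto simp: primitive_def)

lemma primitive_add:
  assumes "primitive \<tau> f f'" "primitive \<tau> g g'"
  shows "primitive \<tau> (\<lambda>t. f t + g t) (\<lambda>t. f' t + g' t)"
  unfolding primitive_def
proof (intro allI impI conjI)
  fix t assume "\<tau> \<le> t"
  note a = primitiveD[OF assms(1) \<open>\<tau> \<le> t\<close>] primitiveD[OF assms(2) \<open>\<tau> \<le> t\<close>]
  show "(\<lambda>t. f' t + g' t) absolutely_integrable_on {\<tau>..t}" using a by (intro set_integral_add)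
  have "integral {\<tau>..t} (\<lambda>t. f' t + g' t) = integral {\<tau>..t} f' + integral {\<tau>..t} g'"
    using a by (intro integral_add) (auto simp: absolutely_integrable_on_def)
  then show "f t + g t = f \<tau> + g \<tau> + integral {\<tau>..t} (\<lambda>t. f' t + g' t)"
    using a by simp
qed

lemma primitive_cmult:
  assumes "primitive \<tau> f f'"
  shows "primitive \<tau> (\<lambda>t. c * f t) (\<lambda>t. c * f' t)"
  unfolding primitive_def
proof (intro allI impI conjI)
  fix t assume "\<tau> \<le> t"
  note a = primitiveD[OF assms(1) \<open>\<tau> \<le> t\<close>]
  show "(\<lambda>t. c * f' t) absolutely_integrable_on {\<tau>..t}" using a by simp
  have "integral {\<tau>..t} (\<lambda>t. c * f' t) = c * integral {\<tau>..t} f'"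
    by (rule integral_mult_right)
  then show "c * f t = c * f \<tau> + integral {\<tau>..t} (\<lambda>t. c * f' t)"
    using a by (simp add: algebra_simps)
qed

lemma primitive_sum:
  assumes "\<And>i. i \<in> A \<Longrightarrow> primitive \<tau> (f i) (f' i)"
  shows "primitive \<tau> (\<lambda>t. \<Sum>i\<in>A. f i t) (\<lambda>t. \<Sum>i\<in>A. f' i t)"
  using assms
  by (induction A rule: infinite_finite_induct) (auto intro: primitive_const primitive_add)

lemma primitive_cnj:
  assumes "primitive \<tau> f f'"
  shows "primitive \<tau> (\<lambda>t. cnj (f t)) (\<lambda>t. cnj (f' t))"
  unfolding primitive_def
proof (intro allI impI conjI)
  fix t assume "\<tau> \<le> t"
  note a = primitiveD[OF assms(1) \<open>\<tau> \<le> t\<close>]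
  show "(\<lambda>t. cnj (f' t)) absolutely_integrable_on {\<tau>..t}"
    using absolutely_integrable_linear[OF a(1) bounded_linear_cnj] by (simp add: o_def)
  have "integral {\<tau>..t} (\<lambda>t. cnj (f' t)) = cnj (integral {\<tau>..t} f')"
    using a(1) by (simp add: integral_cnj)
  then show "cnj (f t) = cnj (f \<tau>) + integral {\<tau>..t} (\<lambda>t. cnj (f' t))"
    using a by simp
qed

lemma primitive_has_vector_derivative:
  assumes "\<And>t. (f has_vector_derivative f' t) (at t)" "continuous_on UNIV f'"
  shows "primitive \<tau> f f'"
  unfolding primitive_def
proof (intro allI impI conjI)
  fix t assume "\<tau> \<le> t"
  have c: "continuous_on {\<tau>..t} f'" using assms(2) continuous_on_subset by blast
  then show "f' absolutely_integrable_on {\<tau>..t}"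
    by (rule absolutely_integrable_continuous_real)
  have "(f' has_integral (f t - f \<tau>)) {\<tau>..t}"
    using assms(1) \<open>\<tau> \<le> t\<close> by (intro fundamental_theorem_of_calculus) 
      (auto intro: has_vector_derivative_at_within)
  then show "f t = f \<tau> + integral {\<tau>..t} f'" by (simp add: integral_unique)
qed

text \<open>
  On \<open>[\<tau>, t]\<^sup>2\<close> the product \<open>f' s * g' r\<close> is integrated over the two triangles \<open>r \<le> s\<close> and \<open>s \<le> r\<close>.  By
  Fubini each triangle is one half of the product rule, and the diagonal is a null set.
\<close>

lemma primitive_mult:
  assumes "primitive \<tau> f f'" "primitive \<tau> g g'"
  shows "primitive \<tau> (\<lambda>t. f t * g t) (\<lambda>t. f' t * g t + f t * g' t)"
  unfolding primitive_def
proof (intro allI impI)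
  fix t assume t: "\<tau> \<le> t"
  note a = primitiveD[OF assms(1) t] primitiveD[OF assms(2) t]
  have prod_ai: "(\<lambda>s. p s * q s) absolutely_integrable_on {\<tau>..t}"
    if "continuous_on {\<tau>..t} p" "q absolutely_integrable_on {\<tau>..t}" for p q :: "real \<Rightarrow> complex"
  proof (rule absolutely_integrable_bounded_measurable_product[OF bilinear_times])
    show "p \<in> borel_measurable (lebesgue_on {\<tau>..t})"
      using that by (simp add: continuous_imp_measurable_on_sets_lebesgue)
    show "bounded (p ` {\<tau>..t})"
      using that compact_continuous_image compact_imp_bounded by blast
  qed (use that in auto)
  have ai1: "(\<lambda>s. f' s * g s) absolutely_integrable_on {\<tau>..t}"
    using prod_ai[OF primitive_continuous[OF assms(2)] a(1)] by (simp add: mult.commute)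
  have ai2: "(\<lambda>s. f s * g' s) absolutely_integrable_on {\<tau>..t}"
    by (rule prod_ai[OF primitive_continuous[OF assms(1)] a(3)])
  define M where "M = lebesgue_on {\<tau>..t}"
  interpret finite_measure M
    unfolding M_def by (rule finite_measure_lebesgue_on) auto
  interpret pair_sigma_finite M M by standard
  have intM: "integrable M q"
    "(LINT s|M. q s) = integral {\<tau>..t} q" if "q absolutely_integrable_on {\<tau>..t}" for q :: "real \<Rightarrow> complex"
    using that unfolding M_def
    by (simp_all add: integrable_restrict_space integral_restrict_space set_integrable_def
      set_lebesgue_integral_eq_integral(2) flip: set_lebesgue_integral_def)
  have F: "integrable M f'" and G: "integrable M g'" using intM a by auto
  have [measurable]: "(\<lambda>x. x) \<in> M \<rightarrow>\<^sub>M borel"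
    unfolding M_def by (auto intro!: measurable_restrict_space1 borel_measurable_if_lebesgue_on simp: measurable_completion)
  have [measurable]: "f' \<in> borel_measurable M" "g' \<in> borel_measurable M" using F G by auto
  have FG: "integrable (M \<Otimes>\<^sub>M M) (\<lambda>(s,r). f' s * g' r)"
    using F G by (intro Fubini_integrable) (auto simp: norm_mult)
  have D1: "integrable (M \<Otimes>\<^sub>M M) (\<lambda>(s,r). if r \<le> s then f' s * g' r else 0)"
    by (rule Bochner_Integration.integrable_bound[OF FG]) (auto simp: norm_mult)
  have D2: "integrable (M \<Otimes>\<^sub>M M) (\<lambda>(s,r). if s \<le> r then f' s * g' r else 0)"
    by (rule Bochner_Integration.integrable_bound[OF FG]) (auto simp: norm_mult)
  have part: "integral {\<tau>..s} q = (LINT r|M. (if r \<le> s then q r else 0))"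
    if "q absolutely_integrable_on {\<tau>..t}" "s \<in> {\<tau>..t}" for q :: "real \<Rightarrow> complex" and s
  proof -
    have "(\<lambda>r. if r \<le> s then q r else 0) absolutely_integrable_on {\<tau>..t}"
    proof -
      have "q absolutely_integrable_on {\<tau>..s}"
        using that by (auto intro: absolutely_integrable_on_subinterval)
      then show ?thesis
        using that unfolding set_integrable_def
        by (elim Bochner_Integration.integrable_cong[THEN iffD1, rotated -1])
           (auto simp: indicator_def)
    qed
    then have "(LINT r|M. (if r \<le> s then q r else 0)) = integral {\<tau>..t} (\<lambda>r. if r \<le> s then q r else 0)"
      by (rule intM)
    also have "\<dots> = integral {\<tau>..t} (\<lambda>r. if r \<in> {\<tau>..s} then q r else 0)"
      by (intro integral_cong) auto
    also have "\<dots> = integral {\<tau>..s} q"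
      using that by (subst integral_restrict_Int) (auto intro!: arg_cong2[of _ _ _ _ integral])
    finally show ?thesis by simp
  qed
  have sp: "s \<in> {\<tau>..t}" if "s \<in> space M" for s using that by (simp add: M_def space_restrict_space)
  have gs: "g s = g \<tau> + (LINT r|M. (if r \<le> s then g' r else 0))" if "s \<in> space M" for s
    using primitiveD(2)[OF assms(2), of s] part[OF a(3) sp[OF that]] sp[OF that] by simp
  have fs: "f s = f \<tau> + (LINT r|M. (if r \<le> s then f' r else 0))" if "s \<in> space M" for s
    using primitiveD(2)[OF assms(1), of s] part[OF a(1) sp[OF that]] sp[OF that] by simp
  have e1: "(LINT s|M. f' s * g s) = (LINT s|M. f' s) * g \<tau> + (LINT s|M. (LINT r|M. (if r \<le> s then f' s * g' r else 0)))"
  proof -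
    have "(LINT s|M. f' s * g s) = (LINT s|M. f' s * g \<tau> + (LINT r|M. (if r \<le> s then f' s * g' r else 0)))"
    proof (rule Bochner_Integration.integral_cong[OF refl])
      fix s assume s: "s \<in> space M"
      have "f' s * (LINT r|M. (if r \<le> s then g' r else 0)) = (LINT r|M. f' s * (if r \<le> s then g' r else 0))"
        by simp
      also have "\<dots> = (LINT r|M. (if r \<le> s then f' s * g' r else 0))"
        by (intro Bochner_Integration.integral_cong) auto
      finally show "f' s * g s = f' s * g \<tau> + (LINT r|M. (if r \<le> s then f' s * g' r else 0))"
        by (subst gs[OF s]) (simp add: algebra_simps)
    qed
    also have "\<dots> = (LINT s|M. f' s) * g \<tau> + (LINT s|M. (LINT r|M. (if r \<le> s then f' s * g' r else 0)))"
      using F integrable_fst[OF D1] by (subst Bochner_Integration.integral_add) auto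
    finally show ?thesis .
  qed
  have e2: "(LINT r|M. f r * g' r) = f \<tau> * (LINT s|M. g' s) + (LINT s|M. (LINT r|M. (if s \<le> r then f' s * g' r else 0)))"
  proof -
    have "(LINT r|M. f r * g' r) = (LINT r|M. f \<tau> * g' r + (LINT s|M. (if s \<le> r then f' s * g' r else 0)))"
    proof (rule Bochner_Integration.integral_cong[OF refl])
      fix r assume r: "r \<in> space M"
      have "(LINT s|M. (if s \<le> r then f' s else 0)) * g' r = (LINT s|M. (if s \<le> r then f' s else 0) * g' r)"
        by simp
      also have "\<dots> = (LINT s|M. (if s \<le> r then f' s * g' r else 0))"
        by (intro Bochner_Integration.integral_cong) auto
      finally show "f r * g' r = f \<tau> * g' r + (LINT s|M. (if s \<le> r then f' s * g' r else 0))"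
        by (subst fs[OF r]) (simp add: algebra_simps)
    qed
    also have "\<dots> = f \<tau> * (LINT s|M. g' s) + (LINT r|M. (LINT s|M. (if s \<le> r then f' s * g' r else 0)))"
      using G integrable_snd[OF D2] by (subst Bochner_Integration.integral_add) auto
    also have "(LINT r|M. (LINT s|M. (if s \<le> r then f' s * g' r else 0))) = (LINT s|M. (LINT r|M. (if s \<le> r then f' s * g' r else 0)))"
      by (rule Fubini_integral[OF D2])
    finally show ?thesis .
  qed
  \<comment> \<open>the two triangles together cover the square, up to the diagonal\<close>
  have "(LINT s|M. (LINT r|M. (if r \<le> s then f' s * g' r else 0))) + (LINT s|M. (LINT r|M. (if s \<le> r then f' s * g' r else 0)))
     = (LINT s|M. (LINT r|M. (if r \<le> s then f' s * g' r else 0)) + (LINT r|M. (if s \<le> r then f' s * g' r else 0)))"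
    using integrable_fst[OF D1] integrable_fst[OF D2] by (subst Bochner_Integration.integral_add) auto
  also have "\<dots> = (LINT s|M. f' s * (LINT r|M. g' r))"
  proof (rule integral_cong_AE)
    show "AE s in M. (LINT r|M. (if r \<le> s then f' s * g' r else 0)) + (LINT r|M. (if s \<le> r then f' s * g' r else 0))
        = f' s * (LINT r|M. g' r)"
      using AE_integrable_fst[OF D1] AE_integrable_fst[OF D2]
    proof eventually_elim
      case (elim s)
      have "(LINT r|M. (if r \<le> s then f' s * g' r else 0)) + (LINT r|M. (if s \<le> r then f' s * g' r else 0))
         = (LINT r|M. (if r \<le> s then f' s * g' r else 0) + (if s \<le> r then f' s * g' r else 0))"
        using elim by simp
      also have "\<dots> = (LINT r|M. f' s * g' r)"
      proof (rule integral_cong_AE)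
        have "AE r in lebesgue. r \<noteq> s"
          using AE_lborel_singleton by (rule AE_completion)
        then have "AE r in M. r \<noteq> s" unfolding M_def by (subst AE_restrict_space_iff) auto
        then show "AE r in M. (if r \<le> s then f' s * g' r else 0) + (if s \<le> r then f' s * g' r else 0) = f' s * g' r"
          by eventually_elim auto
      qed auto
      finally show ?case by simp
    qed
  qed (use integrable_fst[OF D1] integrable_fst[OF D2] in auto)
  also have "\<dots> = (LINT s|M. f' s) * (LINT r|M. g' r)" by simp
  finally have "integral {\<tau>..t} (\<lambda>s. f' s * g s) + integral {\<tau>..t} (\<lambda>s. f s * g' s)
     = integral {\<tau>..t} f' * g \<tau> + f \<tau> * integral {\<tau>..t} g' + integral {\<tau>..t} f' * integral {\<tau>..t} g'"
    using e1 e2 intM(2)[OF ai1] intM(2)[OF ai2] intM(2)[OF a(1)] intM(2)[OF a(3)] by (simp add: algebra_simps)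
  moreover have "integral {\<tau>..t} (\<lambda>s. f' s * g s + f s * g' s) =
      integral {\<tau>..t} (\<lambda>s. f' s * g s) + integral {\<tau>..t} (\<lambda>s. f s * g' s)"
    using ai1 ai2 by (intro integral_add) (auto simp: absolutely_integrable_on_def)
  ultimately have "f t * g t = f \<tau> * g \<tau> + integral {\<tau>..t} (\<lambda>s. f' s * g s + f s * g' s)"
    using a by (simp add: algebra_simps)
  then show "(\<lambda>t. f' t * g t + f t * g' t) absolutely_integrable_on {\<tau>..t} \<and>
         f t * g t = f \<tau> * g \<tau> + integral {\<tau>..t} (\<lambda>t. f' t * g t + f t * g' t)"
    using set_integral_add[OF ai1 ai2] by simp
qed

section \<open>Boundary integrals of functions with nonnegative real part in the half plane\<close>

text \<open>
  The difference quotient below is holomorphic on \<open>Im z > - y\<close> because the subtraction of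
  \<open>f (\<i> y)\<close> removes its pole there.  Cauchy's theorem on the upper half disc leaves the integral over
  the arc, where the denominator is at least \<open>R\<^sup>2 - y\<^sup>2\<close>.
\<close>

lemma half_disc_integral:
  fixes f :: "complex \<Rightarrow> complex"
  assumes hol: "f holomorphic_on UNIV" and bd: "\<And>z. 0 \<le> Im z \<Longrightarrow> cmod (f z) \<le> B"
    and y: "0 < y" "y < R"
  shows "continuous_on {-R..R} (\<lambda>x. (f (of_real x) - f (\<i> * of_real y)) / (of_real x ^ 2 + of_real y ^ 2))"
    "cmod (integral {-R..R} (\<lambda>x. (f (of_real x) - f (\<i> * of_real y)) / (of_real x ^ 2 + of_real y ^ 2)))
         \<le> 2 * B * pi * R / (R\<^sup>2 - y\<^sup>2)"
proof -
  define a where "a = \<i> * complex_of_real y"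
  \<comment> \<open>\<open>q\<close> is the difference quotient at \<open>a = \<i> y\<close>, so that \<open>G z = (f z - f a) / (z\<^sup>2 + y\<^sup>2)\<close> away from \<open>a\<close>\<close>
  define q where "q = (\<lambda>z. if z = a then deriv f a else (f z - f a) / (z - a))"
  define G where "G = (\<lambda>z. q z / (z + a))"
  define S where "S = {z. Im z > - y}"
  have q: "q holomorphic_on UNIV" unfolding q_def by (rule pole_lemma_open[OF hol]) auto
  have "z + a \<noteq> 0" if "z \<in> S" for z
  proof
    assume "z + a = 0" then have "Im (z + a) = 0" by simp
    with that show False by (simp add: S_def a_def)
  qed
  then have G: "G holomorphic_on S"
    unfolding G_def by (intro holomorphic_intros holomorphic_on_subset[OF q]) auto
  have Geq: "G z = (f z - f a) / (z ^ 2 + of_real y ^ 2)" if "z \<noteq> a" for z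
    using that by (simp add: G_def q_def power2_eq_square a_def algebra_simps)
  have cS: "convex S" unfolding S_def by (rule convex_halfspace_Im_gt)
  define L where "L = linepath (of_real (-R)) (complex_of_real R)"
  define A where "A = part_circlepath 0 R 0 pi"
  have imL: "path_image L \<subseteq> S"
  proof
    fix z assume "z \<in> path_image L"
    then have "z \<in> closed_segment (of_real (-R)) (of_real R)" by (simp add: L_def)
    then have "Im z = 0" by (auto simp: closed_segment_def)
    then show "z \<in> S" using y by (simp add: S_def)
  qed
  have Aim: "Im z \<ge> 0 \<and> cmod z = R" if "z \<in> path_image A" for z
    using that y by (auto simp: A_def path_image_part_circlepath Im_exp norm_mult intro!: mult_nonneg_nonneg sin_ge_zero)
  then have imA: "path_image A \<subseteq> S" using y by (fastforce simp: S_def)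
  have ends: "pathfinish L = pathstart A" "pathfinish A = pathstart L"
    by (simp_all add: L_def A_def exp_pi_i)
  have "(G has_contour_integral 0) (L +++ A)"
    by (rule Cauchy_theorem_convex_simple[OF G cS])
       (use imL imA ends in \<open>auto simp: L_def A_def path_image_join\<close>)
  then have "contour_integral (L +++ A) G = 0" by (rule contour_integral_unique)
  moreover have GL: "G contour_integrable_on L" and GA: "G contour_integrable_on A"
    using G imL imA unfolding L_def A_def S_def
    by (auto intro!: contour_integrable_holomorphic_simple[OF G[unfolded S_def]] open_halfspace_Im_gt)
  ultimately have "contour_integral L G + contour_integral A G = 0"
    using ends by (subst (asm) contour_integral_join) (auto simp: L_def A_def)
  then have eq: "cmod (contour_integral L G) = cmod (contour_integral A G)"
    by (metis add_eq_0_iff norm_minus_cancel)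
  have nz: "R\<^sup>2 - y\<^sup>2 > 0" using y by (simp add: power_strict_mono)
  have B0: "0 \<le> B" using order.trans[OF norm_ge_zero bd[of 0]] by simp
  have "cmod (contour_integral A G) \<le> 2 * B / (R\<^sup>2 - y\<^sup>2) * R * \<bar>pi - 0\<bar>"
    unfolding A_def
  proof (rule contour_integral_bound_part_circlepath)
    show "G contour_integrable_on part_circlepath 0 R 0 pi" using GA by (simp add: A_def)
    show "0 \<le> 2 * B / (R\<^sup>2 - y\<^sup>2)" using nz B0 by simp
    fix z assume "z \<in> path_image (part_circlepath 0 R 0 pi)"
    then have z: "Im z \<ge> 0" "cmod z = R" using Aim by (auto simp: A_def)
    have za: "z \<noteq> a" using z y by (auto simp: a_def norm_mult)
    have "cmod (f z - f a) \<le> 2 * B"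
      using bd[of z] bd[of a] z y norm_triangle_ineq4[of "f z" "f a"] by (simp add: a_def)
    moreover have "R\<^sup>2 - y\<^sup>2 \<le> cmod (z ^ 2 + of_real y ^ 2)"
      using norm_diff_ineq[of "z ^ 2" "of_real y ^ 2"] z y by (simp add: norm_power)
    ultimately show "cmod (G z) \<le> 2 * B / (R\<^sup>2 - y\<^sup>2)"
      unfolding Geq[OF za] norm_divide using nz B0 by (intro frac_le) auto
  qed (use y in auto)
  also have "2 * B / (R\<^sup>2 - y\<^sup>2) * R * \<bar>pi - 0\<bar> = 2 * B * pi * R / (R\<^sup>2 - y\<^sup>2)" by simp
  finally have A: "cmod (contour_integral A G) \<le> 2 * B * pi * R / (R\<^sup>2 - y\<^sup>2)" .
  have Gr: "G (of_real x) = (f (of_real x) - f a) / (of_real x ^ 2 + of_real y ^ 2)" for x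
  proof (rule Geq)
    have "Im (of_real x) \<noteq> Im a" using y by (simp add: a_def)
    then show "of_real x \<noteq> a" by metis
  qed
  have "contour_integral L G = integral {-R..R} (\<lambda>x. G (of_real x))"
    unfolding L_def using y by (subst contour_integral_linepath_Reals_eq) auto
  then show "cmod (integral {-R..R} (\<lambda>x. (f (of_real x) - f (\<i> * of_real y)) / (of_real x ^ 2 + of_real y ^ 2)))
         \<le> 2 * B * pi * R / (R\<^sup>2 - y\<^sup>2)"
    using A eq by (simp add: Gr a_def)
  have "continuous_on S G" using G by (rule holomorphic_on_imp_continuous_on)
  then have "continuous_on {-R..R} (\<lambda>x. G (of_real x))"
    by (rule continuous_on_compose2) (use y in \<open>auto simp: S_def intro!: continuous_intros\<close>)
  then show "continuous_on {-R..R} (\<lambda>x. (f (of_real x) - f (\<i> * of_real y)) / (of_real x ^ 2 + of_real y ^ 2))"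
    by (simp add: Gr a_def)
qed

lemma integral_poisson_kernel:
  assumes "0 < y" "0 < R"
  shows "((\<lambda>x. 1 / (x\<^sup>2 + y\<^sup>2)) has_integral (2 / y * arctan (R / y))) {-R..R}"
proof -
  have "((\<lambda>x. 1 / (x\<^sup>2 + y\<^sup>2)) has_integral (arctan (R / y) / y - arctan ((-R) / y) / y)) {-R..R}"
  proof (rule fundamental_theorem_of_calculus)
    fix x assume "x \<in> {-R..R}"
    have "((\<lambda>x. arctan (x / y) / y) has_real_derivative 1 / (x\<^sup>2 + y\<^sup>2)) (at x within {-R..R})"
    proof (rule has_field_derivative_at_within)
      have "((\<lambda>x. arctan (x / y) / y) has_real_derivative inverse (1 + (x / y)\<^sup>2) * (1 / y) / y) (at x)"
        using assms by (auto intro!: derivative_eq_intros)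
      moreover have "x\<^sup>2 + y\<^sup>2 > 0" using assms by (simp add: add_nonneg_pos)
      then have "inverse (1 + (x / y)\<^sup>2) * (1 / y) / y = 1 / (x\<^sup>2 + y\<^sup>2)"
        using assms by (simp add: divide_simps power2_eq_square)
      ultimately show "((\<lambda>x. arctan (x / y) / y) has_real_derivative 1 / (x\<^sup>2 + y\<^sup>2)) (at x)" by simp
    qed
    then show "((\<lambda>x. arctan (x / y) / y) has_vector_derivative 1 / (x\<^sup>2 + y\<^sup>2)) (at x within {-R..R})"
      by (simp add: has_real_derivative_iff_has_vector_derivative)
  qed (use assms in auto)
  then show ?thesis by (simp add: arctan_minus)
qed

text \<open>
  The Poisson integral gives \<open>\<integral>Re f(x) y\<^sup>2 / (x\<^sup>2 + y\<^sup>2) dx = \<pi> y Re f (\<i> y)\<close>, and the kernel on the left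
  increases to \<open>1\<close> as \<open>y \<rightarrow> \<infinity>\<close>.  Since \<open>Re f \<ge> 0\<close> on the real line, the integral over
  \<open>[-r, r]\<close> is at most the one over the diameter \<open>[-R, R]\<close> of a larger half disc.  Let first \<open>R\<close> and
  then \<open>y\<close> tend to infinity.
\<close>

lemma boundary_integral_le:
  fixes f :: "complex \<Rightarrow> complex"
  assumes hol: "f holomorphic_on UNIV" and bd: "\<And>z. 0 \<le> Im z \<Longrightarrow> cmod (f z) \<le> B"
    and pos: "\<And>x::real. 0 \<le> Re (f (of_real x))"
    and asym: "\<And>y::real. 1 \<le> y \<Longrightarrow> y * Re (f (\<i> * of_real y)) \<le> c + K / y"
  shows "(\<integral>\<^sup>+x. ennreal (Re (f (of_real x))) \<partial>lborel) \<le> ennreal (pi * c)"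
proof -
  define g where "g = (\<lambda>x::real. Re (f (of_real x)))"
  have cg: "continuous_on A g" for A
    unfolding g_def by (intro continuous_intros continuous_on_compose2[OF holomorphic_on_imp_continuous_on[OF hol]]) auto
  have est: "integral {-r..r} g \<le> (1 + r\<^sup>2 / y\<^sup>2) * (y * Re (f (\<i> * of_real y)) * (2 * arctan (R / y)) + y\<^sup>2 * (2 * B * pi * R / (R\<^sup>2 - y\<^sup>2)))"
    if r: "0 < r" "r \<le> R" and y: "0 < y" "y < R" for r R y
  proof -
    have nn: "x\<^sup>2 + y\<^sup>2 > 0" for x using y by (simp add: add_nonneg_pos)
    define h where "h = Re (f (\<i> * of_real y))"
    define G where "G = (\<lambda>x::real. (f (of_real x) - f (\<i> * of_real y)) / (of_real x ^ 2 + of_real y ^ 2))"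
    note hd = half_disc_integral[OF hol bd y, folded G_def]
    have ReG: "Re (G x) = g x / (x\<^sup>2 + y\<^sup>2) - h * (1 / (x\<^sup>2 + y\<^sup>2))" for x
    proof -
      have "G x = (f (of_real x) - f (\<i> * of_real y)) / of_real (x\<^sup>2 + y\<^sup>2)" by (simp add: G_def)
      then have "Re (G x) = (g x - h) / (x\<^sup>2 + y\<^sup>2)" by (simp only: Re_divide_of_real) (simp add: g_def h_def)
      then show ?thesis by (simp add: diff_divide_distrib)
    qed
    have "integral {-R..R} (\<lambda>x. Re (G x)) = Re (integral {-R..R} G)"
      using integral_linear[OF integrable_continuous_real[OF hd(1)] bounded_linear_Re] by (simp add: o_def)
    also have "\<dots> \<le> 2 * B * pi * R / (R\<^sup>2 - y\<^sup>2)"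
      using hd(2) complex_Re_le_cmod order.trans by blast
    finally have 1: "integral {-R..R} (\<lambda>x. Re (G x)) \<le> 2 * B * pi * R / (R\<^sup>2 - y\<^sup>2)" .
    have c1: "continuous_on {-R..R} (\<lambda>x. g x / (x\<^sup>2 + y\<^sup>2))"
      by (intro continuous_intros cg) (use nn less_irrefl in metis)
    have "((\<lambda>x. h * (1 / (x\<^sup>2 + y\<^sup>2))) has_integral h * (2 / y * arctan (R / y))) {-R..R}"
      using y by (intro has_integral_mult_right integral_poisson_kernel) auto
    from has_integral_diff[OF integrable_integral[OF integrable_continuous_real[OF c1]] this]
    have "integral {-R..R} (\<lambda>x. Re (G x)) = integral {-R..R} (\<lambda>x. g x / (x\<^sup>2 + y\<^sup>2)) - h * (2 / y * arctan (R / y))"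
      unfolding ReG by (rule integral_unique)
    then have 2: "integral {-R..R} (\<lambda>x. g x / (x\<^sup>2 + y\<^sup>2)) \<le> h * (2 / y * arctan (R / y)) + 2 * B * pi * R / (R\<^sup>2 - y\<^sup>2)"
      using 1 by simp
    have "integral {-r..r} g \<le> integral {-r..r} (\<lambda>x. (r\<^sup>2 + y\<^sup>2) * (g x / (x\<^sup>2 + y\<^sup>2)))"
    proof (rule integral_le)
      fix x assume "x \<in> {-r..r}"
      then have "x\<^sup>2 \<le> r\<^sup>2" by (intro abs_le_square_iff[THEN iffD1]) auto
      then show "g x \<le> (r\<^sup>2 + y\<^sup>2) * (g x / (x\<^sup>2 + y\<^sup>2))"
        using nn[of x] pos[of x] by (simp add: g_def field_simps mult_left_mono)
    next
      show "(\<lambda>x. (r\<^sup>2 + y\<^sup>2) * (g x / (x\<^sup>2 + y\<^sup>2))) integrable_on {-r..r}"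
        by (intro integrable_continuous_real continuous_intros cg) (use nn less_irrefl in metis)
    qed (intro integrable_continuous_real cg)
    also have "\<dots> = (r\<^sup>2 + y\<^sup>2) * integral {-r..r} (\<lambda>x. g x / (x\<^sup>2 + y\<^sup>2))"
      by (rule integral_mult_right)
    also have "\<dots> \<le> (r\<^sup>2 + y\<^sup>2) * integral {-R..R} (\<lambda>x. g x / (x\<^sup>2 + y\<^sup>2))"
    proof (rule mult_left_mono)
      show "integral {-r..r} (\<lambda>x. g x / (x\<^sup>2 + y\<^sup>2)) \<le> integral {-R..R} (\<lambda>x. g x / (x\<^sup>2 + y\<^sup>2))"
        using r pos nn c1 less_imp_le
        by (intro integral_subset_le integrable_continuous_real continuous_on_subset[OF c1])
           (auto simp: g_def intro!: divide_nonneg_nonneg)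
    qed simp
    also have "\<dots> \<le> (r\<^sup>2 + y\<^sup>2) * (h * (2 / y * arctan (R / y)) + 2 * B * pi * R / (R\<^sup>2 - y\<^sup>2))"
      using 2 by (intro mult_left_mono) auto
    also have "\<dots> = (1 + r\<^sup>2 / y\<^sup>2) * (y * h * (2 * arctan (R / y)) + y\<^sup>2 * (2 * B * pi * R / (R\<^sup>2 - y\<^sup>2)))"
      using y by (simp add: field_simps power2_eq_square)
    finally show ?thesis by (simp add: h_def)
  qed
  have est2: "integral {-r..r} g \<le> (1 + r\<^sup>2 / y\<^sup>2) * (y * Re (f (\<i> * of_real y)) * pi)" if r: "0 < r" and y: "0 < y" for r y
  proof (rule tendsto_lowerbound)
    show "((\<lambda>R. (1 + r\<^sup>2 / y\<^sup>2) * (y * Re (f (\<i> * of_real y)) * (2 * arctan (R / y)) + y\<^sup>2 * (2 * B * pi * R / (R\<^sup>2 - y\<^sup>2)))) \<longlongrightarrow> (1 + r\<^sup>2 / y\<^sup>2) * (y * Re (f (\<i> * of_real y)) * pi)) at_top"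
    proof -
      have "((\<lambda>R. arctan (R / y)) \<longlongrightarrow> pi / 2) at_top"
        by (rule filterlim_compose[OF tendsto_arctan_at_top]) (use y in real_asymp)
      moreover have "((\<lambda>R. 2 * B * pi * R / (R\<^sup>2 - y\<^sup>2)) \<longlongrightarrow> 0) at_top" by real_asymp
      ultimately have "((\<lambda>R. (1 + r\<^sup>2 / y\<^sup>2) * (y * Re (f (\<i> * of_real y)) * (2 * arctan (R / y)) + y\<^sup>2 * (2 * B * pi * R / (R\<^sup>2 - y\<^sup>2))))
        \<longlongrightarrow> (1 + r\<^sup>2 / y\<^sup>2) * (y * Re (f (\<i> * of_real y)) * (2 * (pi / 2)) + y\<^sup>2 * 0)) at_top"
        by (intro tendsto_mult tendsto_add tendsto_const)
      then show ?thesis by simp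
    qed
    show "\<forall>\<^sub>F R in at_top. integral {-r..r} g \<le> (1 + r\<^sup>2 / y\<^sup>2) * (y * Re (f (\<i> * of_real y)) * (2 * arctan (R / y)) + y\<^sup>2 * (2 * B * pi * R / (R\<^sup>2 - y\<^sup>2)))"
      using eventually_ge_at_top[of "r + y + 1"] by eventually_elim (rule est, use r y in auto)
  qed simp
  have est3: "integral {-r..r} g \<le> pi * c" if r: "0 < r" for r
  proof (rule tendsto_lowerbound)
    show "((\<lambda>y. (1 + r\<^sup>2 / y\<^sup>2) * ((c + K / y) * pi)) \<longlongrightarrow> pi * c) at_top" by real_asymp
    show "\<forall>\<^sub>F y in at_top. integral {-r..r} g \<le> (1 + r\<^sup>2 / y\<^sup>2) * ((c + K / y) * pi)"
      using eventually_ge_at_top[of 1]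
    proof eventually_elim
      case (elim y)
      have "(1 + r\<^sup>2 / y\<^sup>2) * (y * Re (f (\<i> * of_real y)) * pi) \<le> (1 + r\<^sup>2 / y\<^sup>2) * ((c + K / y) * pi)"
        using asym[OF elim] by (intro mult_left_mono mult_right_mono) auto
      then show ?case using est2[OF r, of y] elim by simp
    qed
  qed simp
  have nng: "0 \<le> g x" for x using pos by (simp add: g_def)
  have [measurable]: "g \<in> borel_measurable borel" by (rule borel_measurable_continuous_onI[OF cg])
  have "(\<integral>\<^sup>+x. ennreal (g x) \<partial>lborel) = (\<integral>\<^sup>+x. (SUP n. ennreal (g x) * indicator {-real n..real n} x) \<partial>lborel)"
  proof (rule nn_integral_cong)
    fix x
    obtain n where n: "\<bar>x\<bar> \<le> real n" using real_arch_simple by blast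
    show "ennreal (g x) = (SUP n. ennreal (g x) * indicator {-real n..real n} x)"
      by (rule antisym, rule SUP_upper2[of n]) (use n in \<open>auto intro!: SUP_least simp: indicator_def\<close>)
  qed
  also have "\<dots> = (SUP n. \<integral>\<^sup>+x. ennreal (g x) * indicator {-real n..real n} x \<partial>lborel)"
    by (rule nn_integral_monotone_convergence_SUP) (auto simp: incseq_def le_fun_def indicator_def)
  also have "\<dots> \<le> ennreal (pi * c)"
  proof (rule SUP_least)
    fix n :: nat
    have "(g has_integral integral {-real (Suc n)..real (Suc n)} g) {-real (Suc n)..real (Suc n)}"
      by (intro integrable_integral integrable_continuous_real cg)
    then have "(\<integral>\<^sup>+x. ennreal (g x) * indicator {-real (Suc n)..real (Suc n)} x \<partial>lborel) = ennreal (integral {-real (Suc n)..real (Suc n)} g)"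
      using nng by (intro nn_integral_has_integral_lebesgue')
    also have "\<dots> \<le> ennreal (pi * c)" by (intro ennreal_leI est3) simp
    finally have "(\<integral>\<^sup>+x. ennreal (g x) * indicator {-real (Suc n)..real (Suc n)} x \<partial>lborel) \<le> ennreal (pi * c)" .
    moreover have "(\<integral>\<^sup>+x. ennreal (g x) * indicator {-real n..real n} x \<partial>lborel) \<le> (\<integral>\<^sup>+x. ennreal (g x) * indicator {-real (Suc n)..real (Suc n)} x \<partial>lborel)"
      by (rule nn_integral_mono) (auto simp: indicator_def)
    ultimately show "(\<integral>\<^sup>+x. ennreal (g x) * indicator {-real n..real n} x \<partial>lborel) \<le> ennreal (pi * c)" by simp
  qed
  finally show ?thesis by (simp add: g_def)
qed

section \<open>Locally square integrable functions\<close>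

text \<open>
  Square integrability on compact intervals is the class in which the coefficients live: it is
  stable under multiplication by continuous functions, and products of two members are integrable.
\<close>

definition l2loc :: "real \<Rightarrow> (real \<Rightarrow> complex) \<Rightarrow> bool" where
  "l2loc \<tau> f \<longleftrightarrow> (\<forall>t\<ge>\<tau>. f \<in> borel_measurable (lebesgue_on {\<tau>..t}) \<and>
      (\<lambda>s. (cmod (f s))\<^sup>2) integrable_on {\<tau>..t})"

lemma l2locD:
  assumes "l2loc \<tau> f" "\<tau> \<le> t"
  shows "f \<in> borel_measurable (lebesgue_on {\<tau>..t})" "(\<lambda>s. (cmod (f s))\<^sup>2) integrable_on {\<tau>..t}"
  using assms by (auto simp: l2loc_def)

lemma l2loc_bound:
  assumes "\<And>t. \<tau> \<le> t \<Longrightarrow> f \<in> borel_measurable (lebesgue_on {\<tau>..t})"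
    and "\<And>t. \<tau> \<le> t \<Longrightarrow> g t integrable_on {\<tau>..t}"
    and "\<And>t s. \<tau> \<le> s \<Longrightarrow> s \<le> t \<Longrightarrow> (cmod (f s))\<^sup>2 \<le> g t s"
  shows "l2loc \<tau> f"
  unfolding l2loc_def
proof (intro allI impI conjI)
  fix t assume t: "\<tau> \<le> t"
  show m: "f \<in> borel_measurable (lebesgue_on {\<tau>..t})" using assms t by blast
  show "(\<lambda>s. (cmod (f s))\<^sup>2) integrable_on {\<tau>..t}"
    by (rule measurable_bounded_by_integrable_imp_integrable[OF _ assms(2)[OF t]])
       (use m assms(3) t in \<open>auto\<close>)
qed

lemma l2loc_add:
  assumes "l2loc \<tau> f" "l2loc \<tau> g"
  shows "l2loc \<tau> (\<lambda>t. f t + g t)"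
proof (rule l2loc_bound[where g = "\<lambda>t s. 2 * (cmod (f s))\<^sup>2 + 2 * (cmod (g s))\<^sup>2"])
  fix t s
  have "(cmod (f s + g s))\<^sup>2 \<le> (cmod (f s) + cmod (g s))\<^sup>2"
    by (simp add: norm_triangle_ineq power_mono)
  also have "\<dots> \<le> 2 * (cmod (f s))\<^sup>2 + 2 * (cmod (g s))\<^sup>2"
    using zero_le_power2[of "cmod (f s) - cmod (g s)"] by (simp add: power2_eq_square algebra_simps)
  finally show "(cmod (f s + g s))\<^sup>2 \<le> 2 * (cmod (f s))\<^sup>2 + 2 * (cmod (g s))\<^sup>2" .
qed (use assms in \<open>auto simp: l2loc_def intro!: integrable_add integrable_on_mult_right borel_measurable_add\<close>)

lemma l2loc_zero: "l2loc \<tau> (\<lambda>t. 0)"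
  by (auto simp: l2loc_def)

lemma l2loc_sum:
  assumes "\<And>i. i \<in> A \<Longrightarrow> l2loc \<tau> (f i)"
  shows "l2loc \<tau> (\<lambda>t. \<Sum>i\<in>A. f i t)"
  using assms by (induction A rule: infinite_finite_induct) (auto intro: l2loc_zero l2loc_add)

lemma l2loc_mult:
  assumes "l2loc \<tau> f" "\<And>t. continuous_on {\<tau>..t} g"
  shows "l2loc \<tau> (\<lambda>t. f t * g t)"
proof -
  have "\<exists>B. \<forall>s\<in>{\<tau>..t}. (cmod (g s))\<^sup>2 \<le> B" for t
  proof -
    have "compact ((\<lambda>s. (cmod (g s))\<^sup>2) ` {\<tau>..t})"
      using assms(2) by (intro compact_continuous_image continuous_intros) auto
    then have "bounded ((\<lambda>s. (cmod (g s))\<^sup>2) ` {\<tau>..t})" by (rule compact_imp_bounded)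
    then show ?thesis by (force simp: bounded_iff)
  qed
  then obtain B where B: "\<And>t s. s \<in> {\<tau>..t} \<Longrightarrow> (cmod (g s))\<^sup>2 \<le> B t" by metis
  show ?thesis
  proof (rule l2loc_bound[where g = "\<lambda>t s. (cmod (f s))\<^sup>2 * B t"])
    fix t s assume "\<tau> \<le> s" "s \<le> t"
    then show "(cmod (f s * g s))\<^sup>2 \<le> (cmod (f s))\<^sup>2 * B t"
      using B[of s t] by (simp add: norm_mult power_mult_distrib mult_left_mono)
  next
    fix t assume "\<tau> \<le> t"
    then show "(\<lambda>t. f t * g t) \<in> borel_measurable (lebesgue_on {\<tau>..t})"
      using assms by (intro borel_measurable_times) (auto simp: l2loc_def continuous_imp_measurable_on_sets_lebesgue)
  qed (use assms in \<open>auto simp: l2loc_def intro!: integrable_on_mult_left\<close>)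
qed

lemma l2loc_cmult: "l2loc \<tau> f \<Longrightarrow> l2loc \<tau> (\<lambda>t. c * f t)"
  using l2loc_mult[of \<tau> f "\<lambda>_. c"] by (simp add: mult.commute)

lemma l2loc_continuous:
  assumes "\<And>t. continuous_on {\<tau>..t} g"
  shows "l2loc \<tau> g"
  unfolding l2loc_def using assms
  by (auto intro!: continuous_imp_measurable_on_sets_lebesgue integrable_continuous_real continuous_intros)

lemma l2loc_norm: "l2loc \<tau> f \<Longrightarrow> l2loc \<tau> (\<lambda>t. complex_of_real (cmod (f t)))"
  unfolding l2loc_def by auto

lemma l2loc_restart:
  assumes "l2loc \<tau> f" "\<tau> \<le> \<sigma>"
  shows "l2loc \<sigma> f"
  unfolding l2loc_def
proof (intro allI impI conjI)
  fix t assume t: "\<sigma> \<le> t"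
  then have a: "f \<in> borel_measurable (lebesgue_on {\<tau>..t})" "(\<lambda>s. (cmod (f s))\<^sup>2) integrable_on {\<tau>..t}"
    using assms by (auto simp: l2loc_def)
  show "f \<in> borel_measurable (lebesgue_on {\<sigma>..t})"
    by (rule measurable_restrict_mono[OF a(1)]) (use assms in auto)
  show "(\<lambda>s. (cmod (f s))\<^sup>2) integrable_on {\<sigma>..t}"
    using a(2) by (rule integrable_subinterval_real) (use assms in auto)
qed

lemma l2loc_prod_ai:
  assumes "l2loc \<tau> f" "l2loc \<tau> g" "\<tau> \<le> t"
  shows "(\<lambda>s. f s * g s) absolutely_integrable_on {\<tau>..t}"
proof (rule measurable_bounded_by_integrable_imp_absolutely_integrable)
  note a = l2locD[OF assms(1,3)] l2locD[OF assms(2,3)]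
  show "(\<lambda>s. (cmod (f s))\<^sup>2 + (cmod (g s))\<^sup>2) integrable_on {\<tau>..t}"
    using a by (intro integrable_add)
  show "(\<lambda>s. f s * g s) \<in> borel_measurable (lebesgue_on {\<tau>..t})"
    using a by (intro borel_measurable_times)
  fix s
  have "2 * (cmod (f s) * cmod (g s)) \<le> (cmod (f s))\<^sup>2 + (cmod (g s))\<^sup>2"
    using zero_le_power2[of "cmod (f s) - cmod (g s)"] by (simp add: power2_eq_square algebra_simps)
  moreover have "0 \<le> cmod (f s) * cmod (g s)" by simp
  ultimately show "cmod (f s * g s) \<le> (cmod (f s))\<^sup>2 + (cmod (g s))\<^sup>2"
    unfolding norm_mult by linarith
qed auto

lemma l2loc_ai:
  assumes "l2loc \<tau> f" "\<tau> \<le> t"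
  shows "f absolutely_integrable_on {\<tau>..t}"
  using l2loc_prod_ai[OF assms(1) l2loc_continuous[of \<tau> "\<lambda>_. 1"] assms(2)] by simp

lemma l2loc_prod_norm_integrable:
  assumes "l2loc \<tau> f" "l2loc \<tau> g" "\<tau> \<le> t"
  shows "(\<lambda>s. cmod (f s) * cmod (g s)) integrable_on {\<tau>..t}"
  using l2loc_prod_ai[OF assms] by (simp add: absolutely_integrable_on_def norm_mult)

lemma integral_Cauchy_Schwarz:
  fixes f g :: "real \<Rightarrow> real"
  assumes "(\<lambda>s. (f s)\<^sup>2) integrable_on S" "(\<lambda>s. (g s)\<^sup>2) integrable_on S" "(\<lambda>s. f s * g s) integrable_on S"
  shows "(integral S (\<lambda>s. f s * g s))\<^sup>2 \<le> integral S (\<lambda>s. (f s)\<^sup>2) * integral S (\<lambda>s. (g s)\<^sup>2)"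
proof -
  define A B C where "A = integral S (\<lambda>s. (f s)\<^sup>2)" and "B = integral S (\<lambda>s. (g s)\<^sup>2)"
    and "C = integral S (\<lambda>s. f s * g s)"
  \<comment> \<open>the quadratic \<open>A x\<^sup>2 - 2 C x + B\<close> is nonnegative\<close>
  have q: "2 * x * C \<le> x\<^sup>2 * A + B" for x
  proof -
    have "integral S (\<lambda>s. 2 * x * (f s * g s)) \<le> integral S (\<lambda>s. x\<^sup>2 * (f s)\<^sup>2 + (g s)\<^sup>2)"
    proof (rule integral_le)
      fix s show "2 * x * (f s * g s) \<le> x\<^sup>2 * (f s)\<^sup>2 + (g s)\<^sup>2"
        using zero_le_power2[of "x * f s - g s"] by (simp add: power2_eq_square algebra_simps)
    qed (use assms in \<open>auto intro!: integrable_on_mult_right integrable_add\<close>)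
    then show ?thesis
      using assms by (simp add: A_def B_def C_def integral_add integrable_on_mult_right)
  qed
  have A0: "A \<ge> 0" unfolding A_def by (rule integral_nonneg[OF assms(1)]) simp
  have "C\<^sup>2 \<le> A * B"
  proof (cases "A = 0")
    case True
    have "C = 0"
    proof (rule ccontr)
      assume "C \<noteq> 0"
      then have "2 * ((B + 1) / (2 * C)) * C = B + 1" by simp
      then show False using q[of "(B + 1) / (2 * C)"] True by simp
    qed
    then show ?thesis using True by simp
  next
    case False
    then show ?thesis using q[of "C / A"] A0 by (simp add: field_simps power2_eq_square)
  qed
  then show ?thesis by (simp add: A_def B_def C_def)
qed

lemma norm_sum_mult_le:
  fixes a b :: "'i \<Rightarrow> complex"
  shows "(cmod (\<Sum>i\<in>A. a i * b i))\<^sup>2 \<le> (\<Sum>i\<in>A. (cmod (a i))\<^sup>2) * (\<Sum>i\<in>A. (cmod (b i))\<^sup>2)"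
proof -
  have "cmod (\<Sum>i\<in>A. a i * b i) \<le> (\<Sum>i\<in>A. cmod (a i) * cmod (b i))"
    by (intro order.trans[OF norm_sum]) (simp add: norm_mult)
  then have "(cmod (\<Sum>i\<in>A. a i * b i))\<^sup>2 \<le> (\<Sum>i\<in>A. cmod (a i) * cmod (b i))\<^sup>2"
    by (intro power_mono) auto
  also have "\<dots> \<le> (\<Sum>i\<in>A. (cmod (a i))\<^sup>2) * (\<Sum>i\<in>A. (cmod (b i))\<^sup>2)"
    by (rule Cauchy_Schwarz_ineq_sum)
  finally show ?thesis .
qed

lemma cnj_mult_self: "cnj z * z = of_real ((cmod z)\<^sup>2)"
  by (metis complex_norm_square mult.commute)

section \<open>Hermitian systems with a spectral parameter\<close>

text \<open>
  The abstract model \<open>u' = \<i> (k L + W) u\<close> on functions on a finite index set, with the nonnegative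
  diagonal part \<open>L\<close> scaled by the spectral parameter.  It is used for the one-particle system, for
  the \<open>2 \<times> 2\<close> system of \<open>\<Psi>\<close>, and for the exterior powers.
\<close>

locale hermitian_system =
  fixes I :: "'i set" and L :: "'i \<Rightarrow> real" and W :: "real \<Rightarrow> 'i \<Rightarrow> 'i \<Rightarrow> complex" and \<tau> :: real
  assumes fin: "finite I"
    and L_nonneg: "\<And>i. i \<in> I \<Longrightarrow> 0 \<le> L i"
    and herm: "\<And>i m t. i \<in> I \<Longrightarrow> m \<in> I \<Longrightarrow> \<tau> \<le> t \<Longrightarrow> W t m i = cnj (W t i m)"
    and W_l2: "\<And>i m. i \<in> I \<Longrightarrow> m \<in> I \<Longrightarrow> l2loc \<tau> (\<lambda>t. W t i m)"
begin

definition rhs :: "complex \<Rightarrow> real \<Rightarrow> ('i \<Rightarrow> complex) \<Rightarrow> 'i \<Rightarrow> complex" where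
  "rhs k t v i = \<i> * (k * of_real (L i) * v i + (\<Sum>m\<in>I. W t i m * v m))"

definition evol :: "complex \<Rightarrow> (real \<Rightarrow> 'i \<Rightarrow> complex) \<Rightarrow> bool" where
  "evol k u \<longleftrightarrow> (\<forall>i\<in>I. primitive \<tau> (\<lambda>t. u t i) (\<lambda>t. rhs k t (u t) i))"

lemma evolD: "evol k u \<Longrightarrow> i \<in> I \<Longrightarrow> primitive \<tau> (\<lambda>t. u t i) (\<lambda>t. rhs k t (u t) i)"
  by (simp add: evol_def)

lemma evol_continuous: "evol k u \<Longrightarrow> i \<in> I \<Longrightarrow> continuous_on {\<tau>..t} (\<lambda>t. u t i)"
  using primitive_continuous[OF evolD] .

lemma Wu_l2:
  assumes "\<And>i t. i \<in> I \<Longrightarrow> continuous_on {\<tau>..t} (\<lambda>t. u t i)" "i \<in> I"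
  shows "l2loc \<tau> (\<lambda>t. \<Sum>m\<in>I. W t i m * u t m)"
  using assms by (intro l2loc_sum l2loc_mult W_l2)

lemma rhs_l2:
  assumes "\<And>i t. i \<in> I \<Longrightarrow> continuous_on {\<tau>..t} (\<lambda>t. u t i)" "i \<in> I"
  shows "l2loc \<tau> (\<lambda>t. rhs k t (u t) i)"
  unfolding rhs_def using assms
  by (intro l2loc_cmult l2loc_add Wu_l2) (auto intro!: l2loc_continuous)

text \<open>
  The contributions of \<open>W\<close> to the derivative of the inner product cancel because \<open>W\<close> is Hermitian;
  those of \<open>L\<close> combine to \<open>k - cnj k'\<close>.
\<close>

lemma inner_primitive:
  assumes "evol k u" "evol k' v"
  shows "primitive \<tau> (\<lambda>t. \<Sum>i\<in>I. cnj (v t i) * u t i)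
          (\<lambda>t. \<i> * (k - cnj k') * (\<Sum>i\<in>I. of_real (L i) * (cnj (v t i) * u t i)))"
proof (rule primitive_cong)
  show "primitive \<tau> (\<lambda>t. \<Sum>i\<in>I. cnj (v t i) * u t i)
     (\<lambda>t. \<Sum>i\<in>I. cnj (rhs k' t (v t) i) * u t i + cnj (v t i) * rhs k t (u t) i)"
    using assms by (intro primitive_sum primitive_mult primitive_cnj evolD)
  fix t assume t: "\<tau> \<le> t"
  have "cnj (rhs k' t (v t) i) * u t i + cnj (v t i) * rhs k t (u t) i
     = \<i> * (k - cnj k') * (of_real (L i) * (cnj (v t i) * u t i)) +
       \<i> * ((\<Sum>m\<in>I. cnj (v t i) * W t i m * u t m) - (\<Sum>m\<in>I. cnj (v t m) * cnj (W t i m) * u t i))" for i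
  proof -
    have "(\<Sum>m\<in>I. cnj (v t i) * W t i m * u t m) = cnj (v t i) * (\<Sum>m\<in>I. W t i m * u t m)"
      by (simp add: sum_distrib_left mult_ac)
    moreover have "(\<Sum>m\<in>I. cnj (v t m) * cnj (W t i m) * u t i) = cnj (\<Sum>m\<in>I. W t i m * v t m) * u t i"
      by (simp add: sum_distrib_left sum_distrib_right mult_ac)
    ultimately show ?thesis by (simp add: rhs_def algebra_simps)
  qed
  then have "(\<Sum>i\<in>I. cnj (rhs k' t (v t) i) * u t i + cnj (v t i) * rhs k t (u t) i)
     = (\<Sum>i\<in>I. \<i> * (k - cnj k') * (of_real (L i) * (cnj (v t i) * u t i))) +
       \<i> * ((\<Sum>i\<in>I. \<Sum>m\<in>I. cnj (v t i) * W t i m * u t m) - (\<Sum>i\<in>I. \<Sum>m\<in>I. cnj (v t m) * cnj (W t i m) * u t i))"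
    by (simp only: sum.distrib sum_subtractf flip: sum_distrib_left)
  also have "(\<Sum>i\<in>I. \<Sum>m\<in>I. cnj (v t m) * cnj (W t i m) * u t i) = (\<Sum>m\<in>I. \<Sum>i\<in>I. cnj (v t m) * cnj (W t i m) * u t i)"
    by (rule sum.swap)
  also have "\<dots> = (\<Sum>m\<in>I. \<Sum>i\<in>I. cnj (v t m) * W t m i * u t i)"
    by (intro sum.cong refl) (metis herm t)
  finally show "(\<Sum>i\<in>I. cnj (rhs k' t (v t) i) * u t i + cnj (v t i) * rhs k t (u t) i)
     = \<i> * (k - cnj k') * (\<Sum>i\<in>I. of_real (L i) * (cnj (v t i) * u t i))"
    by (simp add: sum_distrib_left)
qed simp

lemma inner_conserved:
  assumes "evol (of_real k) u" "evol (of_real k) v" "\<tau> \<le> t"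
  shows "(\<Sum>i\<in>I. cnj (v t i) * u t i) = (\<Sum>i\<in>I. cnj (v \<tau> i) * u \<tau> i)"
  using primitiveD(2)[OF inner_primitive[OF assms(1,2)] assms(3)] by simp

text \<open>
  For \<open>k' = k\<close> the factor in \<open>inner_primitive\<close> is \<open>- 2 Im k\<close>, so the squared norm decreases at the rate
  \<open>2 Im k \<Sum>L\<^sub>i cmod (u\<^sub>i)\<^sup>2\<close>.
\<close>

lemma norm_antimono:
  assumes "evol k u" "0 \<le> Im k" "\<tau> \<le> t"
  shows "(\<Sum>i\<in>I. (cmod (u t i))\<^sup>2) \<le> (\<Sum>i\<in>I. (cmod (u \<tau> i))\<^sup>2)"
proof -
  define F where "F = (\<lambda>t. \<i> * (k - cnj k) * (\<Sum>i\<in>I. of_real (L i) * (cnj (u t i) * u t i)))"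
  have e: "(\<Sum>i\<in>I. cnj (u t i) * u t i) = of_real (\<Sum>i\<in>I. (cmod (u t i))\<^sup>2)" for t
    by (simp only: cnj_mult_self of_real_sum)
  have F: "F s = of_real (- 2 * Im k * (\<Sum>i\<in>I. L i * (cmod (u s i))\<^sup>2))" for s
  proof -
    have "\<i> * (k - cnj k) = of_real (- 2 * Im k)" by (simp add: complex_eq_iff)
    moreover have "(\<Sum>i\<in>I. of_real (L i) * (cnj (u s i) * u s i)) = of_real (\<Sum>i\<in>I. L i * (cmod (u s i))\<^sup>2)"
      by (simp only: cnj_mult_self of_real_sum of_real_mult)
    ultimately show ?thesis unfolding F_def by simp
  qed
  note p = primitiveD[OF inner_primitive[OF assms(1,1)] assms(3), folded F_def, unfolded e]
  have "Re (integral {\<tau>..t} F) = integral {\<tau>..t} (\<lambda>s. Re (F s))"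
    using integral_linear[OF _ bounded_linear_Re, of F "{\<tau>..t}"] p(1)
    by (simp add: o_def absolutely_integrable_on_def)
  also have "\<dots> \<le> 0"
  proof -
    have "integral {\<tau>..t} (\<lambda>s. Re (F s)) \<le> integral {\<tau>..t} (\<lambda>s. 0)"
    proof (rule integral_le)
      show "(\<lambda>s. Re (F s)) integrable_on {\<tau>..t}"
        using integrable_linear[OF _ bounded_linear_Re, of F "{\<tau>..t}"] p(1)
        by (simp add: o_def absolutely_integrable_on_def)
      fix s assume "s \<in> {\<tau>..t}"
      have "0 \<le> (\<Sum>i\<in>I. L i * (cmod (u s i))\<^sup>2)" by (intro sum_nonneg mult_nonneg_nonneg L_nonneg) auto
      then show "Re (F s) \<le> 0" using assms(2) unfolding F by (simp add: mult_nonneg_nonneg)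
    qed auto
    then show ?thesis by simp
  qed
  finally have "Re (of_real (\<Sum>i\<in>I. (cmod (u t i))\<^sup>2)) \<le> Re (of_real (\<Sum>i\<in>I. (cmod (u \<tau> i))\<^sup>2))"
    unfolding p(2) by simp
  then show ?thesis by simp
qed

lemma norm_conserved:
  assumes "evol (of_real k) u" "\<tau> \<le> t"
  shows "(\<Sum>i\<in>I. (cmod (u t i))\<^sup>2) = (\<Sum>i\<in>I. (cmod (u \<tau> i))\<^sup>2)"
proof -
  have e: "(\<Sum>i\<in>I. cnj (u t i) * u t i) = of_real (\<Sum>i\<in>I. (cmod (u t i))\<^sup>2)" for t
    by (simp only: cnj_mult_self of_real_sum)
  show ?thesis using inner_conserved[OF assms(1,1,2)] unfolding e by (simp only: of_real_eq_iff)
qed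

lemma evol_linear:
  assumes "evol k u" "evol k v"
  shows "evol k (\<lambda>t i. a * u t i + b * v t i)"
  unfolding evol_def
proof
  fix i assume i: "i \<in> I"
  have "primitive \<tau> (\<lambda>t. a * u t i + b * v t i) (\<lambda>t. a * rhs k t (u t) i + b * rhs k t (v t) i)"
    using assms i by (intro primitive_add primitive_cmult evolD)
  moreover have "a * rhs k t (u t) i + b * rhs k t (v t) i = rhs k t (\<lambda>i. a * u t i + b * v t i) i" for t
    by (simp add: rhs_def algebra_simps sum.distrib sum_distrib_left)
  ultimately show "primitive \<tau> (\<lambda>t. a * u t i + b * v t i) (\<lambda>t. rhs k t (\<lambda>i. a * u t i + b * v t i) i)"
    by simp
qed

lemma evol_unique:
  assumes "evol k u" "evol k v" "0 \<le> Im k" "\<tau> \<le> t" "\<And>i. i \<in> I \<Longrightarrow> u \<tau> i = v \<tau> i" "i \<in> I"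
  shows "u t i = v t i"
proof -
  have "(\<Sum>i\<in>I. (cmod (1 * u t i + (-1) * v t i))\<^sup>2) \<le> (\<Sum>i\<in>I. (cmod (1 * u \<tau> i + (-1) * v \<tau> i))\<^sup>2)"
    by (rule norm_antimono[OF evol_linear[OF assms(1,2)] assms(3,4)])
  also have "\<dots> = 0" using assms(5) by simp
  finally have "(\<Sum>i\<in>I. (cmod (1 * u t i + (-1) * v t i))\<^sup>2) = 0"
    by (intro antisym sum_nonneg) auto
  then have "(cmod (1 * u t i + (-1) * v t i))\<^sup>2 = 0"
    using fin assms(6) by (subst (asm) sum_nonneg_eq_0_iff) auto
  then show ?thesis by simp
qed

end

section \<open>Solutions that are entire in the spectral parameter\<close>

context hermitian_system
begin

text \<open>
  A bound for the norm of the generator, in the sum norm, for all \<open>k\<close> with \<open>cmod k \<le> R\<close>.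
\<close>

definition gen_bound :: "real \<Rightarrow> real \<Rightarrow> real" where
  "gen_bound R s = (\<Sum>i\<in>I. \<Sum>m\<in>I. cmod (W s i m)) + R * (\<Sum>i\<in>I. L i)"

lemma gen_bound_l2: "l2loc \<tau> (\<lambda>s. of_real (gen_bound R s))"
proof -
  have "l2loc \<tau> (\<lambda>s. (\<Sum>i\<in>I. \<Sum>m\<in>I. of_real (cmod (W s i m))) + of_real (R * (\<Sum>i\<in>I. L i)))"
    by (intro l2loc_add l2loc_sum l2loc_norm W_l2 l2loc_continuous) auto
  then show ?thesis by (simp add: gen_bound_def)
qed

lemma gen_bound_nonneg: "0 \<le> R \<Longrightarrow> 0 \<le> gen_bound R s"
  unfolding gen_bound_def by (intro add_nonneg_nonneg sum_nonneg mult_nonneg_nonneg L_nonneg) auto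

lemma norm_rhs_le:
  assumes "cmod k \<le> R"
  shows "(\<Sum>i\<in>I. cmod (rhs k s v i)) \<le> gen_bound R s * (\<Sum>i\<in>I. cmod (v i))"
proof -
  define P where "P = (\<Sum>i\<in>I. cmod (v i))"
  have vP: "cmod (v i) \<le> P" if "i \<in> I" for i
    unfolding P_def using that fin by (intro member_le_sum) auto
  have "cmod (rhs k s v i) \<le> ((\<Sum>m\<in>I. cmod (W s i m)) + R * L i) * P" if i: "i \<in> I" for i
  proof -
    have "cmod (rhs k s v i) \<le> cmod (k * of_real (L i) * v i) + (\<Sum>m\<in>I. cmod (W s i m * v m))"
      unfolding rhs_def norm_mult[of \<i>] norm_ii mult_1
      by (rule order.trans[OF norm_triangle_ineq]) (intro add_left_mono norm_sum)
    also have "\<dots> \<le> R * L i * P + (\<Sum>m\<in>I. cmod (W s i m) * P)"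
      unfolding norm_mult using assms L_nonneg[OF i] vP i
      by (intro add_mono sum_mono mult_mono) (auto intro: mult_nonneg_nonneg order.trans[OF norm_ge_zero assms])
    finally show ?thesis by (simp add: algebra_simps sum_distrib_left sum_distrib_right)
  qed
  then have "(\<Sum>i\<in>I. cmod (rhs k s v i)) \<le> (\<Sum>i\<in>I. ((\<Sum>m\<in>I. cmod (W s i m)) + R * L i) * P)"
    by (rule sum_mono)
  also have "\<dots> = gen_bound R s * P"
    by (simp add: gen_bound_def sum_distrib_left sum_distrib_right algebra_simps sum.distrib)
  finally show ?thesis by (simp add: P_def)
qed

text \<open>
  The terms of the Dyson series.  The term of order \<open>n\<close> is a polynomial of degree at most \<open>n\<close> in \<open>k\<close>,
  which is why the sum is entire in \<open>k\<close> although the coefficients are merely square integrable in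
  time.
\<close>

primrec dyson :: "('i \<Rightarrow> complex) \<Rightarrow> nat \<Rightarrow> complex \<Rightarrow> real \<Rightarrow> 'i \<Rightarrow> complex" where
  "dyson a 0 k t i = a i"
| "dyson a (Suc n) k t i = integral {\<tau>..t} (\<lambda>s. rhs k s (dyson a n k s) i)"

lemma continuous_integral_l2:
  assumes "l2loc \<tau> g"
  shows "continuous_on {\<tau>..t} (\<lambda>t. integral {\<tau>..t} g)"
proof (cases "\<tau> \<le> t")
  case True
  then show ?thesis using l2loc_ai[OF assms True]
    by (intro indefinite_integral_continuous_1) (simp add: absolutely_integrable_on_def)
qed simp

lemma dyson_continuous: "i \<in> I \<Longrightarrow> continuous_on {\<tau>..t} (\<lambda>t. dyson a n k t i)"
proof (induction n arbitrary: i t)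
  case (Suc n)
  show ?case unfolding dyson.simps
    by (intro continuous_integral_l2 rhs_l2 Suc)
qed auto

lemma dyson_poly:
  "\<exists>c. (\<forall>m i t. i \<in> I \<longrightarrow> continuous_on {\<tau>..t} (\<lambda>t. c m t i)) \<and>
       (\<forall>k t i. \<tau> \<le> t \<longrightarrow> i \<in> I \<longrightarrow> dyson a n k t i = (\<Sum>m\<le>n. c m t i * k ^ m))"
proof (induction n)
  case 0
  show ?case by (rule exI[of _ "\<lambda>m t. a"]) auto
next
  case (Suc n)
  then obtain c where cc: "\<And>m i t. i \<in> I \<Longrightarrow> continuous_on {\<tau>..t} (\<lambda>t. c m t i)"
    and c: "\<And>k t i. \<tau> \<le> t \<Longrightarrow> i \<in> I \<Longrightarrow> dyson a n k t i = (\<Sum>m\<le>n. c m t i * k ^ m)"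
    by blast
  \<comment> \<open>the coefficients of \<open>k ^ m\<close> that come from \<open>k L\<close> and from \<open>W\<close>\<close>
  define A where "A = (\<lambda>m s i. if m = 0 then 0 else \<i> * (of_real (L i) * c (m - 1) s i))"
  define B where "B = (\<lambda>m s i. if m \<le> n then \<i> * (\<Sum>p\<in>I. W s i p * c m s p) else 0)"
  have AB_l2: "l2loc \<tau> (\<lambda>s. A m s i + B m s i)" if i: "i \<in> I" for m i
  proof (rule l2loc_add)
    show "l2loc \<tau> (\<lambda>s. A m s i)" unfolding A_def
      by (cases "m = 0") (auto intro!: l2loc_zero l2loc_cmult l2loc_continuous continuous_intros cc i)
    show "l2loc \<tau> (\<lambda>s. B m s i)" unfolding B_def
      by (cases "m \<le> n") (auto intro!: l2loc_zero l2loc_cmult Wu_l2 cc i)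
  qed
  have rhs: "rhs k s (dyson a n k s) i = (\<Sum>m\<le>Suc n. (A m s i + B m s i) * k ^ m)"
    if s: "\<tau> \<le> s" and i: "i \<in> I" for k s i
  proof -
    have "(\<Sum>m\<le>Suc n. A m s i * k ^ m) = (\<Sum>m\<le>n. \<i> * (of_real (L i) * c m s i) * k ^ Suc m)"
      by (subst sum.atMost_Suc_shift) (simp add: A_def)
    also have "\<dots> = \<i> * (k * of_real (L i) * dyson a n k s i)"
      by (simp add: c[OF s i] sum_distrib_left mult_ac)
    finally have 1: "(\<Sum>m\<le>Suc n. A m s i * k ^ m) = \<i> * (k * of_real (L i) * dyson a n k s i)" .
    have "(\<Sum>m\<le>Suc n. B m s i * k ^ m) = (\<Sum>m\<le>n. \<Sum>p\<in>I. \<i> * (W s i p * c m s p) * k ^ m)"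
      by (simp add: B_def sum_distrib_left sum_distrib_right)
    also have "\<dots> = (\<Sum>p\<in>I. \<Sum>m\<le>n. \<i> * (W s i p * c m s p) * k ^ m)" by (rule sum.swap)
    also have "\<dots> = (\<Sum>p\<in>I. \<i> * (W s i p * dyson a n k s p))"
      by (intro sum.cong refl) (simp add: c[OF s] sum_distrib_left mult_ac)
    also have "\<dots> = \<i> * (\<Sum>p\<in>I. W s i p * dyson a n k s p)"
      by (simp add: sum_distrib_left)
    finally show ?thesis using 1 by (simp only: rhs_def sum.distrib distrib_right distrib_left)
  qed
  show ?case
  proof (intro exI[of _ "\<lambda>m t i. integral {\<tau>..t} (\<lambda>s. A m s i + B m s i)"] conjI allI impI)
    fix m i t assume "i \<in> I"
    then show "continuous_on {\<tau>..t} (\<lambda>t. integral {\<tau>..t} (\<lambda>s. A m s i + B m s i))"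
      by (intro continuous_integral_l2 AB_l2)
  next
    fix k t i assume t: "\<tau> \<le> t" and i: "i \<in> I"
    have "dyson a (Suc n) k t i = integral {\<tau>..t} (\<lambda>s. \<Sum>m\<le>Suc n. (A m s i + B m s i) * k ^ m)"
      unfolding dyson.simps using rhs i by (intro integral_cong) auto
    also have "\<dots> = (\<Sum>m\<le>Suc n. integral {\<tau>..t} (\<lambda>s. (A m s i + B m s i) * k ^ m))"
      using l2loc_ai[OF AB_l2[OF i] t] 
      by (intro integral_sum integrable_on_mult_left) (auto simp: absolutely_integrable_on_def)
    also have "\<dots> = (\<Sum>m\<le>Suc n. integral {\<tau>..t} (\<lambda>s. A m s i + B m s i) * k ^ m)"
      by simp
    finally show "dyson a (Suc n) k t i = (\<Sum>m\<le>Suc n. integral {\<tau>..t} (\<lambda>s. A m s i + B m s i) * k ^ m)" .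
  qed
qed

lemma dyson_holomorphic:
  assumes "\<tau> \<le> t" "i \<in> I"
  shows "(\<lambda>k. dyson a n k t i) holomorphic_on S"
proof -
  obtain c where "\<And>k t i. \<tau> \<le> t \<Longrightarrow> i \<in> I \<Longrightarrow> dyson a n k t i = (\<Sum>m\<le>n. c m t i * k ^ m)"
    using dyson_poly[of a n] by blast
  then have "(\<lambda>k. dyson a n k t i) = (\<lambda>k. \<Sum>m\<le>n. c m t i * k ^ m)" using assms by auto
  then show ?thesis by (auto intro!: holomorphic_intros)
qed

text \<open>
  By Cauchy--Schwarz, \<open>p\<^sub>n\<^sub>+\<^sub>1(t)\<^sup>2 \<le> K \<integral>p\<^sub>n\<^sup>2\<close> for the sum norms \<open>p\<^sub>n\<close> of the terms, where \<open>K\<close> bounds the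
  integral of \<open>(gen_bound R)\<^sup>2\<close>.  With the weight \<open>exp (4 K (t - \<tau>))\<close> each integration gains a
  factor \<open>1/4\<close>, so the terms decay geometrically.
\<close>

lemma dyson_bound:
  assumes "0 \<le> R" "\<tau> \<le> T"
  shows "\<exists>M\<ge>0. \<forall>n k t. cmod k \<le> R \<longrightarrow> t \<in> {\<tau>..T} \<longrightarrow> (\<Sum>i\<in>I. cmod (dyson a n k t i)) \<le> M * (1/2) ^ n"
proof -
  \<comment> \<open>the summand \<open>1\<close> keeps \<open>K\<close> positive\<close>
  define K where "K = integral {\<tau>..T} (\<lambda>s. (gen_bound R s)\<^sup>2) + 1"
  define P where "P = (\<Sum>i\<in>I. cmod (a i))"
  have P0: "P \<ge> 0" by (simp add: P_def sum_nonneg)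
  have wt2: "(\<lambda>s. (gen_bound R s)\<^sup>2) integrable_on {\<tau>..t}" if "\<tau> \<le> t" for t
    using l2locD(2)[OF gen_bound_l2[of R] that] by simp
  have K: "integral {\<tau>..t} (\<lambda>s. (gen_bound R s)\<^sup>2) \<le> K" "K > 0" if "t \<in> {\<tau>..T}" for t
  proof -
    have "integral {\<tau>..t} (\<lambda>s. (gen_bound R s)\<^sup>2) \<le> integral {\<tau>..T} (\<lambda>s. (gen_bound R s)\<^sup>2)"
      using that by (intro integral_subset_le wt2) auto
    then show "integral {\<tau>..t} (\<lambda>s. (gen_bound R s)\<^sup>2) \<le> K" by (simp add: K_def)
    have "0 \<le> integral {\<tau>..T} (\<lambda>s. (gen_bound R s)\<^sup>2)" by (intro integral_nonneg wt2 assms) simp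
    then show "K > 0" by (simp add: K_def)
  qed
  then have K0: "K > 0" using assms by auto
  have main: "(\<Sum>i\<in>I. cmod (dyson a n k t i))\<^sup>2 \<le> P\<^sup>2 * (1/4) ^ n * exp (4 * K * (t - \<tau>))"
    if k: "cmod k \<le> R" and "t \<in> {\<tau>..T}" for n k t
    using that(2)
  proof (induction n arbitrary: t)
    case 0
    have "P\<^sup>2 * 1 \<le> P\<^sup>2 * exp (4 * K * (t - \<tau>))"
      using 0 K0 by (intro mult_left_mono) auto
    then show ?case by (simp add: P_def)
  next
    case (Suc n)
    define p where "p = (\<lambda>s. \<Sum>i\<in>I. cmod (dyson a n k s i))"
    have pc: "continuous_on {\<tau>..r} p" for r unfolding p_def
      by (intro continuous_intros dyson_continuous)
    have p0: "p s \<ge> 0" for s by (simp add: p_def sum_nonneg)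
    have t: "\<tau> \<le> t" using Suc by auto
    have ri: "(\<lambda>s. rhs k s (dyson a n k s) i) absolutely_integrable_on {\<tau>..t}" if "i \<in> I" for i
      by (intro l2loc_ai rhs_l2 dyson_continuous that t)
    have "l2loc \<tau> (\<lambda>s. of_real (p s))" by (intro l2loc_continuous continuous_intros pc)
    from l2loc_prod_norm_integrable[OF gen_bound_l2[of R] this t]
    have wp: "(\<lambda>s. gen_bound R s * p s) integrable_on {\<tau>..t}"
      using gen_bound_nonneg[OF assms(1)] p0 by simp
    have p2: "(\<lambda>s. (p s)\<^sup>2) integrable_on {\<tau>..t}"
      by (intro integrable_continuous_real continuous_intros pc)
    have "(\<Sum>i\<in>I. cmod (dyson a (Suc n) k t i)) \<le> (\<Sum>i\<in>I. integral {\<tau>..t} (\<lambda>s. cmod (rhs k s (dyson a n k s) i)))"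
      unfolding dyson.simps using ri
      by (intro sum_mono integral_norm_bound_integral) (auto simp: absolutely_integrable_on_def)
    also have "\<dots> = integral {\<tau>..t} (\<lambda>s. \<Sum>i\<in>I. cmod (rhs k s (dyson a n k s) i))"
      using ri fin by (intro integral_sum[symmetric]) (auto simp: absolutely_integrable_on_def)
    also have "\<dots> \<le> integral {\<tau>..t} (\<lambda>s. gen_bound R s * p s)"
      using ri fin wp norm_rhs_le[OF k] unfolding p_def
      by (intro integral_le integrable_sum) (auto simp: absolutely_integrable_on_def)
    finally have "(\<Sum>i\<in>I. cmod (dyson a (Suc n) k t i))\<^sup>2 \<le> (integral {\<tau>..t} (\<lambda>s. gen_bound R s * p s))\<^sup>2"
      by (intro power_mono sum_nonneg) auto
    also have "\<dots> \<le> integral {\<tau>..t} (\<lambda>s. (gen_bound R s)\<^sup>2) * integral {\<tau>..t} (\<lambda>s. (p s)\<^sup>2)"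
      by (intro integral_Cauchy_Schwarz wt2 t wp p2)
    also have "\<dots> \<le> K * integral {\<tau>..t} (\<lambda>s. (p s)\<^sup>2)"
      using K[OF Suc.prems] by (intro mult_right_mono integral_nonneg p2) auto
    also have "\<dots> \<le> K * (P\<^sup>2 * (1/4) ^ n * (exp (4 * K * (t - \<tau>)) / (4 * K)))"
    proof (intro mult_left_mono)
      have ex: "((\<lambda>s. P\<^sup>2 * (1/4) ^ n * exp (4 * K * (s - \<tau>))) has_integral
          P\<^sup>2 * (1/4) ^ n * (exp (4 * K * (t - \<tau>)) / (4 * K) - exp (4 * K * (\<tau> - \<tau>)) / (4 * K))) {\<tau>..t}"
        using t K0
        by (intro has_integral_mult_right fundamental_theorem_of_calculus)
           (auto intro!: derivative_eq_intros simp: has_real_derivative_iff_has_vector_derivative[symmetric])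
      have "integral {\<tau>..t} (\<lambda>s. (p s)\<^sup>2) \<le> P\<^sup>2 * (1/4) ^ n * (exp (4 * K * (t - \<tau>)) / (4 * K) - exp (4 * K * (\<tau> - \<tau>)) / (4 * K))"
        by (rule has_integral_le[OF integrable_integral[OF p2] ex])
           (use Suc in \<open>auto simp: p_def\<close>)
      also have "\<dots> \<le> P\<^sup>2 * (1/4) ^ n * (exp (4 * K * (t - \<tau>)) / (4 * K))"
        using K0 by (intro mult_left_mono) auto
      finally show "integral {\<tau>..t} (\<lambda>s. (p s)\<^sup>2) \<le> P\<^sup>2 * (1/4) ^ n * (exp (4 * K * (t - \<tau>)) / (4 * K))" .
    qed (use K0 in auto)
    also have "\<dots> = P\<^sup>2 * (1/4) ^ Suc n * exp (4 * K * (t - \<tau>))" using K0 by simp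
    finally show ?case .
  qed
  show ?thesis
  proof (intro exI[of _ "P * exp (2 * K * (T - \<tau>))"] conjI allI impI)
    show "0 \<le> P * exp (2 * K * (T - \<tau>))" using P0 by simp
    fix n k t assume k: "cmod k \<le> R" and t: "t \<in> {\<tau>..T}"
    have "(\<Sum>i\<in>I. cmod (dyson a n k t i))\<^sup>2 \<le> P\<^sup>2 * (1/4) ^ n * exp (4 * K * (T - \<tau>))"
      using main[OF k t, of n] t K0 
      by (elim order.trans) (intro mult_left_mono, auto)
    also have "\<dots> = (P * exp (2 * K * (T - \<tau>)) * (1/2) ^ n)\<^sup>2"
    proof -
      have "((1/2) ^ n)\<^sup>2 = (1/4::real) ^ n" by (simp add: power_divide power2_eq_square flip: power_mult_distrib)
      moreover have "(exp (2 * K * (T - \<tau>)))\<^sup>2 = exp (4 * K * (T - \<tau>))" by (simp flip: exp_double)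
      ultimately show ?thesis by (simp add: power_mult_distrib)
    qed
    finally show "(\<Sum>i\<in>I. cmod (dyson a n k t i)) \<le> P * exp (2 * K * (T - \<tau>)) * (1/2) ^ n"
      by (rule power2_le_imp_le) (use P0 in simp)
  qed
qed

lemma solution_exists:
  "\<exists>u :: complex \<Rightarrow> real \<Rightarrow> 'i \<Rightarrow> complex.
     (\<forall>k. evol k (u k)) \<and> (\<forall>k. \<forall>i\<in>I. u k \<tau> i = a i) \<and>
     (\<forall>t\<ge>\<tau>. \<forall>i\<in>I. (\<lambda>k. u k t i) holomorphic_on UNIV)"
proof -
  define u where "u = (\<lambda>k t i. \<Sum>n. dyson a n k t i)"
  have bnd: "\<exists>M\<ge>0. \<forall>n k t i. cmod k \<le> R \<longrightarrow> t \<in> {\<tau>..T} \<longrightarrow> i \<in> I \<longrightarrow> cmod (dyson a n k t i) \<le> M * (1/2) ^ n"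
    if RT: "0 \<le> R" "\<tau> \<le> T" for R T
  proof -
    obtain M where M: "M \<ge> 0" "\<And>n k t. cmod k \<le> R \<Longrightarrow> t \<in> {\<tau>..T} \<Longrightarrow> (\<Sum>i\<in>I. cmod (dyson a n k t i)) \<le> M * (1/2) ^ n"
      using dyson_bound[OF RT, of a] by blast
    have "cmod (dyson a n k t i) \<le> (\<Sum>i\<in>I. cmod (dyson a n k t i))" if "i \<in> I" for n k t i
      using that fin by (intro member_le_sum) auto
    then show ?thesis using M by (meson order.trans)
  qed
  have sm: "summable (\<lambda>n. M * (1/2) ^ n)" for M :: real
    by (intro summable_mult summable_geometric) simp
  have summ: "summable (\<lambda>n. dyson a n k t i)" if t: "\<tau> \<le> t" and i: "i \<in> I" for k t i
  proof -
    obtain M where M0: "\<forall>n k' t' i. cmod k' \<le> cmod k \<longrightarrow> t' \<in> {\<tau>..t} \<longrightarrow> i \<in> I \<longrightarrow> cmod (dyson a n k' t' i) \<le> M * (1/2) ^ n"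
      using bnd[of "cmod k" t] t norm_ge_zero[of k] by blast
    note M = M0[rule_format]
    show ?thesis using t i M by (intro summable_comparison_test'[OF sm[of M]]) auto
  qed
  have cont: "continuous_on {\<tau>..T} (\<lambda>t. u k t i)" if i: "i \<in> I" for k i T
  proof (cases "\<tau> \<le> T")
    case True
    obtain M where M0: "\<forall>n k' t' i. cmod k' \<le> cmod k \<longrightarrow> t' \<in> {\<tau>..T} \<longrightarrow> i \<in> I \<longrightarrow> cmod (dyson a n k' t' i) \<le> M * (1/2) ^ n"
      using bnd[of "cmod k" T] True norm_ge_zero[of k] by blast
    note M = M0[rule_format]
    have "uniform_limit {\<tau>..T} (\<lambda>N t. \<Sum>n<N. dyson a n k t i) (\<lambda>t. \<Sum>n. dyson a n k t i) sequentially"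
      by (rule Weierstrass_m_test[OF _ sm]) (use M i in auto)
    then have "continuous_on {\<tau>..T} (\<lambda>t. \<Sum>n. dyson a n k t i)"
      by (rule uniform_limit_theorem[rotated]) (auto intro!: always_eventually continuous_intros dyson_continuous i)
    then show ?thesis by (simp add: u_def)
  qed simp
  have hol: "(\<lambda>k. u k t i) holomorphic_on UNIV" if t: "\<tau> \<le> t" and i: "i \<in> I" for t i
  proof (rule holomorphic_uniform_sequence[of UNIV "\<lambda>N k. \<Sum>n<N. dyson a n k t i"])
    fix k :: complex
    obtain M where M0: "\<forall>n k' t' i. cmod k' \<le> cmod k + 1 \<longrightarrow> t' \<in> {\<tau>..t} \<longrightarrow> i \<in> I \<longrightarrow> cmod (dyson a n k' t' i) \<le> M * (1/2) ^ n"
      using bnd[of "cmod k + 1" t] t norm_ge_zero[of k] by (meson add_nonneg_nonneg zero_le_one)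
    note M = M0[rule_format]
    have "cmod k' \<le> cmod k + 1" if "k' \<in> cball k 1" for k'
      using that norm_triangle_sub[of k' k] by (auto simp: dist_norm norm_minus_commute)
    then have "uniform_limit (cball k 1) (\<lambda>N k. \<Sum>n<N. dyson a n k t i) (\<lambda>k. u k t i) sequentially"
      unfolding u_def by (intro Weierstrass_m_test[OF _ sm[of M]]) (use M i t in auto)
    then show "\<exists>d>0. cball k d \<subseteq> UNIV \<and> uniform_limit (cball k d) (\<lambda>N k. \<Sum>n<N. dyson a n k t i) (\<lambda>k. u k t i) sequentially"
      by (intro exI[of _ 1]) auto
  qed (auto intro!: holomorphic_intros dyson_holomorphic t i)
  have ev: "u k t i = a i + integral {\<tau>..t} (\<lambda>s. rhs k s (u k s) i)" if t: "\<tau> \<le> t" and i: "i \<in> I" for k t i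
  proof -
    define F where "F = (\<lambda>n s. rhs k s (dyson a n k s) i)"
    obtain M where M: "M \<ge> 0" "\<And>n k' t'. cmod k' \<le> cmod k \<Longrightarrow> t' \<in> {\<tau>..t} \<Longrightarrow> (\<Sum>i\<in>I. cmod (dyson a n k' t' i)) \<le> M * (1/2) ^ n"
      using dyson_bound[of "cmod k" t a] t by auto
    have Fai: "F n absolutely_integrable_on {\<tau>..t}" for n
      unfolding F_def by (intro l2loc_ai rhs_l2 dyson_continuous i t)
    have Fb: "cmod (F n s) \<le> gen_bound (cmod k) s * M * (1/2) ^ n" if s: "s \<in> {\<tau>..t}" for n s
    proof -
      have "cmod (F n s) \<le> (\<Sum>i\<in>I. cmod (rhs k s (dyson a n k s) i))"
        unfolding F_def using i fin by (intro member_le_sum) auto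
      also have "\<dots> \<le> gen_bound (cmod k) s * (\<Sum>i\<in>I. cmod (dyson a n k s i))" by (rule norm_rhs_le) simp
      also have "\<dots> \<le> gen_bound (cmod k) s * (M * (1/2) ^ n)"
        using M(2)[OF _ s] by (intro mult_left_mono gen_bound_nonneg) auto
      finally show ?thesis by (simp add: mult.assoc)
    qed
    have sumF: "(\<lambda>n. F n s) sums rhs k s (u k s) i" if s: "s \<in> {\<tau>..t}" for s
      unfolding F_def rhs_def u_def using s i
      by (intro sums_mult sums_add sums_sum summable_sums summ) auto
    have "(\<lambda>N. integral {\<tau>..t} (\<lambda>s. \<Sum>n<N. F n s)) \<longlonglongrightarrow> integral {\<tau>..t} (\<lambda>s. rhs k s (u k s) i)"
    proof (rule dominated_convergence(2))
      show "(\<lambda>s. \<Sum>n<N. F n s) integrable_on {\<tau>..t}" for N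
        using Fai by (intro integrable_sum) (auto simp: absolutely_integrable_on_def)
      have "(\<lambda>s. of_real (gen_bound (cmod k) s) :: complex) absolutely_integrable_on {\<tau>..t}" by (rule l2loc_ai[OF gen_bound_l2 t])
      then have "(\<lambda>s. cmod (of_real (gen_bound (cmod k) s))) integrable_on {\<tau>..t}" by (simp only: absolutely_integrable_on_def)
      then have "(\<lambda>s. gen_bound (cmod k) s) integrable_on {\<tau>..t}" using gen_bound_nonneg[of "cmod k"] by simp
      then show "(\<lambda>s. gen_bound (cmod k) s * M * 2) integrable_on {\<tau>..t}"
        by (intro integrable_on_mult_left)
      fix N s assume s: "s \<in> {\<tau>..t}"
      have "cmod (\<Sum>n<N. F n s) \<le> (\<Sum>n<N. gen_bound (cmod k) s * M * (1/2) ^ n)"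
        by (intro sum_norm_le Fb s)
      also have "\<dots> = gen_bound (cmod k) s * M * (\<Sum>n<N. (1/2) ^ n)" by (simp add: sum_distrib_left)
      also have "\<dots> \<le> gen_bound (cmod k) s * M * 2"
        using M(1) gen_bound_nonneg[of "cmod k" s]
        by (intro mult_left_mono) (auto simp: sum_gp_strict)
      finally show "cmod (\<Sum>n<N. F n s) \<le> gen_bound (cmod k) s * M * 2" .
    next
      fix s assume "s \<in> {\<tau>..t}"
      then show "(\<lambda>N. \<Sum>n<N. F n s) \<longlonglongrightarrow> rhs k s (u k s) i"
        using sumF by (simp add: sums_def)
    qed
    moreover have "integral {\<tau>..t} (\<lambda>s. \<Sum>n<N. F n s) = (\<Sum>n<N. dyson a (Suc n) k t i)" for N
      using Fai unfolding dyson.simps F_def by (intro integral_sum) (auto simp: absolutely_integrable_on_def)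
    ultimately have "(\<lambda>n. dyson a (Suc n) k t i) sums integral {\<tau>..t} (\<lambda>s. rhs k s (u k s) i)"
      by (simp add: sums_def)
    then have "(\<lambda>n. dyson a n k t i) sums (integral {\<tau>..t} (\<lambda>s. rhs k s (u k s) i) + dyson a 0 k t i)"
      by (subst (asm) sums_Suc_iff[of "\<lambda>n. dyson a n k t i"]) simp
    then show ?thesis unfolding u_def by (simp add: sums_unique[symmetric] add.commute)
  qed
  have init: "u k \<tau> i = a i" if "i \<in> I" for k i
    using ev[of \<tau> i k] that by simp
  have "evol k (u k)" for k
    unfolding evol_def primitive_def
  proof (intro ballI allI impI conjI)
    fix i t assume i: "i \<in> I" and t: "\<tau> \<le> t"
    show "(\<lambda>t. rhs k t (u k t) i) absolutely_integrable_on {\<tau>..t}"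
      by (intro l2loc_ai rhs_l2 cont i t)
    show "u k t i = u k \<tau> i + integral {\<tau>..t} (\<lambda>t. rhs k t (u k t) i)"
      using ev[OF t i, of k] init[OF i] by simp
  qed
  then show ?thesis using init hol by blast
qed

end

section \<open>Adiabatic estimate for ground states\<close>

lemma primitive_Re_integral:
  assumes "primitive \<tau> f f'" "\<tau> \<le> t"
  shows "(\<lambda>s. Re (f' s)) integrable_on {\<tau>..t}" "Re (f t) = Re (f \<tau>) + integral {\<tau>..t} (\<lambda>s. Re (f' s))"
proof -
  note p = primitiveD[OF assms]
  have i: "f' integrable_on {\<tau>..t}" using p(1) by (simp add: absolutely_integrable_on_def)
  show "(\<lambda>s. Re (f' s)) integrable_on {\<tau>..t}"
    using integrable_linear[OF i bounded_linear_Re] by (simp add: o_def)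
  show "Re (f t) = Re (f \<tau>) + integral {\<tau>..t} (\<lambda>s. Re (f' s))"
    unfolding p(2) using integral_linear[OF i bounded_linear_Re] by (simp add: o_def)
qed

text \<open>
  A path inside the kernel of \<open>L\<close> (the ground states) that solves the equation compressed to this
  kernel.  There the spectral parameter disappears, so the path is independent of \<open>k\<close>.
\<close>

locale ground_path = hermitian_system +
  fixes h :: "real \<Rightarrow> 'a \<Rightarrow> complex"
  assumes h_excited: "\<And>i t. i \<in> I \<Longrightarrow> L i \<noteq> 0 \<Longrightarrow> \<tau> \<le> t \<Longrightarrow> h t i = 0"
    and h_ground: "\<And>i. i \<in> I \<Longrightarrow> L i = 0 \<Longrightarrow> primitive \<tau> (\<lambda>t. h t i) (\<lambda>t. \<i> * (\<Sum>m\<in>I. W t i m * h t m))"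
begin

text \<open>
  On the excited states this is the rate at which \<open>W\<close> pushes the path out of the ground space.
\<close>

definition w :: "real \<Rightarrow> 'a \<Rightarrow> complex" where
  "w t l = (\<Sum>m\<in>I. W t l m * h t m)"

abbreviation "\<eta> \<equiv> (\<Sum>i\<in>I. (cmod (h \<tau> i))\<^sup>2)"
abbreviation "Exc \<equiv> {i \<in> I. L i \<noteq> 0}"

definition \<phi> :: "(real \<Rightarrow> 'a \<Rightarrow> complex) \<Rightarrow> real \<Rightarrow> complex" where
  "\<phi> u t = (\<Sum>i\<in>I. cnj (h t i) * u t i)"

lemma h_primitive: "i \<in> I \<Longrightarrow> primitive \<tau> (\<lambda>t. h t i) (\<lambda>t. if L i = 0 then \<i> * w t i else 0)"
proof (cases "L i = 0")
  case True
  assume "i \<in> I" then show ?thesis using h_ground True by (simp add: w_def)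
next
  case False
  assume "i \<in> I" then show ?thesis using h_excited False by (auto intro: primitive_cong[OF primitive_const[of _ 0]])
qed

lemma h_continuous: "i \<in> I \<Longrightarrow> continuous_on {\<tau>..t} (\<lambda>t. h t i)"
  by (rule primitive_continuous[OF h_primitive])

lemma w_l2: "i \<in> I \<Longrightarrow> l2loc \<tau> (\<lambda>t. w t i)"
  unfolding w_def by (intro Wu_l2 h_continuous)

lemma sum_w_adjoint:
  assumes "\<tau> \<le> t"
  shows "(\<Sum>i\<in>I. cnj (h t i) * (\<Sum>m\<in>I. W t i m * v m)) = (\<Sum>m\<in>I. cnj (w t m) * v m)"
proof -
  have "(\<Sum>i\<in>I. cnj (h t i) * (\<Sum>m\<in>I. W t i m * v m)) = (\<Sum>i\<in>I. \<Sum>m\<in>I. cnj (h t i) * W t i m * v m)"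
    by (simp add: sum_distrib_left mult_ac)
  also have "\<dots> = (\<Sum>m\<in>I. \<Sum>i\<in>I. cnj (h t i) * W t i m * v m)" by (rule sum.swap)
  also have "\<dots> = (\<Sum>m\<in>I. \<Sum>i\<in>I. cnj (W t m i * h t i) * v m)"
  proof (intro sum.cong refl)
    fix m i assume "m \<in> I" "i \<in> I"
    then have "W t i m = cnj (W t m i)" using herm assms by blast
    then show "cnj (h t i) * W t i m * v m = cnj (W t m i * h t i) * v m" by simp
  qed
  finally show ?thesis by (simp add: w_def sum_distrib_right)
qed

text \<open>
  Inside the ground space the two evolutions cancel in the derivative of the inner product; what
  remains is the coupling of the path to the excited components of \<open>u\<close>.
\<close>

lemma \<phi>_primitive:
  assumes "evol k u"
  shows "primitive \<tau> (\<phi> u) (\<lambda>t. \<i> * (\<Sum>l\<in>Exc. cnj (w t l) * u t l))"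
proof (rule primitive_cong)
  show "primitive \<tau> (\<phi> u) (\<lambda>t. \<Sum>i\<in>I. cnj (if L i = 0 then \<i> * w t i else 0) * u t i + cnj (h t i) * rhs k t (u t) i)"
    unfolding \<phi>_def[abs_def] using assms
    by (intro primitive_sum primitive_mult primitive_cnj evolD h_primitive)
  fix t assume t: "\<tau> \<le> t"
  have "(\<Sum>i\<in>I. cnj (h t i) * rhs k t (u t) i) = (\<Sum>i\<in>I. \<i> * (cnj (h t i) * (\<Sum>m\<in>I. W t i m * u t m)))"
  proof (intro sum.cong refl)
    fix i assume "i \<in> I"
    then show "cnj (h t i) * rhs k t (u t) i = \<i> * (cnj (h t i) * (\<Sum>m\<in>I. W t i m * u t m))"
      using h_excited[of i t] t by (cases "L i = 0") (auto simp: rhs_def)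
  qed
  also have "\<dots> = \<i> * (\<Sum>m\<in>I. cnj (w t m) * u t m)"
    by (simp add: sum_w_adjoint[OF t] flip: sum_distrib_left)
  also have "(\<Sum>m\<in>I. cnj (w t m) * u t m) = (\<Sum>m\<in>Exc. cnj (w t m) * u t m) + (\<Sum>m\<in>I-Exc. cnj (w t m) * u t m)"
    using fin by (subst sum.subset_diff[of Exc]) auto
  finally have 1: "(\<Sum>i\<in>I. cnj (h t i) * rhs k t (u t) i) = \<i> * ((\<Sum>m\<in>Exc. cnj (w t m) * u t m) + (\<Sum>m\<in>I-Exc. cnj (w t m) * u t m))" .
  have "(\<Sum>i\<in>I. cnj (if L i = 0 then \<i> * w t i else 0) * u t i) = (\<Sum>i\<in>I-Exc. - \<i> * (cnj (w t i) * u t i))"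
    using fin by (intro sum.mono_neutral_cong_right) auto
  also have "\<dots> = - \<i> * (\<Sum>i\<in>I-Exc. cnj (w t i) * u t i)"
    by (rule sum_distrib_left[symmetric])
  finally show "(\<Sum>i\<in>I. cnj (if L i = 0 then \<i> * w t i else 0) * u t i + cnj (h t i) * rhs k t (u t) i)
      = \<i> * (\<Sum>l\<in>Exc. cnj (w t l) * u t l)"
    unfolding sum.distrib 1 by (simp add: algebra_simps)
qed simp

text \<open>
  The path solves the Hermitian system whose coupling is the compression of \<open>W\<close> to the ground space.
\<close>

lemma h_norm: 
  assumes "\<tau> \<le> t"
  shows "(\<Sum>i\<in>I. (cmod (h t i))\<^sup>2) = \<eta>"
proof -
  \<comment> \<open>the compression of \<open>W\<close> to the ground space\<close>
  define W' where "W' = (\<lambda>t i m. if L i = 0 \<and> L m = 0 then W t i m else 0)"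
  interpret E: hermitian_system I L W' \<tau>
  proof
    fix i m t assume "i \<in> I" "m \<in> I" "\<tau> \<le> t"
    then show "W' t m i = cnj (W' t i m)" using herm[of i m t] by (auto simp: W'_def)
  next
    fix i m assume "i \<in> I" "m \<in> I"
    then show "l2loc \<tau> (\<lambda>t. W' t i m)"
      using W_l2 by (cases "L i = 0 \<and> L m = 0") (auto simp: W'_def l2loc_zero)
  qed (auto intro: fin L_nonneg)
  have "E.evol (of_real 0) h"
    unfolding E.evol_def
  proof
    fix i assume i: "i \<in> I"
    have "(\<Sum>m\<in>I. W' t i m * h t m) = (if L i = 0 then w t i else 0)" if "\<tau> \<le> t" for t
    proof (cases "L i = 0")
      case True
      have "W' t i m * h t m = W t i m * h t m" if "m \<in> I" for m
        using h_excited[OF that _ \<open>\<tau> \<le> t\<close>] True by (cases "L m = 0") (auto simp: W'_def)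
      then have "(\<Sum>m\<in>I. W' t i m * h t m) = (\<Sum>m\<in>I. W t i m * h t m)" by (intro sum.cong refl)
      then show ?thesis using True by (simp add: w_def)
    qed (simp add: W'_def)
    then show "primitive \<tau> (\<lambda>t. h t i) (\<lambda>t. E.rhs (of_real 0) t (h t) i)"
      by (intro primitive_cong[OF h_primitive[OF i]]) (auto simp: E.rhs_def)
  qed
  from E.norm_conserved[OF this assms] show ?thesis .
qed

context
  fixes k :: complex and u
  assumes u: "evol k u" and imk: "0 \<le> Im k" and u0: "\<And>i. i \<in> I \<Longrightarrow> u \<tau> i = h \<tau> i"
begin

lemma u_norm: "\<tau> \<le> t \<Longrightarrow> (\<Sum>i\<in>I. (cmod (u t i))\<^sup>2) \<le> \<eta>"
  using norm_antimono[OF u imk] u0 by simp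

lemma \<phi>_start: "\<phi> u \<tau> = of_real \<eta>"
proof -
  have "\<phi> u \<tau> = (\<Sum>i\<in>I. cnj (h \<tau> i) * h \<tau> i)"
    unfolding \<phi>_def by (intro sum.cong refl) (simp add: u0)
  then show ?thesis by (simp only: cnj_mult_self of_real_sum)
qed

text \<open>
  Expand the square: \<open>u\<close> has at most and \<open>h\<close> exactly the norm of the common starting vector.
\<close>

lemma dist_le:
  assumes "\<tau> \<le> t"
  shows "(\<Sum>i\<in>I. (cmod (u t i - h t i))\<^sup>2) \<le> 2 * Re (of_real \<eta> - \<phi> u t)"
proof -
  have "(cmod (a - b))\<^sup>2 = (cmod a)\<^sup>2 + (cmod b)\<^sup>2 - 2 * Re (cnj b * a)" for a b
    unfolding cmod_power2 by (simp add: power2_eq_square algebra_simps)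
  then have "(\<Sum>i\<in>I. (cmod (u t i - h t i))\<^sup>2) = (\<Sum>i\<in>I. (cmod (u t i))\<^sup>2) + (\<Sum>i\<in>I. (cmod (h t i))\<^sup>2) - 2 * Re (\<phi> u t)"
    by (simp add: sum.distrib sum_subtractf \<phi>_def sum_distrib_left)
  then show ?thesis using u_norm[OF assms] h_norm[OF assms] by simp
qed

lemma \<phi>_bound:
  assumes "\<tau> \<le> t"
  shows "cmod (\<phi> u t) \<le> \<eta>"
proof -
  have "(cmod (\<phi> u t))\<^sup>2 \<le> (\<Sum>i\<in>I. (cmod (cnj (h t i)))\<^sup>2) * (\<Sum>i\<in>I. (cmod (u t i))\<^sup>2)"
    unfolding \<phi>_def by (rule norm_sum_mult_le)
  also have "\<dots> \<le> \<eta> * \<eta>"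
    using u_norm[OF assms] h_norm[OF assms] by (simp add: mult_left_mono sum_nonneg)
  finally have "(cmod (\<phi> u t))\<^sup>2 \<le> \<eta>\<^sup>2" by (simp add: power2_eq_square)
  then show ?thesis by (rule power2_le_imp_le) (simp add: sum_nonneg)
qed

end

text \<open>
  At \<open>k = \<i> y\<close> an excited component satisfies \<open>u\<^sub>l' = - y L\<^sub>l u\<^sub>l + \<i> (W u)\<^sub>l\<close>.  Integrating the derivative of
  \<open>cmod (u\<^sub>l)\<^sup>2\<close> and absorbing half of the damping bounds the time integral of \<open>cmod (u\<^sub>l)\<^sup>2\<close> by that of the
  source, divided by \<open>(y L\<^sub>l)\<^sup>2\<close>.
\<close>

lemma excited_energy:
  assumes u: "evol (\<i> * of_real y) u" and y: "0 < y" and l: "l \<in> I" "0 < L l" and z: "u \<tau> l = 0" and t: "\<tau> \<le> t"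
  shows "y * L l * integral {\<tau>..t} (\<lambda>s. (cmod (u s l))\<^sup>2)
     \<le> integral {\<tau>..t} (\<lambda>s. (cmod (\<Sum>m\<in>I. W s l m * u s m))\<^sup>2) / (y * L l)"
proof -
  define c where "c = y * L l"
  define g where "g = (\<lambda>s. \<Sum>m\<in>I. W s l m * u s m)"
  define D where "D = (\<lambda>s. cnj (rhs (\<i> * of_real y) s (u s) l) * u s l + cnj (u s l) * rhs (\<i> * of_real y) s (u s) l)"
  have c: "c > 0" using y l by (simp add: c_def)
  have p: "primitive \<tau> (\<lambda>t. cnj (u t l) * u t l) D"
    unfolding D_def using evolD[OF u l(1)] by (intro primitive_mult primitive_cnj)
  note r = primitive_Re_integral[OF p t]
  have g2: "(\<lambda>s. (cmod (g s))\<^sup>2) integrable_on {\<tau>..t}"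
    unfolding g_def by (intro l2locD(2)[OF Wu_l2] evol_continuous[OF u] l t)
  have u2: "(\<lambda>s. (cmod (u s l))\<^sup>2) integrable_on {\<tau>..t}"
    by (intro integrable_continuous_real continuous_intros evol_continuous[OF u] l)
  have "0 \<le> Re (cnj (u t l) * u t l)" by (simp only: cnj_mult_self) simp
  also have "\<dots> = integral {\<tau>..t} (\<lambda>s. Re (D s))" unfolding r(2) using z by simp
  also have "\<dots> \<le> integral {\<tau>..t} (\<lambda>s. (cmod (g s))\<^sup>2 / c - c * (cmod (u s l))\<^sup>2)"
  proof (rule integral_le[OF r(1)])
    show "(\<lambda>s. (cmod (g s))\<^sup>2 / c - c * (cmod (u s l))\<^sup>2) integrable_on {\<tau>..t}"
      using g2 u2 by (intro integrable_diff integrable_on_mult_right integrable_on_divide)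
    fix s
    have rh: "rhs (\<i> * of_real y) s (u s) l = - of_real c * u s l + \<i> * g s"
      by (simp add: rhs_def g_def c_def algebra_simps)
    define z where "z = cnj (u s l) * (\<i> * g s)"
    have "D s = - of_real (2 * c) * (cnj (u s l) * u s l) + (cnj z + z)"
      unfolding D_def rh z_def by (simp add: algebra_simps)
    also have "\<dots> = of_real (- 2 * c * (cmod (u s l))\<^sup>2) + (cnj z + z)"
      unfolding cnj_mult_self by simp
    finally have "Re (D s) = - 2 * c * (cmod (u s l))\<^sup>2 + (Re z + Re z)"
      by (simp only: plus_complex.simps Re_complex_of_real cnj.simps)
    then have "Re (D s) = - 2 * c * (cmod (u s l))\<^sup>2 + 2 * Re (cnj (u s l) * (\<i> * g s))"
      by (simp only: z_def mult_2)
    also have "Re (cnj (u s l) * (\<i> * g s)) \<le> cmod (u s l) * cmod (g s)"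
      using complex_Re_le_cmod[of "cnj (u s l) * (\<i> * g s)"] by (simp add: norm_mult)
    also have "- 2 * c * (cmod (u s l))\<^sup>2 + 2 * (cmod (u s l) * cmod (g s)) \<le> (cmod (g s))\<^sup>2 / c - c * (cmod (u s l))\<^sup>2"
    proof -
      have "0 \<le> (c * cmod (u s l) - cmod (g s))\<^sup>2 / c" using c by simp
      also have "\<dots> = c * (cmod (u s l))\<^sup>2 - 2 * (cmod (u s l) * cmod (g s)) + (cmod (g s))\<^sup>2 / c"
        using c by (simp add: power2_eq_square field_simps)
      finally show ?thesis by simp
    qed
    finally show "Re (D s) \<le> (cmod (g s))\<^sup>2 / c - c * (cmod (u s l))\<^sup>2" by simp
  qed
  also have "\<dots> = integral {\<tau>..t} (\<lambda>s. (cmod (g s))\<^sup>2) / c - c * integral {\<tau>..t} (\<lambda>s. (cmod (u s l))\<^sup>2)"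
    using g2 u2 by (simp add: integral_diff integrable_on_mult_right integrable_on_divide)
  finally show ?thesis by (simp add: g_def c_def)
qed

text \<open>
  Split \<open>cmod (w\<^sub>l) * cmod (u\<^sub>l)\<close> by the arithmetic-geometric mean with weight \<open>y L\<^sub>l\<close>, and insert
  \<open>excited_energy\<close> for the part with \<open>u\<^sub>l\<close>.
\<close>

lemma \<phi>_drop:
  assumes u: "evol (\<i> * of_real y) u" and y: "0 < y" and u0: "\<And>i. i \<in> I \<Longrightarrow> u \<tau> i = h \<tau> i" and t: "\<tau> \<le> t"
  shows "cmod (of_real \<eta> - \<phi> u t) \<le> (\<Sum>l\<in>Exc. (integral {\<tau>..t} (\<lambda>s. (cmod (w s l))\<^sup>2)
            + integral {\<tau>..t} (\<lambda>s. (cmod (\<Sum>m\<in>I. W s l m * u s m))\<^sup>2)) / (2 * y * L l))"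
proof -
  have imy: "0 \<le> Im (\<i> * of_real y)" using y by simp
  note p = primitiveD[OF \<phi>_primitive[OF u] t]
  have p2: "\<phi> u t = of_real \<eta> + integral {\<tau>..t} (\<lambda>s. \<i> * (\<Sum>l\<in>Exc. cnj (w s l) * u s l))"
    unfolding p(2) by (subst \<phi>_start[OF u imy u0]) auto
  have lpos: "0 < y * L l" if "l \<in> Exc" for l using that L_nonneg[of l] y by auto
  have w2: "(\<lambda>s. (cmod (w s l))\<^sup>2) integrable_on {\<tau>..t}" if "l \<in> Exc" for l
    using that by (intro l2locD(2)[OF w_l2] t) auto
  have u2: "(\<lambda>s. (cmod (u s l))\<^sup>2) integrable_on {\<tau>..t}" if "l \<in> Exc" for l
    using that by (intro integrable_continuous_real continuous_intros evol_continuous[OF u]) auto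
  have b2: "(\<lambda>s. (cmod (w s l))\<^sup>2 / (2 * (y * L l)) + y * L l / 2 * (cmod (u s l))\<^sup>2) integrable_on {\<tau>..t}" if "l \<in> Exc" for l
    using w2[OF that] u2[OF that] by (intro integrable_add integrable_on_mult_right integrable_on_divide)
  have diff_plus: "cmod (a - (a + b)) = cmod b" for a b by simp
  have "cmod (of_real \<eta> - \<phi> u t) = cmod (integral {\<tau>..t} (\<lambda>s. \<i> * (\<Sum>l\<in>Exc. cnj (w s l) * u s l)))"
    unfolding p2 using diff_plus by blast
  also have "\<dots> \<le> integral {\<tau>..t} (\<lambda>s. \<Sum>l\<in>Exc. (cmod (w s l))\<^sup>2 / (2 * (y * L l)) + y * L l / 2 * (cmod (u s l))\<^sup>2)"
  proof (rule integral_norm_bound_integral)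
    show "(\<lambda>s. \<i> * (\<Sum>l\<in>Exc. cnj (w s l) * u s l)) integrable_on {\<tau>..t}"
      using p(1) unfolding absolutely_integrable_on_def by blast
    show "(\<lambda>s. \<Sum>l\<in>Exc. (cmod (w s l))\<^sup>2 / (2 * (y * L l)) + y * L l / 2 * (cmod (u s l))\<^sup>2) integrable_on {\<tau>..t}"
      using fin b2 by (intro integrable_sum) auto
    fix s
    have "cmod (\<i> * (\<Sum>l\<in>Exc. cnj (w s l) * u s l)) \<le> (\<Sum>l\<in>Exc. cmod (w s l) * cmod (u s l))"
      unfolding norm_mult norm_ii mult_1 by (rule order.trans[OF norm_sum]) (simp add: norm_mult)
    also have "\<dots> \<le> (\<Sum>l\<in>Exc. (cmod (w s l))\<^sup>2 / (2 * (y * L l)) + y * L l / 2 * (cmod (u s l))\<^sup>2)"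
    proof (rule sum_mono)
      fix l assume "l \<in> Exc"
      define c where "c = y * L l"
      have c: "c > 0" using lpos[OF \<open>l \<in> Exc\<close>] by (simp add: c_def)
      have "0 \<le> (c * cmod (u s l) - cmod (w s l))\<^sup>2 / (2 * c)" using c by simp
      also have "\<dots> = c / 2 * (cmod (u s l))\<^sup>2 - cmod (w s l) * cmod (u s l) + (cmod (w s l))\<^sup>2 / (2 * c)"
        using c by (simp add: power2_eq_square field_simps)
      finally show "cmod (w s l) * cmod (u s l) \<le> (cmod (w s l))\<^sup>2 / (2 * (y * L l)) + y * L l / 2 * (cmod (u s l))\<^sup>2"
        by (simp add: c_def)
    qed
    finally show "cmod (\<i> * (\<Sum>l\<in>Exc. cnj (w s l) * u s l)) \<le> (\<Sum>l\<in>Exc. (cmod (w s l))\<^sup>2 / (2 * (y * L l)) + y * L l / 2 * (cmod (u s l))\<^sup>2)" .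
  qed
  also have "\<dots> = (\<Sum>l\<in>Exc. integral {\<tau>..t} (\<lambda>s. (cmod (w s l))\<^sup>2 / (2 * (y * L l)) + y * L l / 2 * (cmod (u s l))\<^sup>2))"
    using fin b2 by (intro integral_sum) auto
  also have "\<dots> \<le> (\<Sum>l\<in>Exc. (integral {\<tau>..t} (\<lambda>s. (cmod (w s l))\<^sup>2)
            + integral {\<tau>..t} (\<lambda>s. (cmod (\<Sum>m\<in>I. W s l m * u s m))\<^sup>2)) / (2 * y * L l))"
  proof (rule sum_mono)
    fix l assume l: "l \<in> Exc"
    define A where "A = integral {\<tau>..t} (\<lambda>s. (cmod (w s l))\<^sup>2)"
    define B where "B = integral {\<tau>..t} (\<lambda>s. (cmod (u s l))\<^sup>2)"
    define G where "G = integral {\<tau>..t} (\<lambda>s. (cmod (\<Sum>m\<in>I. W s l m * u s m))\<^sup>2)"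
    have "u \<tau> l = 0" using l u0[of l] h_excited[of l \<tau>] by simp
    then have "y * L l * B \<le> G / (y * L l)"
      unfolding B_def G_def using lpos[OF l] y l L_nonneg[of l] t by (intro excited_energy u y) auto
    moreover have "integral {\<tau>..t} (\<lambda>s. (cmod (w s l))\<^sup>2 / (2 * (y * L l)) + y * L l / 2 * (cmod (u s l))\<^sup>2) = A / (2 * (y * L l)) + y * L l / 2 * B"
      unfolding A_def B_def using w2[OF l] u2[OF l]
      by (subst integral_add) (auto intro!: integrable_on_mult_right integrable_on_divide)
    ultimately show "integral {\<tau>..t} (\<lambda>s. (cmod (w s l))\<^sup>2 / (2 * (y * L l)) + y * L l / 2 * (cmod (u s l))\<^sup>2)
       \<le> (A + G) / (2 * y * L l)"
      by (simp add: add_divide_distrib mult.assoc)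
  qed
  finally show ?thesis .
qed

text \<open>
  The size of the excursion from the ground space: coupling strengths weighted by inverse gaps.
\<close>

definition coupling :: "real \<Rightarrow> real \<Rightarrow> real" where
  "coupling s t = (\<Sum>l\<in>Exc. integral {s..t} (\<lambda>r. (cmod (w r l))\<^sup>2) / L l)"

text \<open>
  A bootstrap.  The bound \<open>\<phi>_drop\<close> with norm estimates only shows that \<open>\<eta> - \<phi>\<close>, hence by \<open>dist_le\<close> also
  the squared distance of \<open>u\<close> and \<open>h\<close>, is \<open>O(1 / y)\<close> uniformly in time.  Therefore
  \<open>cmod ((W u)\<^sub>l)\<^sup>2 \<le> 2 cmod (w\<^sub>l)\<^sup>2 + O(1 / y)\<close>, and \<open>\<phi>_drop\<close> once more gives \<open>(1 + 2) / 2 = 3/2\<close> times the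
  coupling.
\<close>

lemma \<phi>_asymptotics:
  assumes t: "\<tau> \<le> t"
  shows "\<exists>K. \<forall>y\<ge>1. \<forall>u. evol (\<i> * of_real y) u \<longrightarrow> (\<forall>i\<in>I. u \<tau> i = h \<tau> i) \<longrightarrow>
     y * cmod (of_real \<eta> - \<phi> u t) \<le> 3/2 * coupling \<tau> t + K / y"
proof -
  define \<omega> where "\<omega> = (\<lambda>l s. \<Sum>m\<in>I. (cmod (W s l m))\<^sup>2)"
  define b where "b = (\<lambda>l. integral {\<tau>..t} (\<omega> l))"
  define K1 where "K1 = (\<Sum>l\<in>Exc. \<eta> * b l / L l)"
  define K where "K = (\<Sum>l\<in>Exc. 2 * K1 * b l / L l)"
  have \<omega>int: "\<omega> l integrable_on {\<tau>..s}" if "l \<in> I" "\<tau> \<le> s" for l s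
    unfolding \<omega>_def using fin that by (intro integrable_sum l2locD(2)[OF W_l2]) auto
  have \<omega>0: "0 \<le> \<omega> l s" for l s by (simp add: \<omega>_def sum_nonneg)
  have bmono: "integral {\<tau>..s} (\<omega> l) \<le> b l" if "l \<in> I" "s \<in> {\<tau>..t}" for l s
    unfolding b_def using that \<omega>0 by (intro integral_subset_le \<omega>int) auto
  have \<eta>0: "0 \<le> \<eta>" by (simp add: sum_nonneg)
  have Lp: "0 < L l" if "l \<in> Exc" for l using that L_nonneg[of l] by auto
  have w2: "(\<lambda>s. (cmod (w s l))\<^sup>2) integrable_on {\<tau>..s}" if "l \<in> Exc" "\<tau> \<le> s" for l s
    using that by (intro l2locD(2)[OF w_l2]) auto
  have wle: "(cmod (w s l))\<^sup>2 \<le> \<omega> l s * \<eta>" if "\<tau> \<le> s" for l s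
    using norm_sum_mult_le[of "\<lambda>m. W s l m" "\<lambda>m. h s m" I] h_norm[OF that]
    by (simp add: w_def \<omega>_def)
  have "y * cmod (of_real \<eta> - \<phi> u t) \<le> 3/2 * coupling \<tau> t + K / y"
    if y1: "1 \<le> y" and u: "evol (\<i> * of_real y) u" and u0: "\<And>i. i \<in> I \<Longrightarrow> u \<tau> i = h \<tau> i" for y u
  proof -
    have y: "0 < y" using y1 by simp
    have imy: "0 \<le> Im (\<i> * of_real y)" using y by simp
    have g2: "(\<lambda>s. (cmod (\<Sum>m\<in>I. W s l m * u s m))\<^sup>2) integrable_on {\<tau>..s}" if "l \<in> Exc" "\<tau> \<le> s" for l s
      using that by (intro l2locD(2)[OF Wu_l2] evol_continuous[OF u]) auto
    \<comment> \<open>first pass, with norm estimates for \<open>W h\<close> and \<open>W u\<close>\<close>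
    have crude: "cmod (of_real \<eta> - \<phi> u s) \<le> K1 / y" if s: "s \<in> {\<tau>..t}" for s
    proof -
      have "cmod (of_real \<eta> - \<phi> u s) \<le> (\<Sum>l\<in>Exc. (integral {\<tau>..s} (\<lambda>s. (cmod (w s l))\<^sup>2)
            + integral {\<tau>..s} (\<lambda>s. (cmod (\<Sum>m\<in>I. W s l m * u s m))\<^sup>2)) / (2 * y * L l))"
        using s by (intro \<phi>_drop u y u0) auto
      also have "\<dots> \<le> (\<Sum>l\<in>Exc. (b l * \<eta> + b l * \<eta>) / (2 * y * L l))"
      proof (intro sum_mono divide_right_mono add_mono)
        fix l assume l: "l \<in> Exc"
        have "integral {\<tau>..s} (\<lambda>s. (cmod (w s l))\<^sup>2) \<le> integral {\<tau>..s} (\<lambda>s. \<omega> l s * \<eta>)"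
          using wle l s by (intro integral_le w2 integrable_on_mult_left \<omega>int) auto
        also have "\<dots> = integral {\<tau>..s} (\<omega> l) * \<eta>" by simp
        also have "\<dots> \<le> b l * \<eta>" using l s \<eta>0 by (intro mult_right_mono bmono) auto
        finally show "integral {\<tau>..s} (\<lambda>s. (cmod (w s l))\<^sup>2) \<le> b l * \<eta>" .
        have "integral {\<tau>..s} (\<lambda>s. (cmod (\<Sum>m\<in>I. W s l m * u s m))\<^sup>2) \<le> integral {\<tau>..s} (\<lambda>s. \<omega> l s * \<eta>)"
        proof (intro integral_le g2 integrable_on_mult_left \<omega>int)
          fix r assume "r \<in> {\<tau>..s}"
          then have "(\<Sum>m\<in>I. (cmod (u r m))\<^sup>2) \<le> \<eta>" using u_norm[OF u imy u0] by simp
          then have "\<omega> l r * (\<Sum>m\<in>I. (cmod (u r m))\<^sup>2) \<le> \<omega> l r * \<eta>" using \<omega>0 by (rule mult_left_mono)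
          then show "(cmod (\<Sum>m\<in>I. W r l m * u r m))\<^sup>2 \<le> \<omega> l r * \<eta>"
            using norm_sum_mult_le[of "\<lambda>m. W r l m" "\<lambda>m. u r m" I] by (simp add: \<omega>_def)
        qed (use l s in auto)
        also have "\<dots> = integral {\<tau>..s} (\<omega> l) * \<eta>" by simp
        also have "\<dots> \<le> b l * \<eta>" using l s \<eta>0 by (intro mult_right_mono bmono) auto
        finally show "integral {\<tau>..s} (\<lambda>s. (cmod (\<Sum>m\<in>I. W s l m * u s m))\<^sup>2) \<le> b l * \<eta>" .
        show "0 \<le> 2 * y * L l" using Lp[OF l] y by simp
      qed
      also have "\<dots> = K1 / y"
        using y by (simp add: K1_def sum_divide_distrib mult_ac)
      finally show ?thesis .
    qed
    \<comment> \<open>second pass: \<open>u\<close> is now known to be close to \<open>h\<close>\<close>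
    have close: "(\<Sum>m\<in>I. (cmod (u s m - h s m))\<^sup>2) \<le> 2 * K1 / y" if s: "s \<in> {\<tau>..t}" for s
      using dist_le[OF u imy u0, of s] crude[OF s] complex_Re_le_cmod[of "of_real \<eta> - \<phi> u s"] s by simp
    have "cmod (of_real \<eta> - \<phi> u t) \<le> (\<Sum>l\<in>Exc. (integral {\<tau>..t} (\<lambda>s. (cmod (w s l))\<^sup>2)
            + integral {\<tau>..t} (\<lambda>s. (cmod (\<Sum>m\<in>I. W s l m * u s m))\<^sup>2)) / (2 * y * L l))"
      using t by (intro \<phi>_drop u y u0)
    also have "\<dots> \<le> (\<Sum>l\<in>Exc. (integral {\<tau>..t} (\<lambda>s. (cmod (w s l))\<^sup>2)
            + (2 * integral {\<tau>..t} (\<lambda>s. (cmod (w s l))\<^sup>2) + 4 * K1 / y * b l)) / (2 * y * L l))"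
    proof (intro sum_mono divide_right_mono add_mono order.refl)
      fix l assume l: "l \<in> Exc"
      have "integral {\<tau>..t} (\<lambda>s. (cmod (\<Sum>m\<in>I. W s l m * u s m))\<^sup>2) \<le> integral {\<tau>..t} (\<lambda>s. 2 * (cmod (w s l))\<^sup>2 + 4 * K1 / y * \<omega> l s)"
      proof (intro integral_le g2 integrable_add integrable_on_mult_right w2 \<omega>int)
        fix s assume s: "s \<in> {\<tau>..t}"
        define r where "r = (\<Sum>m\<in>I. W s l m * (u s m - h s m))"
        have eq: "(\<Sum>m\<in>I. W s l m * u s m) = w s l + r"
          by (simp add: w_def r_def sum_subtractf algebra_simps)
        have "(cmod (w s l + r))\<^sup>2 \<le> 2 * (cmod (w s l))\<^sup>2 + 2 * (cmod r)\<^sup>2"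
        proof -
          have "(cmod (w s l + r))\<^sup>2 \<le> (cmod (w s l) + cmod r)\<^sup>2" by (simp add: norm_triangle_ineq power_mono)
          then show ?thesis
            using zero_le_power2[of "cmod (w s l) - cmod r"] by (simp add: power2_eq_square algebra_simps)
        qed
        moreover have arith: "2 * (\<omega> l s * (2 * K1 / y)) = 4 * K1 / y * \<omega> l s" by simp
        moreover have "(cmod r)\<^sup>2 \<le> \<omega> l s * (2 * K1 / y)"
          unfolding r_def \<omega>_def using close[OF s] 
          by (intro order.trans[OF norm_sum_mult_le] mult_left_mono sum_nonneg) auto
        ultimately show "(cmod (\<Sum>m\<in>I. W s l m * u s m))\<^sup>2 \<le> 2 * (cmod (w s l))\<^sup>2 + 4 * K1 / y * \<omega> l s"
          unfolding eq using arith by linarith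
      qed (use l t in auto)
      also have "\<dots> = 2 * integral {\<tau>..t} (\<lambda>s. (cmod (w s l))\<^sup>2) + 4 * K1 / y * b l"
        unfolding b_def using l t by (subst integral_add) (auto intro!: integrable_on_mult_right integrable_on_divide w2 \<omega>int)
      finally show "integral {\<tau>..t} (\<lambda>s. (cmod (\<Sum>m\<in>I. W s l m * u s m))\<^sup>2) \<le> 2 * integral {\<tau>..t} (\<lambda>s. (cmod (w s l))\<^sup>2) + 4 * K1 / y * b l" .
      show "0 \<le> 2 * y * L l" using Lp[OF l] y by simp
    qed
    also have "\<dots> = (3/2 * coupling \<tau> t + K / y) / y"
    proof -
      have "(integral {\<tau>..t} (\<lambda>s. (cmod (w s l))\<^sup>2)
            + (2 * integral {\<tau>..t} (\<lambda>s. (cmod (w s l))\<^sup>2) + 4 * K1 / y * b l)) / (2 * y * L l)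
         = 3/2 * (integral {\<tau>..t} (\<lambda>s. (cmod (w s l))\<^sup>2) / L l) / y + 2 * K1 * b l / L l / y / y" if "l \<in> Exc" for l
        using Lp[OF that] y by (simp add: field_simps)
      then show ?thesis
        by (simp add: coupling_def K_def sum.distrib sum_divide_distrib sum_distrib_left add_divide_distrib)
    qed
    finally show ?thesis using y by (simp add: pos_le_divide_eq mult.commute)
  qed
  then show ?thesis by blast
qed

text \<open>
  Apply \<open>boundary_integral_le\<close> to the entire function \<open>\<eta> - \<phi>\<close>, whose real part dominates half of the
  squared distance of \<open>u\<close> and \<open>h\<close>.
\<close>

theorem adiabatic_estimate:
  "\<exists>u :: real \<Rightarrow> real \<Rightarrow> 'a \<Rightarrow> complex.
     (\<forall>k. evol (of_real k) (u k)) \<and> (\<forall>k. \<forall>i\<in>I. u k \<tau> i = h \<tau> i) \<and>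
     (\<forall>t\<ge>\<tau>. \<forall>i\<in>I. continuous_on UNIV (\<lambda>k. u k t i)) \<and>
     (\<forall>t\<ge>\<tau>. (\<integral>\<^sup>+k. ennreal (\<Sum>i\<in>I. (cmod (u k t i - h t i))\<^sup>2) \<partial>lborel) \<le> ennreal (3 * pi * coupling \<tau> t))"
proof -
  obtain v :: "complex \<Rightarrow> real \<Rightarrow> 'a \<Rightarrow> complex" where v: "\<And>k. evol k (v k)" and v0: "\<And>k i. i \<in> I \<Longrightarrow> v k \<tau> i = h \<tau> i"
    and hol: "\<And>t i. \<tau> \<le> t \<Longrightarrow> i \<in> I \<Longrightarrow> (\<lambda>k. v k t i) holomorphic_on UNIV"
    using solution_exists[of "h \<tau>"] by blast
  have cont: "continuous_on UNIV (\<lambda>k. v (of_real k) t i)" if "\<tau> \<le> t" "i \<in> I" for t i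
    by (intro continuous_on_compose2[OF holomorphic_on_imp_continuous_on[OF hol[OF that]]] continuous_intros) auto
  have est: "(\<integral>\<^sup>+k. ennreal (\<Sum>i\<in>I. (cmod (v (of_real k) t i - h t i))\<^sup>2) \<partial>lborel) \<le> ennreal (3 * pi * coupling \<tau> t)"
    if t: "\<tau> \<le> t" for t
  proof -
    define f where "f = (\<lambda>k. of_real \<eta> - \<phi> (v k) t)"
    have fhol: "f holomorphic_on UNIV"
      unfolding f_def \<phi>_def by (intro holomorphic_intros hol t)
    have d: "(\<Sum>i\<in>I. (cmod (v k t i - h t i))\<^sup>2) \<le> 2 * Re (f k)" if "0 \<le> Im k" for k
      unfolding f_def using dist_le[OF v that v0 t] .
    have pos: "0 \<le> Re (f (of_real k))" for k :: real
    proof -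
      have "0 \<le> (\<Sum>i\<in>I. (cmod (v (of_real k) t i - h t i))\<^sup>2)" by (simp add: sum_nonneg)
      then show ?thesis using d[of "of_real k"] by simp
    qed
    obtain K where K: "\<And>y u. 1 \<le> y \<Longrightarrow> evol (\<i> * of_real y) u \<Longrightarrow> (\<forall>i\<in>I. u \<tau> i = h \<tau> i) \<Longrightarrow>
        y * cmod (of_real \<eta> - \<phi> u t) \<le> 3/2 * coupling \<tau> t + K / y"
      using \<phi>_asymptotics[OF t] by blast
    have half: "(\<integral>\<^sup>+k. ennreal (Re (f (of_real k))) \<partial>lborel) \<le> ennreal (pi * (3/2 * coupling \<tau> t))"
    proof (rule boundary_integral_le[OF fhol _ pos])
      fix z assume "0 \<le> Im z"
      have "cmod (f z) \<le> \<eta> + cmod (\<phi> (v z) t)"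
        unfolding f_def
        by (rule order.trans[OF norm_triangle_ineq4]) (simp only: norm_of_real abs_of_nonneg sum_nonneg zero_le_power2 order.refl)
      then show "cmod (f z) \<le> 2 * \<eta>" using \<phi>_bound[OF v \<open>0 \<le> Im z\<close> v0 t] by simp
    next
      fix y :: real assume y: "1 \<le> y"
      have "y * Re (f (\<i> * of_real y)) \<le> y * cmod (f (\<i> * of_real y))"
        using y by (intro mult_left_mono complex_Re_le_cmod) auto
      also have "\<dots> \<le> 3/2 * coupling \<tau> t + K / y"
        unfolding f_def using y v v0 by (intro K) auto
      finally show "y * Re (f (\<i> * of_real y)) \<le> 3/2 * coupling \<tau> t + K / y" .
    qed
    have "(\<integral>\<^sup>+k. ennreal (\<Sum>i\<in>I. (cmod (v (of_real k) t i - h t i))\<^sup>2) \<partial>lborel) \<le> (\<integral>\<^sup>+k. ennreal 2 * ennreal (Re (f (of_real k))) \<partial>lborel)"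
    proof (rule nn_integral_mono)
      fix k :: real
      have "ennreal (\<Sum>i\<in>I. (cmod (v (of_real k) t i - h t i))\<^sup>2) \<le> ennreal (2 * Re (f (of_real k)))"
        using d[of "of_real k"] by (intro ennreal_leI) simp
      then show "ennreal (\<Sum>i\<in>I. (cmod (v (of_real k) t i - h t i))\<^sup>2) \<le> ennreal 2 * ennreal (Re (f (of_real k)))"
        using ennreal_mult'[of 2 "Re (f (of_real k))"] by simp
    qed
    also have "(\<integral>\<^sup>+k. ennreal 2 * ennreal (Re (f (of_real k))) \<partial>lborel) = ennreal 2 * (\<integral>\<^sup>+k. ennreal (Re (f (of_real k))) \<partial>lborel)"
    proof (rule nn_integral_cmult)
      have "continuous_on UNIV (\<lambda>k::real. Re (f (of_real k)))"
        by (intro continuous_intros continuous_on_compose2[OF holomorphic_on_imp_continuous_on[OF fhol]]) auto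
      then have "(\<lambda>k::real. Re (f (of_real k))) \<in> borel_measurable lborel"
        unfolding measurable_lborel2 by (rule borel_measurable_continuous_onI)
      then show "(\<lambda>k::real. ennreal (Re (f (of_real k)))) \<in> borel_measurable lborel"
        by (rule measurable_compose[OF _ measurable_ennreal])
    qed
    also have "\<dots> \<le> ennreal 2 * ennreal (pi * (3/2 * coupling \<tau> t))"
      by (intro mult_left_mono half) simp
    also have "\<dots> = ennreal (3 * pi * coupling \<tau> t)"
      by (subst ennreal_mult'[symmetric]) (auto simp: algebra_simps)
    finally show ?thesis .
  qed
  show ?thesis
    by (rule exI[of _ "\<lambda>k. v (of_real k)"]) (use v v0 cont est in auto)
qed

end

section \<open>Antisymmetric states and the exterior product\<close>

text \<open>
  Antisymmetric states are functions on sets of occupied levels.  This is the sign with which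
  level \<open>r\<close> moves past the occupied levels above it.
\<close>

definition fermi_sign :: "nat \<Rightarrow> nat set \<Rightarrow> complex" where
  "fermi_sign r S = (-1) ^ card {x \<in> S. r < x}"

text \<open>
  The exterior product of the vector \<open>x\<close> with the state \<open>\<omega>\<close>, that is, the creation operator of \<open>x\<close>.
\<close>

definition wedge :: "(nat \<Rightarrow> complex) \<Rightarrow> (nat set \<Rightarrow> complex) \<Rightarrow> nat set \<Rightarrow> complex" where
  "wedge x \<omega> S = (\<Sum>r\<in>S. fermi_sign r S * x r * \<omega> (S - {r}))"

text \<open>
  The matrix of the derivation that \<open>V\<close> induces on the exterior algebra (its second quantization):
  one particle hops from \<open>q\<close> to \<open>r\<close>.
\<close>

definition dGamma :: "(nat \<Rightarrow> nat \<Rightarrow> complex) \<Rightarrow> nat set \<Rightarrow> nat set \<Rightarrow> complex" where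
  "dGamma V S T = (\<Sum>r\<in>S. \<Sum>q\<in>T. if S - {r} = T - {q} then V r q * fermi_sign r S * fermi_sign q T else 0)"

lemma fermi_sign_insert:
  assumes "finite A" "u \<notin> A"
  shows "fermi_sign v (insert u A) = (if v < u then - fermi_sign v A else fermi_sign v A)"
proof -
  have "{x \<in> insert u A. v < x} = (if v < u then insert u {x \<in> A. v < x} else {x \<in> A. v < x})" by auto
  then show ?thesis using assms by (auto simp: fermi_sign_def)
qed

lemma fermi_sign_square [simp]: "fermi_sign r S * fermi_sign r S = 1" "fermi_sign r S * (fermi_sign r S * z) = z"
  by (simp_all add: fermi_sign_def flip: power_add mult_2 mult.assoc)

lemma norm_fermi_sign [simp]: "cmod (fermi_sign r S) = 1"
  by (simp add: fermi_sign_def norm_power)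

lemma cnj_fermi_sign [simp]: "cnj (fermi_sign r S) = fermi_sign r S"
  by (simp add: fermi_sign_def)

text \<open>
  Two creation operators anticommute; this is the sign that makes the diagonal terms in
  \<open>dGamma_wedge\<close> cancel.
\<close>

lemma fermi_sign_cancel:
  assumes "finite S" "r \<in> S" "s \<in> S" "r \<noteq> s"
  shows "fermi_sign s S * fermi_sign r (S - {s}) * fermi_sign s (S - {r}) = - fermi_sign r S"
proof -
  define A where "A = S - {r} - {s}"
  have A: "finite A" "r \<notin> A" "s \<notin> A" "S = insert r (insert s A)" "S - {s} = insert r A" "S - {r} = insert s A"
    using assms by (auto simp: A_def)
  show ?thesis unfolding A(5,6) unfolding A(4) using A(1-3) assms(4) by (auto simp: fermi_sign_insert)
qed

text \<open>
  A hop from \<open>q\<close> to \<open>r\<close> commutes with the creation of a third level \<open>s\<close>: both exchanges of \<open>s\<close>,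
  with \<open>r\<close> and with \<open>q\<close>, change the sign, so the two changes cancel.
\<close>

lemma fermi_sign_commute:
  assumes "finite S" "r \<in> S" "s \<in> S" "r \<noteq> s" "q \<notin> S - {r}"
  shows "fermi_sign r S * fermi_sign q (insert q (S - {r})) * fermi_sign s (insert q (S - {r}))
     = fermi_sign s S * fermi_sign r (S - {s}) * fermi_sign q (insert q (S - {s} - {r}))"
proof -
  define A where "A = S - {r} - {s}"
  have A: "finite A" "r \<notin> A" "s \<notin> A" "S = insert r (insert s A)" "S - {s} = insert r A" "S - {r} = insert s A"
    "S - {s} - {r} = A" "q \<notin> A" "q \<noteq> s"
    using assms by (auto simp: A_def)
  show ?thesis unfolding A(7) unfolding A(5,6) unfolding A(4)
    using A(1-3,8,9) assms(4) by (auto simp: fermi_sign_insert)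
qed

lemma dGamma_apply:
  assumes U: "finite U" and S: "S \<subseteq> U" and p: "card S = p"
  shows "(\<Sum>T | T \<subseteq> U \<and> card T = p. dGamma V S T * f T)
    = (\<Sum>r\<in>S. \<Sum>q\<in>U - (S - {r}). V r q * fermi_sign r S * fermi_sign q (insert q (S - {r})) * f (insert q (S - {r})))"
proof -
  define P where "P = {T. T \<subseteq> U \<and> card T = p}"
  have finP: "finite P" unfolding P_def using U by (auto intro: finite_subset[of _ "Pow U"])
  have finT: "finite T" if "T \<in> P" for T using that U by (auto simp: P_def intro: finite_subset)
  have finS: "finite S" using U S by (rule rev_finite_subset)
  have "(\<Sum>T\<in>P. dGamma V S T * f T) = (\<Sum>T\<in>P. \<Sum>r\<in>S. \<Sum>q\<in>T. if S - {r} = T - {q} then V r q * fermi_sign r S * fermi_sign q T * f T else 0)"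
    by (auto simp: dGamma_def sum_distrib_right intro!: sum.cong)
  also have "\<dots> = (\<Sum>r\<in>S. \<Sum>T\<in>P. \<Sum>q\<in>T. if S - {r} = T - {q} then V r q * fermi_sign r S * fermi_sign q T * f T else 0)"
    by (rule sum.swap)
  also have "\<dots> = (\<Sum>r\<in>S. \<Sum>q\<in>U - (S - {r}). V r q * fermi_sign r S * fermi_sign q (insert q (S - {r})) * f (insert q (S - {r})))"
  proof (rule sum.cong[OF refl])
    fix r assume r: "r \<in> S"
    define Z where "Z = {x \<in> (SIGMA T:P. T). S - {r} = fst x - {snd x}}"
    have "(\<Sum>T\<in>P. \<Sum>q\<in>T. if S - {r} = T - {q} then V r q * fermi_sign r S * fermi_sign q T * f T else 0)
       = (\<Sum>x\<in>(SIGMA T:P. T). if S - {r} = fst x - {snd x} then V r (snd x) * fermi_sign r S * fermi_sign (snd x) (fst x) * f (fst x) else 0)"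
      using finP finT by (subst sum.Sigma) (simp_all add: split_beta)
    also have "\<dots> = (\<Sum>x\<in>Z. V r (snd x) * fermi_sign r S * fermi_sign (snd x) (fst x) * f (fst x))"
      unfolding Z_def using finP finT by (intro sum.inter_filter[symmetric]) blast
    also have "\<dots> = (\<Sum>q\<in>U - (S - {r}). V r q * fermi_sign r S * fermi_sign q (insert q (S - {r})) * f (insert q (S - {r})))"
    proof (rule sum.reindex_bij_witness[of _ "\<lambda>q. (insert q (S - {r}), q)" snd])
      fix q assume q: "q \<in> U - (S - {r})"
      have "insert q (S - {r}) \<subseteq> U" using q S by auto
      moreover have "card (insert q (S - {r})) = p"
        using q finS r p card_Suc_Diff1[OF finS r] by (subst card_insert_disjoint) auto
      moreover have "insert q (S - {r}) - {q} = S - {r}" using q by auto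
      ultimately show "(insert q (S - {r}), q) \<in> Z" by (simp add: P_def Z_def)
    next
      fix x assume "x \<in> Z"
      then have x: "fst x \<subseteq> U" "snd x \<in> fst x" "S - {r} = fst x - {snd x}" by (auto simp: Z_def P_def)
      have i: "insert (snd x) (S - {r}) = fst x" unfolding x(3) using x(2) by auto
      show "(insert (snd x) (S - {r}), snd x) = x" by (simp add: i)
      show "snd x \<in> U - (S - {r})" unfolding x(3) using x(1,2) by auto
      show "V r (snd x) * fermi_sign r S * fermi_sign (snd x) (insert (snd x) (S - {r})) * f (insert (snd x) (S - {r})) = V r (snd x) * fermi_sign r S * fermi_sign (snd x) (fst x) * f (fst x)"
        by (simp add: i)
    qed simp
    finally show "(\<Sum>T\<in>P. \<Sum>q\<in>T. if S - {r} = T - {q} then V r q * fermi_sign r S * fermi_sign q T * f T else 0)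
      = (\<Sum>q\<in>U - (S - {r}). V r q * fermi_sign r S * fermi_sign q (insert q (S - {r})) * f (insert q (S - {r})))" .
  qed
  finally show ?thesis by (simp add: P_def)
qed

lemma sum_off_diagonal_swap:
  assumes "finite S"
  shows "(\<Sum>r\<in>S. \<Sum>s\<in>S - {r}. g r s) = (\<Sum>s\<in>S. \<Sum>r\<in>S - {s}. g r s)"
proof -
  have "{s \<in> S. r \<noteq> s} = S - {r}" "{s \<in> S. s \<noteq> r} = S - {r}" for r by auto
  then show ?thesis using sum.swap_restrict[OF assms assms, of g "\<lambda>r s. r \<noteq> s"] by simp
qed

text \<open>
  The induced operator is a derivation of the exterior product.  Hops that leave the new particle
  alone match the second summand on the right, hops of the new particle the first.  The right-hand
  side has two further kinds of terms, which antisymmetry excludes on the left: hops of the new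
  particle, and hops of another one, out of a level that both occupy.  They cancel by
  \<open>fermi_sign_cancel\<close>.
\<close>

lemma dGamma_wedge:
  assumes U: "finite U" and S: "S \<subseteq> U" and p: "card S = Suc p"
  shows "(\<Sum>T | T \<subseteq> U \<and> card T = Suc p. dGamma V S T * wedge x \<omega> T)
    = wedge (\<lambda>r. \<Sum>q\<in>U. V r q * x q) \<omega> S
      + (\<Sum>r\<in>S. fermi_sign r S * x r * (\<Sum>T | T \<subseteq> U \<and> card T = p. dGamma V (S - {r}) T * \<omega> T))"
proof -
  have finS: "finite S" using U S by (rule rev_finite_subset)
  \<comment> \<open>the contribution of creating \<open>s\<close> after a hop from \<open>q\<close> to \<open>r\<close>\<close>
  define G where "G = (\<lambda>s r q. fermi_sign s S * x s * (V r q * fermi_sign r (S - {s}) * fermi_sign q (insert q (S - {s} - {r})) * \<omega> (insert q (S - {s} - {r}))))"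
  have w: "wedge x \<omega> (insert q (S - {r})) = fermi_sign q (insert q (S - {r})) * x q * \<omega> (S - {r})
      + (\<Sum>s\<in>S - {r}. fermi_sign s (insert q (S - {r})) * x s * \<omega> (insert q (S - {r} - {s})))"
    if "r \<in> S" "q \<in> U - (S - {r})" for r q
  proof -
    have "(\<Sum>s\<in>S - {r}. fermi_sign s (insert q (S - {r})) * x s * \<omega> (insert q (S - {r}) - {s}))
        = (\<Sum>s\<in>S - {r}. fermi_sign s (insert q (S - {r})) * x s * \<omega> (insert q (S - {r} - {s})))"
      using that by (intro sum.cong refl) (auto simp: insert_Diff_if)
    then show ?thesis unfolding wedge_def using that finS by (subst sum.insert) auto
  qed
  have G: "V r q * fermi_sign r S * fermi_sign q (insert q (S - {r})) * (fermi_sign s (insert q (S - {r})) * x s * \<omega> (insert q (S - {r} - {s})))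
      = G s r q" if "r \<in> S" "q \<in> U - (S - {r})" "s \<in> S - {r}" for r q s
  proof -
    have "S - {r} - {s} = S - {s} - {r}" by auto
    then show ?thesis unfolding G_def using fermi_sign_commute[OF finS, of r s q] that by (simp add: mult_ac)
  qed
  have G_diag: "G s r s = - (fermi_sign r S * (V r s * x s) * \<omega> (S - {r}))" if "r \<in> S" "s \<in> S - {r}" for r s
  proof -
    have "insert s (S - {s} - {r}) = S - {r}" using that by auto
    then have "G s r s = (fermi_sign s S * fermi_sign r (S - {s}) * fermi_sign s (S - {r})) * (V r s * x s * \<omega> (S - {r}))"
      unfolding G_def by (simp add: mult_ac)
    also have "\<dots> = - fermi_sign r S * (V r s * x s * \<omega> (S - {r}))"
      using fermi_sign_cancel[OF finS, of r s] that by simp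
    finally show ?thesis by (simp add: mult_ac)
  qed
  have "(\<Sum>T | T \<subseteq> U \<and> card T = Suc p. dGamma V S T * wedge x \<omega> T)
     = (\<Sum>r\<in>S. \<Sum>q\<in>U - (S - {r}). V r q * fermi_sign r S * fermi_sign q (insert q (S - {r})) * wedge x \<omega> (insert q (S - {r})))"
    by (rule dGamma_apply[OF U S p])
  also have "\<dots> = (\<Sum>r\<in>S. \<Sum>q\<in>U - (S - {r}). fermi_sign r S * (V r q * x q) * \<omega> (S - {r}) + (\<Sum>s\<in>S - {r}. G s r q))"
    by (intro sum.cong refl)
       (simp add: w G[symmetric] distrib_left sum_distrib_left mult_ac)
  also have "\<dots> = (\<Sum>r\<in>S. (\<Sum>q\<in>U - (S - {r}). fermi_sign r S * (V r q * x q) * \<omega> (S - {r})) + (\<Sum>s\<in>S - {r}. \<Sum>q\<in>U - (S - {r}). G s r q))"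
  proof (rule sum.cong[OF refl])
    fix r
    have "(\<Sum>q\<in>U - (S - {r}). \<Sum>s\<in>S - {r}. G s r q) = (\<Sum>s\<in>S - {r}. \<Sum>q\<in>U - (S - {r}). G s r q)"
      by (rule sum.swap)
    then show "(\<Sum>q\<in>U - (S - {r}). fermi_sign r S * (V r q * x q) * \<omega> (S - {r}) + (\<Sum>s\<in>S - {r}. G s r q))
      = (\<Sum>q\<in>U - (S - {r}). fermi_sign r S * (V r q * x q) * \<omega> (S - {r})) + (\<Sum>s\<in>S - {r}. \<Sum>q\<in>U - (S - {r}). G s r q)"
      by (simp only: sum.distrib)
  qed
  also have "\<dots> = (\<Sum>r\<in>S. (\<Sum>q\<in>U. fermi_sign r S * (V r q * x q) * \<omega> (S - {r})) + (\<Sum>s\<in>S - {r}. \<Sum>q\<in>U - (S - {s} - {r}). G s r q))"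
  proof (rule sum.cong[OF refl])
    fix r assume r: "r \<in> S"
    have "(\<Sum>s\<in>S - {r}. \<Sum>q\<in>U - (S - {s} - {r}). G s r q) = (\<Sum>s\<in>S - {r}. G s r s + (\<Sum>q\<in>U - (S - {r}). G s r q))"
    proof (rule sum.cong[OF refl])
      fix s assume s: "s \<in> S - {r}"
      have "U - (S - {s} - {r}) = insert s (U - (S - {r}))" using s r S by auto
      then show "(\<Sum>q\<in>U - (S - {s} - {r}). G s r q) = G s r s + (\<Sum>q\<in>U - (S - {r}). G s r q)"
        using U s by simp
    qed
    also have "\<dots> = (\<Sum>s\<in>S - {r}. - (fermi_sign r S * (V r s * x s) * \<omega> (S - {r}))) + (\<Sum>s\<in>S - {r}. \<Sum>q\<in>U - (S - {r}). G s r q)"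
      unfolding sum.distrib using G_diag r by simp
    finally have 1: "(\<Sum>s\<in>S - {r}. \<Sum>q\<in>U - (S - {s} - {r}). G s r q) = 
       - (\<Sum>s\<in>S - {r}. fermi_sign r S * (V r s * x s) * \<omega> (S - {r})) + (\<Sum>s\<in>S - {r}. \<Sum>q\<in>U - (S - {r}). G s r q)"
      by (simp add: sum_negf)
    have "(\<Sum>q\<in>U. fermi_sign r S * (V r q * x q) * \<omega> (S - {r})) = (\<Sum>q\<in>U - (S - {r}). fermi_sign r S * (V r q * x q) * \<omega> (S - {r})) + (\<Sum>q\<in>S - {r}. fermi_sign r S * (V r q * x q) * \<omega> (S - {r}))"
      using U S by (intro sum.subset_diff) auto
    then show "(\<Sum>q\<in>U - (S - {r}). fermi_sign r S * (V r q * x q) * \<omega> (S - {r})) + (\<Sum>s\<in>S - {r}. \<Sum>q\<in>U - (S - {r}). G s r q)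
      = (\<Sum>q\<in>U. fermi_sign r S * (V r q * x q) * \<omega> (S - {r})) + (\<Sum>s\<in>S - {r}. \<Sum>q\<in>U - (S - {s} - {r}). G s r q)"
      using 1 by simp
  qed
  also have "\<dots> = wedge (\<lambda>r. \<Sum>q\<in>U. V r q * x q) \<omega> S + (\<Sum>r\<in>S. \<Sum>s\<in>S - {r}. \<Sum>q\<in>U - (S - {s} - {r}). G s r q)"
    by (simp add: wedge_def sum.distrib sum_distrib_left sum_distrib_right)
  also have "(\<Sum>r\<in>S. \<Sum>s\<in>S - {r}. \<Sum>q\<in>U - (S - {s} - {r}). G s r q) = (\<Sum>s\<in>S. \<Sum>r\<in>S - {s}. \<Sum>q\<in>U - (S - {s} - {r}). G s r q)"
    by (rule sum_off_diagonal_swap[OF finS])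
  also have "\<dots> = (\<Sum>s\<in>S. fermi_sign s S * x s * (\<Sum>T | T \<subseteq> U \<and> card T = p. dGamma V (S - {s}) T * \<omega> T))"
  proof (rule sum.cong[OF refl])
    fix s assume s: "s \<in> S"
    have "(\<Sum>T | T \<subseteq> U \<and> card T = p. dGamma V (S - {s}) T * \<omega> T)
      = (\<Sum>r\<in>S - {s}. \<Sum>q\<in>U - (S - {s} - {r}). V r q * fermi_sign r (S - {s}) * fermi_sign q (insert q (S - {s} - {r})) * \<omega> (insert q (S - {s} - {r})))"
      using S p s finS by (intro dGamma_apply U) auto
    then show "(\<Sum>r\<in>S - {s}. \<Sum>q\<in>U - (S - {s} - {r}). G s r q) = fermi_sign s S * x s * (\<Sum>T | T \<subseteq> U \<and> card T = p. dGamma V (S - {s}) T * \<omega> T)"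
      by (simp add: G_def sum_distrib_left)
  qed
  finally show ?thesis .
qed

lemma dGamma_hermitian:
  assumes "\<And>r q. r \<in> S \<Longrightarrow> q \<in> T \<Longrightarrow> V q r = cnj (V r q)"
  shows "dGamma V T S = cnj (dGamma V S T)"
proof -
  have "dGamma V T S = (\<Sum>r\<in>S. \<Sum>q\<in>T. if T - {q} = S - {r} then V q r * fermi_sign q T * fermi_sign r S else 0)"
    unfolding dGamma_def by (rule sum.swap)
  also have "\<dots> = (\<Sum>r\<in>S. \<Sum>q\<in>T. cnj (if S - {r} = T - {q} then V r q * fermi_sign r S * fermi_sign q T else 0))"
  proof (intro sum.cong refl)
    fix r q assume "r \<in> S" "q \<in> T"
    then have "V q r = cnj (V r q)" by (rule assms)
    then show "(if T - {q} = S - {r} then V q r * fermi_sign q T * fermi_sign r S else 0) = cnj (if S - {r} = T - {q} then V r q * fermi_sign r S * fermi_sign q T else 0)"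
      by (auto simp: mult_ac)
  qed
  finally show ?thesis by (simp add: dGamma_def)
qed

lemma dGamma_diagonal:
  assumes "finite S" "\<And>r. r \<in> S \<Longrightarrow> V r r = 0"
  shows "dGamma V S S = 0"
  unfolding dGamma_def
proof (intro sum.neutral ballI)
  fix r q assume "r \<in> S" "q \<in> S"
  then show "(if S - {r} = S - {q} then V r q * fermi_sign r S * fermi_sign q S else 0) = 0"
    using assms(2)[of r] by (cases "r = q") auto
qed

lemma dGamma_hop:
  assumes "finite A" "q \<in> A" "r \<notin> A"
  shows "dGamma V (insert r (A - {q})) A = V r q * fermi_sign r (insert r (A - {q})) * fermi_sign q A"
proof -
  define S where "S = insert r (A - {q})"
  have iff: "S - {r'} = A - {q'} \<longleftrightarrow> r' = r \<and> q' = q" if "r' \<in> S" "q' \<in> A" for r' q'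
    using that assms unfolding S_def by auto
  have "dGamma V S A = (\<Sum>r'\<in>S. \<Sum>q'\<in>A. if r' = r then (if q' = q then V r q * fermi_sign r S * fermi_sign q A else 0) else 0)"
    unfolding dGamma_def using iff by (intro sum.cong refl) auto
  also have "\<dots> = (\<Sum>r'\<in>S. if r' = r then V r q * fermi_sign r S * fermi_sign q A else 0)"
    using assms by (intro sum.cong refl) auto
  also have "\<dots> = V r q * fermi_sign r S * fermi_sign q A"
    using assms by (simp add: S_def)
  finally show ?thesis by (simp add: S_def)
qed

lemma dGamma_zero:
  assumes "S \<noteq> A" "S \<notin> (\<lambda>(q,r). insert r (A - {q})) ` (A \<times> (U - A))" "S \<subseteq> U"
  shows "dGamma V S A = 0"
  unfolding dGamma_def
proof (intro sum.neutral ballI)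
  fix r q assume rq: "r \<in> S" "q \<in> A"
  have "S - {r} \<noteq> A - {q}"
  proof
    assume e: "S - {r} = A - {q}"
    then have "S = insert r (A - {q})" using rq by auto
    moreover have "r \<notin> A" using e rq assms(1) by auto
    ultimately show False using assms(2,3) rq by auto
  qed
  then show "(if S - {r} = A - {q} then V r q * fermi_sign r S * fermi_sign q A else 0) = 0" by simp
qed

section \<open>The spectrum of the exterior powers\<close>

text \<open>
  \<open>V\<close> is Hermitian at negative times too, which is arranged by setting it to zero there.
\<close>

locale mid_block =
  fixes N :: nat and j :: nat and lam :: "nat \<Rightarrow> real" and V :: "real \<Rightarrow> nat \<Rightarrow> nat \<Rightarrow> complex"
  assumes j: "1 < j" "j + 2 \<le> N"
    and mono: "mono_on {1..N} lam"
    and gap: "lam (j - 1) < lam j" "lam j = lam (j + 1)" "lam (j + 1) < lam (j + 2)"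
    and V_herm: "\<And>t m l. m \<in> {1..N} \<Longrightarrow> l \<in> {1..N} \<Longrightarrow> V t l m = cnj (V t m l)"
    and V_diag: "\<And>t m. m \<in> {1..N} \<Longrightarrow> V t m m = 0"
    and V_l2: "\<And>m l. m \<in> {1..N} \<Longrightarrow> l \<in> {1..N} \<Longrightarrow> l2loc 0 (\<lambda>t. V t m l)"
begin

definition \<mu> :: "nat \<Rightarrow> real" where "\<mu> r = lam r - lam j"

abbreviation "S0 \<equiv> {1..j - 1}"
abbreviation "A1 \<equiv> {1..j}"
abbreviation "A2 \<equiv> insert (j + 1) {1..j - 1}"

text \<open>
  Energy above the state \<open>{1..j - 1}\<close> when the middle pair is at energy \<open>0\<close>.  The same formula serves
  both particle numbers, as a particle in the middle pair costs nothing.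
\<close>

definition excess :: "nat set \<Rightarrow> real" where "excess S = sum \<mu> S - sum \<mu> S0"

definition sector :: "nat \<Rightarrow> nat set set" where "sector p = {S. S \<subseteq> {1..N} \<and> card S = p}"

lemma sector_finite: "S \<in> sector p \<Longrightarrow> finite S"
  by (auto simp: sector_def intro: finite_subset)

lemma finite_sector: "finite (sector p)"
  unfolding sector_def by (rule finite_subset[of _ "Pow {1..N}"]) auto

lemma lam_le: "1 \<le> a \<Longrightarrow> a \<le> b \<Longrightarrow> b \<le> N \<Longrightarrow> lam a \<le> lam b"
  using mono by (auto simp: mono_on_def)

lemma \<mu>_neg:
  assumes "r \<in> S0"
  shows "\<mu> r < 0"
proof -
  have "1 \<le> r" "r \<le> j - 1" "j - 1 \<le> N" using assms j by auto
  then show ?thesis using lam_le[of r "j - 1"] gap(1) unfolding \<mu>_def by linarith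
qed

lemma \<mu>_zero: "r = j \<or> r = j + 1 \<Longrightarrow> \<mu> r = 0"
  using gap(2) by (auto simp: \<mu>_def)

lemma \<mu>_pos: "j + 2 \<le> r \<Longrightarrow> r \<le> N \<Longrightarrow> 0 < \<mu> r"
  using lam_le[of "j + 2" r] gap(2,3) j by (simp add: \<mu>_def)

lemma \<mu>_nonneg: "j \<le> r \<Longrightarrow> r \<le> N \<Longrightarrow> 0 \<le> \<mu> r"
  using lam_le[of j r] j by (simp add: \<mu>_def)

text \<open>
  Occupied levels outside \<open>{1..j - 1}\<close> have nonnegative energy, empty levels inside contribute the
  negative of a negative energy.
\<close>

lemma excess_split:
  assumes "S \<subseteq> {1..N}"
  shows "excess S = sum \<mu> (S - S0) + (\<Sum>r\<in>S0 - S. - \<mu> r)"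
proof -
  have f: "finite S" using assms finite_subset by blast
  have "sum \<mu> S = sum \<mu> (S \<inter> S0) + sum \<mu> (S - S0)"
    using f by (subst sum.union_disjoint[symmetric]) (auto intro!: sum.cong)
  moreover have "sum \<mu> S0 = sum \<mu> (S \<inter> S0) + sum \<mu> (S0 - S)"
    using f by (subst sum.union_disjoint[symmetric]) (auto intro!: sum.cong)
  ultimately show ?thesis by (simp add: excess_def sum_negf)
qed

lemma excess_nonneg:
  assumes "S \<subseteq> {1..N}"
  shows "0 \<le> excess S"
  unfolding excess_split[OF assms]
proof (intro add_nonneg_nonneg sum_nonneg)
  fix r assume "r \<in> S - S0"
  then have "j \<le> r" "r \<le> N" using assms by auto
  then show "0 \<le> \<mu> r" by (rule \<mu>_nonneg)
next
  fix r assume "r \<in> S0 - S"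
  then show "0 \<le> - \<mu> r" using \<mu>_neg[of r] by (simp add: less_imp_le)
qed

lemma excess_zero_iff:
  assumes "S \<subseteq> {1..N}"
  shows "excess S = 0 \<longleftrightarrow> S0 \<subseteq> S \<and> S \<subseteq> {1..j + 1}"
proof
  have f: "finite S" using assms finite_subset by blast
  have nn: "\<And>r. r \<in> S - S0 \<Longrightarrow> 0 \<le> \<mu> r" "\<And>r. r \<in> S0 - S \<Longrightarrow> 0 \<le> - \<mu> r"
  proof -
    fix r assume "r \<in> S - S0" then have "j \<le> r" "r \<le> N" using assms by auto
    then show "0 \<le> \<mu> r" by (rule \<mu>_nonneg)
  next
    fix r assume "r \<in> S0 - S" then show "0 \<le> - \<mu> r" using \<mu>_neg[of r] by (simp add: less_imp_le)
  qed
  assume "excess S = 0"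
  then have sums: "sum \<mu> (S - S0) = 0" "(\<Sum>r\<in>S0 - S. - \<mu> r) = 0"
    using sum_nonneg[of "S - S0" \<mu>, OF nn(1)] sum_nonneg[of "S0 - S" "\<lambda>r. - \<mu> r", OF nn(2)]
    unfolding excess_split[OF assms] by linarith+
  have z: "\<forall>r\<in>S - S0. \<mu> r = 0" "\<forall>r\<in>S0 - S. - \<mu> r = 0"
    using sum_nonneg_eq_0_iff[of "S - S0" \<mu>, OF finite_Diff[OF f] nn(1)] sums(1)
      sum_nonneg_eq_0_iff[of "S0 - S" "\<lambda>r. - \<mu> r", OF finite_Diff[OF finite_atLeastAtMost] nn(2)] sums(2)
    by blast+
  show "S0 \<subseteq> S \<and> S \<subseteq> {1..j + 1}"
  proof (intro conjI subsetI)
    fix r assume r: "r \<in> S0"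
    then have "\<mu> r < 0" by (rule \<mu>_neg)
    then show "r \<in> S" using z(2) r by (metis DiffI less_irrefl neg_equal_0_iff_equal)
  next
    fix r assume r: "r \<in> S"
    then have "1 \<le> r" "r \<le> N" using assms by auto
    moreover have "\<not> j + 2 \<le> r"
    proof
      assume a: "j + 2 \<le> r"
      then have "0 < \<mu> r" using \<open>r \<le> N\<close> by (rule \<mu>_pos)
      moreover have "r \<in> S - S0" using r a by auto
      ultimately show False using z(1) by (metis less_irrefl)
    qed
    ultimately show "r \<in> {1..j + 1}" by auto
  qed
next
  assume a: "S0 \<subseteq> S \<and> S \<subseteq> {1..j + 1}"
  have "sum \<mu> (S - S0) = 0"
  proof (intro sum.neutral ballI)
    fix r assume "r \<in> S - S0"
    then have "r = j \<or> r = j + 1" using a by auto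
    then show "\<mu> r = 0" by (rule \<mu>_zero)
  qed
  moreover have "S0 - S = {}" using a by auto
  ultimately show "excess S = 0" by (simp only: excess_split[OF assms] sum.empty add_0_right)
qed

lemma hermitian_system_sector: 
  assumes "0 \<le> \<tau>"
  shows "hermitian_system (sector p) excess (\<lambda>t. dGamma (V t)) \<tau>"
proof
  show "finite (sector p)" by (rule finite_sector)
  show "0 \<le> excess S" if "S \<in> sector p" for S using that by (intro excess_nonneg) (auto simp: sector_def)
  show "dGamma (V t) T S = cnj (dGamma (V t) S T)" if "S \<in> sector p" "T \<in> sector p" for S T t
  proof (rule dGamma_hermitian)
    fix r q assume "r \<in> S" "q \<in> T"
    then have "r \<in> {1..N}" "q \<in> {1..N}" using that by (auto simp: sector_def)
    then show "V t q r = cnj (V t r q)" by (rule V_herm)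
  qed
  show "l2loc \<tau> (\<lambda>t. dGamma (V t) S T)" if "S \<in> sector p" "T \<in> sector p" for S T
    unfolding dGamma_def
  proof (intro l2loc_sum)
    fix r q assume "r \<in> S" "q \<in> T"
    then have "r \<in> {1..N}" "q \<in> {1..N}" using that by (auto simp: sector_def)
    then have "l2loc \<tau> (\<lambda>t. (fermi_sign r S * fermi_sign q T) * V t r q)"
      by (intro l2loc_cmult l2loc_restart[OF V_l2 assms])
    then show "l2loc \<tau> (\<lambda>t. if S - {r} = T - {q} then V t r q * fermi_sign r S * fermi_sign q T else 0)"
      by (cases "S - {r} = T - {q}") (simp_all add: l2loc_zero mult_ac)
  qed
qed

text \<open>
  The integrand of \<open>I''\<close>.
\<close>

definition gap_density :: "real \<Rightarrow> real" where
  "gap_density s = (\<Sum>m=1..j-1. \<Sum>l=j..j+1. inverse \<bar>lam l - lam m\<bar> * (cmod (V s m l))\<^sup>2)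
        + (\<Sum>m=1..j+1. \<Sum>l=j+2..N. inverse \<bar>lam l - lam m\<bar> * (cmod (V s m l))\<^sup>2)"

lemma gap_density_nonneg: "0 \<le> gap_density s"
  unfolding gap_density_def by (intro add_nonneg_nonneg sum_nonneg mult_nonneg_nonneg) auto

lemma gap_density_integrable:
  assumes "0 \<le> \<tau>" "\<tau> \<le> t"
  shows "gap_density integrable_on {\<tau>..t}"
  unfolding gap_density_def[abs_def]
  by (intro integrable_add integrable_sum integrable_on_mult_right l2locD(2)[OF l2loc_restart[OF V_l2 assms(1)] assms(2)])
     (use j in auto)

text \<open>
  A state coupled to the ground state \<open>A\<close> arises from it by moving one particle from \<open>q \<in> A\<close> to
  \<open>r \<notin> A\<close>, at the cost \<open>lam r - lam q\<close> and with amplitude \<open>cmod (V q r)\<close>.  All such pairs occur in \<open>I''\<close>, except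
  pairs inside \<open>{j, j + 1}\<close>; those lead to a ground state and get weight \<open>inverse 0 = 0\<close>.
\<close>

lemma hop_energy_le:
  assumes A: "S0 \<subseteq> A" "A \<subseteq> {1..j + 1}"
  shows "(\<Sum>S | S \<in> sector (card A) \<and> excess S \<noteq> 0. (cmod (dGamma (V s) S A))\<^sup>2 / excess S) \<le> gap_density s"
proof -
  have finA: "finite A" using A finite_subset by blast
  have AN: "A \<subseteq> {1..N}" using A j by auto
  have LA: "excess A = 0" using A AN by (simp add: excess_zero_iff)
  define c where "c = (\<lambda>(q,r). inverse \<bar>lam r - lam q\<bar> * (cmod (V s q r))\<^sup>2)"
  define g where "g = (\<lambda>(q,r). insert r (A - {q}))"
  define f where "f = (\<lambda>S. (cmod (dGamma (V s) S A))\<^sup>2 * inverse \<bar>excess S\<bar>)"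
  have c0: "0 \<le> c x" for x by (auto simp: c_def split: prod.split)
  have f0: "0 \<le> f S" for S by (simp add: f_def)
  have hop: "f (g x) = c x" if x0: "x \<in> A \<times> ({1..N} - A)" for x
  proof -
    obtain q r where x: "x = (q, r)" "q \<in> A" "r \<in> {1..N}" "r \<notin> A" using x0 by (cases x) auto
    have "sum \<mu> (g x) = \<mu> r + (sum \<mu> A - \<mu> q)"
      using x finA by (simp add: g_def sum_diff1)
    then have "excess (g x) = lam r - lam q" using LA by (simp add: excess_def \<mu>_def)
    moreover have "cmod (dGamma (V s) (g x) A) = cmod (V s q r)"
    proof -
      have "V s r q = cnj (V s q r)" using x AN by (intro V_herm) auto
      then show ?thesis using dGamma_hop[OF finA x(2,4), of "V s"] by (simp add: x(1) g_def norm_mult)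
    qed
    ultimately show ?thesis by (simp add: f_def c_def x(1))
  qed
  have "(\<Sum>S | S \<in> sector (card A) \<and> excess S \<noteq> 0. (cmod (dGamma (V s) S A))\<^sup>2 / excess S) = (\<Sum>S | S \<in> sector (card A) \<and> excess S \<noteq> 0. f S)"
    using excess_nonneg by (intro sum.cong refl) (auto simp: f_def sector_def divide_inverse)
  also have "\<dots> \<le> (\<Sum>S\<in>g ` (A \<times> ({1..N} - A)). f S)"
  proof -
    have "f S = 0" if "S \<in> sector (card A)" "excess S \<noteq> 0" "S \<notin> g ` (A \<times> ({1..N} - A))" for S
    proof -
      have "dGamma (V s) S A = 0"
        using that LA by (intro dGamma_zero[of S A "{1..N}"]) (auto simp: g_def sector_def)
      then show ?thesis by (simp add: f_def)
    qed
    then have "(\<Sum>S | S \<in> sector (card A) \<and> excess S \<noteq> 0. f S) = (\<Sum>S\<in>{S \<in> sector (card A). excess S \<noteq> 0} \<inter> g ` (A \<times> ({1..N} - A)). f S)"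
      using finite_sector by (intro sum.mono_neutral_right) auto
    also have "\<dots> \<le> (\<Sum>S\<in>g ` (A \<times> ({1..N} - A)). f S)"
      using finA f0 by (intro sum_mono2) auto
    finally show ?thesis .
  qed
  also have "\<dots> \<le> (\<Sum>x\<in>A \<times> ({1..N} - A). (f \<circ> g) x)"
    using finA f0 by (intro sum_image_le) auto
  also have "\<dots> = (\<Sum>x\<in>A \<times> ({1..N} - A). c x)" using hop by (intro sum.cong refl) simp
  also have "\<dots> \<le> (\<Sum>x\<in>{1..j-1} \<times> {j..j+1} \<union> {1..j+1} \<times> {j+2..N}. c x)"
  proof -
    have "(\<Sum>x\<in>A \<times> ({1..N} - A). c x) = (\<Sum>x\<in>(A \<times> ({1..N} - A)) \<inter> ({1..j-1} \<times> {j..j+1} \<union> {1..j+1} \<times> {j+2..N}). c x)"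
    proof (rule sum.mono_neutral_right)
      show "\<forall>x\<in>A \<times> ({1..N} - A) - (A \<times> ({1..N} - A)) \<inter> ({1..j-1} \<times> {j..j+1} \<union> {1..j+1} \<times> {j+2..N}). c x = 0"
      proof
        fix x assume x: "x \<in> A \<times> ({1..N} - A) - (A \<times> ({1..N} - A)) \<inter> ({1..j-1} \<times> {j..j+1} \<union> {1..j+1} \<times> {j+2..N})"
        obtain q r where qr: "x = (q, r)" by (cases x)
        have q: "1 \<le> q" "q \<le> j + 1" using x qr A by auto
        have "r \<notin> A" "1 \<le> r" and rN: "r \<le> N" using x qr by auto
        moreover have "r \<notin> S0" using A(1) \<open>r \<notin> A\<close> by blast
        ultimately have r: "j \<le> r" by auto
        have "\<not> j + 2 \<le> r" using x qr q r rN by auto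
        then have r': "r = j \<or> r = j + 1" using r by auto
        have "\<not> q \<le> j - 1" using x qr q r' by auto
        then have "q = j \<or> q = j + 1" using q by auto
        then have "lam r = lam q" using r' gap(2) by auto
        then show "c x = 0" by (simp add: c_def qr)
      qed
    qed (use finA in auto)
    also have "\<dots> \<le> (\<Sum>x\<in>{1..j-1} \<times> {j..j+1} \<union> {1..j+1} \<times> {j+2..N}. c x)"
      using c0 by (intro sum_mono2) auto
    finally show ?thesis .
  qed
  also have "\<dots> = gap_density s"
  proof -
    have "sum c (P \<times> Q) = (\<Sum>m\<in>P. \<Sum>l\<in>Q. inverse \<bar>lam l - lam m\<bar> * (cmod (V s m l))\<^sup>2)" for P Q
      by (simp add: c_def sum.cartesian_product)
    moreover have "sum c ({1..j-1} \<times> {j..j+1} \<union> {1..j+1} \<times> {j+2..N}) = sum c ({1..j-1} \<times> {j..j+1}) + sum c ({1..j+1} \<times> {j+2..N})"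
      by (rule sum.union_disjoint) auto
    ultimately show ?thesis by (simp only: gap_density_def)
  qed
  finally show ?thesis .
qed

text \<open>
  The product rule together with \<open>dGamma_wedge\<close>; the energies add up because
  \<open>\<mu> r + excess (S - {r}) = excess S\<close>.
\<close>

lemma wedge_evol:
  assumes \<tau>: "0 \<le> \<tau>"
    and \<omega>: "hermitian_system.evol (sector p) excess (\<lambda>t. dGamma (V t)) \<tau> k \<omega>"
    and x: "\<And>r. r \<in> {1..N} \<Longrightarrow> primitive \<tau> (\<lambda>t. x t r) (\<lambda>t. \<i> * (k * of_real (\<mu> r) * x t r + (\<Sum>q\<in>{1..N}. V t r q * x t q)))"
  shows "hermitian_system.evol (sector (Suc p)) excess (\<lambda>t. dGamma (V t)) \<tau> k (\<lambda>t. wedge (x t) (\<omega> t))"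
proof -
  interpret A: hermitian_system "sector p" excess "\<lambda>t. dGamma (V t)" \<tau> by (rule hermitian_system_sector[OF \<tau>])
  interpret B: hermitian_system "sector (Suc p)" excess "\<lambda>t. dGamma (V t)" \<tau> by (rule hermitian_system_sector[OF \<tau>])
  show ?thesis
    unfolding B.evol_def
  proof
    fix S assume S: "S \<in> sector (Suc p)"
    have finS: "finite S" using S by (rule sector_finite)
    have SN: "S \<subseteq> {1..N}" "card S = Suc p" using S by (auto simp: sector_def)
    have rem: "S - {r} \<in> sector p" if "r \<in> S" for r
      using that SN finS by (auto simp: sector_def)
    have Lrem: "\<mu> r + excess (S - {r}) = excess S" if "r \<in> S" for r
      using that finS by (simp add: excess_def sum_diff1)
    define Vx where "Vx = (\<lambda>t r. \<Sum>q\<in>{1..N}. V t r q * x t q)"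
    define W\<omega> where "W\<omega> = (\<lambda>t T. \<Sum>T'\<in>sector p. dGamma (V t) T T' * \<omega> t T')"
    have "primitive \<tau> (\<lambda>t. \<Sum>r\<in>S. fermi_sign r S * (x t r * \<omega> t (S - {r})))
        (\<lambda>t. \<Sum>r\<in>S. fermi_sign r S * (\<i> * (k * of_real (\<mu> r) * x t r + Vx t r) * \<omega> t (S - {r}) +
                 x t r * (\<i> * (k * of_real (excess (S - {r})) * \<omega> t (S - {r}) + W\<omega> t (S - {r})))))"
      using A.evolD[OF \<omega> rem] x SN(1) unfolding A.rhs_def Vx_def W\<omega>_def
      by (intro primitive_sum primitive_cmult primitive_mult) auto
    moreover have "(\<Sum>r\<in>S. fermi_sign r S * (\<i> * (k * of_real (\<mu> r) * x t r + Vx t r) * \<omega> t (S - {r}) +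
                 x t r * (\<i> * (k * of_real (excess (S - {r})) * \<omega> t (S - {r}) + W\<omega> t (S - {r})))))
         = B.rhs k t (wedge (x t) (\<omega> t)) S" for t
    proof -
      have "(\<Sum>r\<in>S. fermi_sign r S * (\<i> * (k * of_real (\<mu> r) * x t r + Vx t r) * \<omega> t (S - {r}) +
                 x t r * (\<i> * (k * of_real (excess (S - {r})) * \<omega> t (S - {r}) + W\<omega> t (S - {r})))))
        = (\<Sum>r\<in>S. \<i> * (k * of_real (excess S) * (fermi_sign r S * x t r * \<omega> t (S - {r})))
             + \<i> * (fermi_sign r S * Vx t r * \<omega> t (S - {r})) + \<i> * (fermi_sign r S * x t r * W\<omega> t (S - {r})))"
        by (intro sum.cong refl) (simp add: Lrem[symmetric] algebra_simps)
      also have "\<dots> = \<i> * (k * of_real (excess S) * wedge (x t) (\<omega> t) S + (wedge (Vx t) (\<omega> t) S + (\<Sum>r\<in>S. fermi_sign r S * x t r * W\<omega> t (S - {r}))))"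
        by (simp add: sum.distrib wedge_def distrib_left add.assoc flip: sum_distrib_left)
      also have "wedge (Vx t) (\<omega> t) S + (\<Sum>r\<in>S. fermi_sign r S * x t r * W\<omega> t (S - {r})) = (\<Sum>T\<in>sector (Suc p). dGamma (V t) S T * wedge (x t) (\<omega> t) T)"
        unfolding Vx_def W\<omega>_def sector_def by (rule dGamma_wedge[symmetric]) (use SN in auto)
      finally show ?thesis by (simp add: B.rhs_def)
    qed
    ultimately show "primitive \<tau> (\<lambda>t. wedge (x t) (\<omega> t) S) (\<lambda>t. B.rhs k t (wedge (x t) (\<omega> t)) S)"
      by (simp add: wedge_def[abs_def] mult.assoc)
  qed
qed

lemma S0_sector: "S0 \<in> sector (j - 1)"
  using j by (auto simp: sector_def)

lemma A_sector: "A1 \<in> sector j" "A2 \<in> sector j"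
  using j by (auto simp: sector_def)

lemma excess_A: "excess S0 = 0" "excess A1 = 0" "excess A2 = 0"
proof -
  have "A1 = insert j S0" using j by auto
  then have "sum \<mu> A1 = \<mu> j + sum \<mu> S0" using j by simp
  then show "excess A1 = 0" by (simp add: excess_def \<mu>_zero)
  have "sum \<mu> A2 = \<mu> (j + 1) + sum \<mu> S0" using j by simp
  then show "excess A2 = 0" by (simp add: excess_def \<mu>_zero)
qed (simp add: excess_def)

lemma ground_S0:
  assumes "S \<in> sector (j - 1)" "excess S = 0"
  shows "S = S0"
proof -
  have S: "S \<subseteq> {1..N}" "card S = j - 1" "finite S" using assms(1) sector_finite[OF assms(1)] by (auto simp: sector_def)
  have "S0 \<subseteq> S" using assms(2) excess_zero_iff[OF S(1)] by blast
  then show ?thesis using S card_subset_eq[of S S0] by simp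
qed

lemma ground_A:
  assumes "S \<in> sector j" "excess S = 0"
  shows "S = A1 \<or> S = A2"
proof -
  have S: "S \<subseteq> {1..N}" "card S = j" "finite S" using assms(1) sector_finite[OF assms(1)] by (auto simp: sector_def)
  have 1: "S0 \<subseteq> S" "S \<subseteq> {1..j + 1}" using assms(2) excess_zero_iff[OF S(1)] by blast+
  have "card (S - S0) = 1" using 1 S j by (subst card_Diff_subset) auto
  then obtain a where a: "S - S0 = {a}" by (auto simp: card_1_singleton_iff)
  then have "a \<in> S" "a \<notin> S0" by auto
  then have "a = j \<or> a = j + 1" using 1(2) by auto
  moreover have "S = insert a S0" using a 1(1) by auto
  moreover have "insert j S0 = A1" using j by auto
  ultimately show ?thesis by auto
qed

end

section \<open>Slow drift of the middle pair\<close>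

context mid_block
begin

lemma A_facts: "A1 \<noteq> A2" "A1 = insert j S0" "j \<notin> S0" "j + 1 \<notin> S0" "j \<in> A1" "A1 - {j} = S0" "A2 - {j + 1} = S0"
  "fermi_sign j A1 = 1" "fermi_sign (j + 1) A2 = 1"
proof -
  show 1: "A1 = insert j S0" using j by auto
  show "j \<notin> S0" "j + 1 \<notin> S0" "j \<in> A1" using j by auto
  then show "A1 - {j} = S0" "A2 - {j + 1} = S0" unfolding 1 by auto
  have "j + 1 \<in> A2" "j + 1 \<notin> A1" by auto
  then show "A1 \<noteq> A2" by blast
  have "{x \<in> A1. j < x} = {}" "{x \<in> A2. j + 1 < x} = {}" by auto
  then show "fermi_sign j A1 = 1" "fermi_sign (j + 1) A2 = 1" by (simp_all only: fermi_sign_def card.empty power_0)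
qed

lemma card_A: "card S0 = j - 1" "card A1 = j" "card A2 = j"
  using j by (auto simp: card_insert_if)

lemma ground_path_S0:
  assumes "0 \<le> \<tau>"
  shows "ground_path (sector (j - 1)) excess (\<lambda>t. dGamma (V t)) \<tau> (\<lambda>t S. if S = S0 then 1 else 0)"
proof (intro ground_path.intro hermitian_system_sector assms ground_path_axioms.intro)
  fix S assume S: "S \<in> sector (j - 1)" "excess S = 0"
  then have "S = S0" by (rule ground_S0)
  moreover have "dGamma (V t) S0 S0 = 0" for t
    using j by (intro dGamma_diagonal V_diag) auto
  ultimately show "primitive \<tau> (\<lambda>t. if S = S0 then 1 else 0) (\<lambda>t. \<i> * (\<Sum>m\<in>sector (j - 1). dGamma (V t) S m * (if m = S0 then 1 else 0)))"
    using primitive_const[of \<tau> 1] finite_sector S0_sector by (simp add: if_distrib[of "\<lambda>x. _ * x"] cong: if_cong)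
next
  fix S and t :: real assume "S \<in> sector (j - 1)" "excess S \<noteq> 0"
  then have "S \<noteq> S0" using excess_A(1) by blast
  then show "(if S = S0 then 1 else 0 :: complex) = 0" by simp
qed

lemma coupling_S0:
  assumes "0 \<le> \<tau>" "\<tau> \<le> t"
  shows "ground_path.coupling (sector (j - 1)) excess (\<lambda>t. dGamma (V t)) (\<lambda>t S. if S = S0 then 1 else 0) \<tau> t \<le> integral {\<tau>..t} gap_density"
proof -
  define h :: "real \<Rightarrow> nat set \<Rightarrow> complex" where "h = (\<lambda>t S. if S = S0 then 1 else 0)"
  interpret G: ground_path "sector (j - 1)" excess "\<lambda>t. dGamma (V t)" \<tau> h
    unfolding h_def by (rule ground_path_S0[OF assms(1)])
  have w: "G.w s S = dGamma (V s) S S0" for s S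
    unfolding G.w_def unfolding h_def
    using finite_sector S0_sector by (simp add: if_distrib[of "\<lambda>x. _ * x"] cong: if_cong)
  have int: "(\<lambda>r. (cmod (G.w r l))\<^sup>2 / excess l) integrable_on {\<tau>..t}" if "l \<in> {l \<in> sector (j - 1). excess l \<noteq> 0}" for l
    using that by (intro integrable_on_divide l2locD(2)[OF G.w_l2 assms(2)]) simp
  have fin: "finite {l \<in> sector (j - 1). excess l \<noteq> 0}" using finite_sector by simp
  have "G.coupling \<tau> t = (\<Sum>l | l \<in> sector (j - 1) \<and> excess l \<noteq> 0. integral {\<tau>..t} (\<lambda>r. (cmod (G.w r l))\<^sup>2 / excess l))"
    unfolding G.coupling_def by simp
  also have "\<dots> = integral {\<tau>..t} (\<lambda>r. \<Sum>l | l \<in> sector (j - 1) \<and> excess l \<noteq> 0. (cmod (G.w r l))\<^sup>2 / excess l)"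
    by (rule integral_sum[symmetric, OF fin int])
  also have "\<dots> \<le> integral {\<tau>..t} gap_density"
  proof (rule integral_le)
    show "(\<lambda>r. \<Sum>l | l \<in> sector (j - 1) \<and> excess l \<noteq> 0. (cmod (G.w r l))\<^sup>2 / excess l) integrable_on {\<tau>..t}"
      by (rule integrable_sum[OF fin int])
    fix s
    have "S0 \<subseteq> {1..j + 1}" by (rule subsetI) auto
    from hop_energy_le[OF order.refl this, of s]
    show "(\<Sum>l | l \<in> sector (j - 1) \<and> excess l \<noteq> 0. (cmod (G.w s l))\<^sup>2 / excess l) \<le> gap_density s"
      unfolding w card_A .
  qed (rule gap_density_integrable[OF assms])
  finally show ?thesis by (simp add: h_def)
qed

text \<open>
  The exterior product of the vector with components \<open>\<psi>1\<close>, \<open>\<psi>2\<close> in the middle pair with the state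
  \<open>{1..j - 1}\<close>.
\<close>

definition pair_path :: "(real \<Rightarrow> complex) \<Rightarrow> (real \<Rightarrow> complex) \<Rightarrow> real \<Rightarrow> nat set \<Rightarrow> complex" where
  "pair_path \<psi>1 \<psi>2 t S = (if S = A1 then \<psi>1 t else if S = A2 then \<psi>2 t else 0)"

lemma sum_pair_path:
  "(\<Sum>S\<in>sector j. f S * pair_path \<psi>1 \<psi>2 t S) = f A1 * \<psi>1 t + f A2 * \<psi>2 t"
proof -
  have "(\<Sum>S\<in>sector j. f S * pair_path \<psi>1 \<psi>2 t S) = (\<Sum>S\<in>{A1, A2}. f S * pair_path \<psi>1 \<psi>2 t S)"
    using A_sector finite_sector by (intro sum.mono_neutral_right) (auto simp: pair_path_def)
  also have "\<dots> = f A1 * \<psi>1 t + f A2 * \<psi>2 t"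
    using A_facts(1) by (simp add: pair_path_def)
  finally show ?thesis .
qed

text \<open>
  The equations of a column of \<open>\<Psi>\<close> at \<open>k = 0\<close>.
\<close>

definition mid_pair :: "(real \<Rightarrow> complex) \<Rightarrow> (real \<Rightarrow> complex) \<Rightarrow> bool" where
  "mid_pair \<psi>1 \<psi>2 \<longleftrightarrow> primitive 0 \<psi>1 (\<lambda>t. \<i> * (V t j (j + 1) * \<psi>2 t)) \<and>
     primitive 0 \<psi>2 (\<lambda>t. \<i> * (V t (j + 1) j * \<psi>1 t)) \<and>
     (\<forall>t\<ge>0. (cmod (\<psi>1 t))\<^sup>2 + (cmod (\<psi>2 t))\<^sup>2 = 1)"

text \<open>
  Between \<open>A1\<close> and \<open>A2\<close> the particle in the top level hops with sign \<open>1\<close>, so the compression of the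
  \<open>j\<close>-particle coupling to the ground states is the \<open>2 \<times> 2\<close> matrix of the system of \<open>\<Psi>\<close>.
\<close>

lemma ground_path_pair:
  assumes "0 \<le> \<tau>" and \<psi>: "mid_pair \<psi>1 \<psi>2"
  shows "ground_path (sector j) excess (\<lambda>t. dGamma (V t)) \<tau> (pair_path \<psi>1 \<psi>2)"
proof (intro ground_path.intro hermitian_system_sector assms ground_path_axioms.intro)
  fix S assume S: "S \<in> sector j" "excess S = 0"
  have d: "dGamma (V t) A1 A1 = 0" "dGamma (V t) A2 A2 = 0" for t
    using j by (auto intro!: dGamma_diagonal V_diag)
  have o: "dGamma (V t) A1 A2 = V t j (j + 1)" "dGamma (V t) A2 A1 = V t (j + 1) j" for t
  proof -
    have "dGamma (V t) (insert j (A2 - {j + 1})) A2 = V t j (j + 1) * fermi_sign j (insert j (A2 - {j + 1})) * fermi_sign (j + 1) A2"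
      using j by (intro dGamma_hop) auto
    then show "dGamma (V t) A1 A2 = V t j (j + 1)"
      unfolding A_facts(7) unfolding A_facts(2)[symmetric] by (simp only: A_facts(8,9) mult_1_right)
    have "dGamma (V t) (insert (j + 1) (A1 - {j})) A1 = V t (j + 1) j * fermi_sign (j + 1) (insert (j + 1) (A1 - {j})) * fermi_sign j A1"
      using j by (intro dGamma_hop) auto
    then show "dGamma (V t) A2 A1 = V t (j + 1) j"
      unfolding A_facts(6) by (simp only: A_facts(8,9) mult_1_right)
  qed
  have p: "primitive \<tau> \<psi>1 (\<lambda>t. \<i> * (V t j (j + 1) * \<psi>2 t))" "primitive \<tau> \<psi>2 (\<lambda>t. \<i> * (V t (j + 1) j * \<psi>1 t))"
    using \<psi> primitive_restart assms(1) by (auto simp: mid_pair_def)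
  from ground_A[OF S] show "primitive \<tau> (\<lambda>t. pair_path \<psi>1 \<psi>2 t S) (\<lambda>t. \<i> * (\<Sum>m\<in>sector j. dGamma (V t) S m * pair_path \<psi>1 \<psi>2 t m))"
  proof
    assume "S = A1"
    then show ?thesis using p(1) unfolding sum_pair_path by (simp only: d o) (simp add: pair_path_def)
  next
    assume "S = A2"
    then show ?thesis using p(2) A_facts(1) unfolding sum_pair_path by (simp only: d o) (simp add: pair_path_def)
  qed
next
  fix S and t :: real assume "S \<in> sector j" "excess S \<noteq> 0"
  then have "S \<noteq> A1" "S \<noteq> A2" using excess_A by blast+
  then show "pair_path \<psi>1 \<psi>2 t S = 0" by (simp add: pair_path_def)
qed

text \<open>
  The amplitude at an excited state is a combination of the amplitudes from \<open>A1\<close> and \<open>A2\<close> with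
  coefficients of norm \<open>1\<close>, so Cauchy--Schwarz reduces the claim to \<open>hop_energy_le\<close> for each of them.
\<close>

lemma coupling_pair:
  assumes "0 \<le> \<tau>" "\<tau> \<le> t" and \<psi>: "mid_pair \<psi>1 \<psi>2"
  shows "ground_path.coupling (sector j) excess (\<lambda>t. dGamma (V t)) (pair_path \<psi>1 \<psi>2) \<tau> t \<le> 2 * integral {\<tau>..t} gap_density"
proof -
  interpret G: ground_path "sector j" excess "\<lambda>t. dGamma (V t)" \<tau> "pair_path \<psi>1 \<psi>2"
    by (rule ground_path_pair[OF assms(1,3)])
  have int: "(\<lambda>r. (cmod (G.w r l))\<^sup>2 / excess l) integrable_on {\<tau>..t}" if "l \<in> {l \<in> sector j. excess l \<noteq> 0}" for l
    using that by (intro integrable_on_divide l2locD(2)[OF G.w_l2 assms(2)]) simp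
  have fin: "finite {l \<in> sector j. excess l \<noteq> 0}" using finite_sector by simp
  have "G.coupling \<tau> t = (\<Sum>l | l \<in> sector j \<and> excess l \<noteq> 0. integral {\<tau>..t} (\<lambda>r. (cmod (G.w r l))\<^sup>2 / excess l))"
    unfolding G.coupling_def by simp
  also have "\<dots> = integral {\<tau>..t} (\<lambda>r. \<Sum>l | l \<in> sector j \<and> excess l \<noteq> 0. (cmod (G.w r l))\<^sup>2 / excess l)"
    by (rule integral_sum[symmetric, OF fin int])
  also have "\<dots> \<le> integral {\<tau>..t} (\<lambda>s. 2 * gap_density s)"
  proof (rule integral_le)
    show "(\<lambda>r. \<Sum>l | l \<in> sector j \<and> excess l \<noteq> 0. (cmod (G.w r l))\<^sup>2 / excess l) integrable_on {\<tau>..t}"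
      by (rule integrable_sum[OF fin int])
    fix s assume s: "s \<in> {\<tau>..t}"
    have "(cmod (G.w s l))\<^sup>2 / excess l \<le> (cmod (dGamma (V s) l A1))\<^sup>2 / excess l + (cmod (dGamma (V s) l A2))\<^sup>2 / excess l" if "l \<in> sector j" for l
    proof -
      have "(cmod (G.w s l))\<^sup>2 = (cmod (\<Sum>b\<in>{True,False}. (if b then dGamma (V s) l A1 else dGamma (V s) l A2) * (if b then \<psi>1 s else \<psi>2 s)))\<^sup>2"
        by (simp add: G.w_def sum_pair_path)
      also have "\<dots> \<le> (\<Sum>b\<in>{True,False}. (cmod (if b then dGamma (V s) l A1 else dGamma (V s) l A2))\<^sup>2) * (\<Sum>b\<in>{True,False}. (cmod (if b then \<psi>1 s else \<psi>2 s))\<^sup>2)"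
        by (rule norm_sum_mult_le)
      also have "(\<Sum>b\<in>{True,False}. (cmod (if b then \<psi>1 s else \<psi>2 s))\<^sup>2) = 1"
        using \<psi> s assms(1) by (simp add: mid_pair_def)
      finally have "(cmod (G.w s l))\<^sup>2 \<le> (cmod (dGamma (V s) l A1))\<^sup>2 + (cmod (dGamma (V s) l A2))\<^sup>2" by simp
      moreover have "0 \<le> excess l" by (rule G.L_nonneg[OF that])
      ultimately show ?thesis by (simp add: divide_right_mono flip: add_divide_distrib)
    qed
    then have "(\<Sum>l | l \<in> sector j \<and> excess l \<noteq> 0. (cmod (G.w s l))\<^sup>2 / excess l)
        \<le> (\<Sum>l | l \<in> sector j \<and> excess l \<noteq> 0. (cmod (dGamma (V s) l A1))\<^sup>2 / excess l) + (\<Sum>l | l \<in> sector j \<and> excess l \<noteq> 0. (cmod (dGamma (V s) l A2))\<^sup>2 / excess l)"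
      unfolding sum.distrib[symmetric] by (intro sum_mono) auto
    also have "\<dots> \<le> gap_density s + gap_density s"
    proof (rule add_mono)
      show "(\<Sum>l | l \<in> sector j \<and> excess l \<noteq> 0. (cmod (dGamma (V s) l A1))\<^sup>2 / excess l) \<le> gap_density s"
        using hop_energy_le[of A1 s] unfolding card_A by auto
      have "A2 \<subseteq> {1..j + 1}" by auto
      then show "(\<Sum>l | l \<in> sector j \<and> excess l \<noteq> 0. (cmod (dGamma (V s) l A2))\<^sup>2 / excess l) \<le> gap_density s"
        using hop_energy_le[of A2 s] unfolding card_A by blast
    qed
    finally show "(\<Sum>l | l \<in> sector j \<and> excess l \<noteq> 0. (cmod (G.w s l))\<^sup>2 / excess l) \<le> 2 * gap_density s" by simp
  qed (intro integrable_on_mult_right gap_density_integrable assms)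
  also have "\<dots> = 2 * integral {\<tau>..t} gap_density" by simp
  finally show ?thesis .
qed

text \<open>
  Let \<open>\<eta>\<close> be the wedge product of \<open>x\<close> and \<open>\<omega>\<close>, a \<open>j\<close>-particle solution of norm at most \<open>1\<close>.  The inner
  product of \<open>v\<close> and \<open>\<eta>\<close> is conserved, and at time \<open>\<tau>\<close> it equals \<open>Q \<tau>\<close>.  At time \<open>T\<close> three replacements
  lead to \<open>Q T\<close>: \<open>v\<close> by its ground path, at the cost \<open>sqrt d\<close>; the expansion of \<open>\<eta>\<close> on the ground states
  by its term \<open>x\<^sub>a * \<omega> T S0\<close>, at the cost \<open>2 * sqrt e\<close>, since all other terms contain excited components of
  \<open>\<omega>\<close>; and \<open>\<omega> T S0\<close> by \<open>1\<close>, at the cost \<open>sqrt e\<close>.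
\<close>

lemma mid_pair_drift_pointwise:
  assumes \<tau>: "0 \<le> \<tau>" "\<tau> \<le> T" and \<psi>: "mid_pair \<psi>1 \<psi>2"
    and \<omega>: "hermitian_system.evol (sector (j - 1)) excess (\<lambda>t. dGamma (V t)) \<tau> (of_real k) \<omega>"
      "\<And>S. S \<in> sector (j - 1) \<Longrightarrow> \<omega> \<tau> S = (if S = S0 then 1 else 0)"
    and v: "hermitian_system.evol (sector j) excess (\<lambda>t. dGamma (V t)) \<tau> (of_real k) v"
      "\<And>S. S \<in> sector j \<Longrightarrow> v \<tau> S = pair_path \<psi>1 \<psi>2 \<tau> S"
    and x: "\<And>r. r \<in> {1..N} \<Longrightarrow> primitive \<tau> (\<lambda>t. x t r) (\<lambda>t. \<i> * (of_real k * of_real (\<mu> r) * x t r + (\<Sum>q\<in>{1..N}. V t r q * x t q)))"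
      "\<And>t. \<tau> \<le> t \<Longrightarrow> (\<Sum>r=1..N. (cmod (x t r))\<^sup>2) \<le> 1"
  defines "Q \<equiv> \<lambda>t. cnj (\<psi>1 t) * x t j + cnj (\<psi>2 t) * x t (j + 1)"
  shows "(cmod (Q T - Q \<tau>))\<^sup>2 \<le> 18 * (\<Sum>S\<in>sector (j - 1). (cmod (\<omega> T S - (if S = S0 then 1 else 0)))\<^sup>2)
       + 2 * (\<Sum>S\<in>sector j. (cmod (v T S - pair_path \<psi>1 \<psi>2 T S))\<^sup>2)"
proof -
  interpret B: hermitian_system "sector j" excess "\<lambda>t. dGamma (V t)" \<tau> by (rule hermitian_system_sector[OF \<tau>(1)])
  define \<eta> where "\<eta> = (\<lambda>t. wedge (x t) (\<omega> t))"
  define h where "h = pair_path \<psi>1 \<psi>2"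
  define ip where "ip = (\<lambda>(a::nat set \<Rightarrow> complex) b. \<Sum>S\<in>sector j. cnj (a S) * b S)"
  define e where "e = (\<Sum>S\<in>sector (j - 1). (cmod (\<omega> T S - (if S = S0 then 1 else 0)))\<^sup>2)"
  define d where "d = (\<Sum>S\<in>sector j. (cmod (v T S - h T S))\<^sup>2)"
  have e0: "0 \<le> e" and d0: "0 \<le> d" by (auto simp: e_def d_def sum_nonneg)
  have j1: "Suc (j - 1) = j" using j by simp
  have \<eta>: "B.evol (of_real k) \<eta>"
    using wedge_evol[OF \<tau>(1) \<omega>(1) x(1)] unfolding j1 \<eta>_def by blast
  have ip_h: "ip (h t) b = cnj (\<psi>1 t) * b A1 + cnj (\<psi>2 t) * b A2" for t b
  proof -
    have "ip (h t) b = (\<Sum>S\<in>sector j. b S * pair_path (\<lambda>t. cnj (\<psi>1 t)) (\<lambda>t. cnj (\<psi>2 t)) t S)"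
      unfolding ip_def h_def by (intro sum.cong refl) (simp add: pair_path_def)
    then show ?thesis by (simp add: sum_pair_path mult.commute)
  qed
  have rem: "insert a S0 - {r} \<in> sector (j - 1)" "insert a S0 - {r} \<noteq> S0" if "a = j \<or> a = j + 1" "r \<in> S0" for a r
  proof -
    have a: "a \<notin> S0" "a \<le> N" "1 \<le> a" using that j by auto
    have "card (insert a S0 - {r}) = j - 1" using a that by (simp add: card_Diff_singleton_if)
    moreover have "S0 \<subseteq> {1..N}" using j by auto
    ultimately show "insert a S0 - {r} \<in> sector (j - 1)" using a unfolding sector_def by auto
    have "r \<notin> insert a S0 - {r}" by simp
    then show "insert a S0 - {r} \<noteq> S0" using that(2) by metis
  qed
  have \<eta>_A: "\<eta> t A1 = x t j * \<omega> t S0 + (\<Sum>r\<in>S0. fermi_sign r A1 * x t r * \<omega> t (A1 - {r}))"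
    "\<eta> t A2 = x t (j + 1) * \<omega> t S0 + (\<Sum>r\<in>S0. fermi_sign r A2 * x t r * \<omega> t (A2 - {r}))" for t
  proof -
    have f: "fermi_sign j (insert j S0) = 1" "insert j S0 - {j} = S0"
      using A_facts(6,8) unfolding A_facts(2) by simp_all
    have "\<eta> t A1 = fermi_sign j (insert j S0) * x t j * \<omega> t (insert j S0 - {j}) + (\<Sum>r\<in>S0. fermi_sign r (insert j S0) * x t r * \<omega> t (insert j S0 - {r}))"
      unfolding \<eta>_def wedge_def A_facts(2) using A_facts(3) by (intro sum.insert) auto
    then show "\<eta> t A1 = x t j * \<omega> t S0 + (\<Sum>r\<in>S0. fermi_sign r A1 * x t r * \<omega> t (A1 - {r}))"
      unfolding f A_facts(2) by simp
    show "\<eta> t A2 = x t (j + 1) * \<omega> t S0 + (\<Sum>r\<in>S0. fermi_sign r A2 * x t r * \<omega> t (A2 - {r}))"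
      unfolding \<eta>_def wedge_def using A_facts(4)
      by (subst sum.insert) (auto simp only: A_facts finite_atLeastAtMost mult_1_left)
  qed
  have start: "\<eta> \<tau> A1 = x \<tau> j" "\<eta> \<tau> A2 = x \<tau> (j + 1)"
  proof -
    have z: "(\<Sum>r\<in>S0. fermi_sign r (insert a S0) * x \<tau> r * \<omega> \<tau> (insert a S0 - {r})) = 0" if "a = j \<or> a = j + 1" for a
      using rem[OF that] \<omega>(2) by (intro sum.neutral) simp
    show "\<eta> \<tau> A1 = x \<tau> j" using z[of j] \<omega>(2)[OF S0_sector] \<eta>_A(1)[of \<tau>] A_facts(2) by simp
    show "\<eta> \<tau> A2 = x \<tau> (j + 1)" using z[of "j + 1"] \<omega>(2)[OF S0_sector] \<eta>_A(2)[of \<tau>] by simp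
  qed
  \<comment> \<open>conservation of the inner product between the times \<open>\<tau>\<close> and \<open>T\<close>\<close>
  have Q\<tau>: "ip (v T) (\<eta> T) = Q \<tau>"
  proof -
    have "ip (v T) (\<eta> T) = ip (v \<tau>) (\<eta> \<tau>)"
      unfolding ip_def by (rule B.inner_conserved[OF \<eta> v(1) \<tau>(2)])
    also have "\<dots> = ip (h \<tau>) (\<eta> \<tau>)"
      unfolding ip_def h_def using v(2) by (intro sum.cong refl) simp
    finally show ?thesis unfolding ip_h start Q_def .
  qed
  \<comment> \<open>at time \<open>\<tau>\<close> only the states \<open>insert r S0\<close> carry weight, namely \<open>cmod (x \<tau> r)\<^sup>2\<close>\<close>
  have \<eta>norm: "(\<Sum>S\<in>sector j. (cmod (\<eta> T S))\<^sup>2) \<le> 1"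
  proof -
    have "(\<Sum>S\<in>sector j. (cmod (\<eta> T S))\<^sup>2) = (\<Sum>S\<in>sector j. (cmod (\<eta> \<tau> S))\<^sup>2)"
      by (rule B.norm_conserved[OF \<eta> \<tau>(2)])
    also have "\<dots> \<le> (\<Sum>S\<in>(\<lambda>r. insert r S0) ` ({1..N} - S0). (cmod (\<eta> \<tau> S))\<^sup>2)"
    proof -
      have "\<eta> \<tau> S = 0" if S: "S \<in> sector j" "S \<notin> (\<lambda>r. insert r S0) ` ({1..N} - S0)" for S
        unfolding \<eta>_def wedge_def
      proof (intro sum.neutral ballI)
        fix r assume r: "r \<in> S"
        have SN: "S \<subseteq> {1..N}" "card S = j" "finite S" using S(1) sector_finite[OF S(1)] by (auto simp: sector_def)
        have "S - {r} \<in> sector (j - 1)" using SN r by (auto simp: sector_def)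
        moreover have "S - {r} \<noteq> S0"
        proof
          assume e: "S - {r} = S0"
          then have eqS: "S = insert r S0" and "r \<notin> S0" using r by blast+
          then have "r \<in> {1..N} - S0" using SN(1) r by blast
          from image_eqI[where f = "\<lambda>r. insert r S0", OF eqS this] show False using S(2) by blast
        qed
        ultimately show "fermi_sign r S * x \<tau> r * \<omega> \<tau> (S - {r}) = 0" using \<omega>(2) by simp
      qed
      then have "(\<Sum>S\<in>sector j. (cmod (\<eta> \<tau> S))\<^sup>2) = (\<Sum>S\<in>sector j \<inter> (\<lambda>r. insert r S0) ` ({1..N} - S0). (cmod (\<eta> \<tau> S))\<^sup>2)"
        using finite_sector by (intro sum.mono_neutral_right) auto
      also have "\<dots> \<le> (\<Sum>S\<in>(\<lambda>r. insert r S0) ` ({1..N} - S0). (cmod (\<eta> \<tau> S))\<^sup>2)"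
        by (intro sum_mono2) auto
      finally show ?thesis .
    qed
    also have "\<dots> \<le> (\<Sum>r\<in>{1..N} - S0. ((\<lambda>S. (cmod (\<eta> \<tau> S))\<^sup>2) \<circ> (\<lambda>r. insert r S0)) r)"
      by (intro sum_image_le) auto
    also have "\<dots> = (\<Sum>r\<in>{1..N} - S0. (cmod (x \<tau> r))\<^sup>2)"
    proof (rule sum.cong[OF refl])
      fix r assume r: "r \<in> {1..N} - S0"
      have "\<eta> \<tau> (insert r S0) = fermi_sign r (insert r S0) * x \<tau> r * \<omega> \<tau> (insert r S0 - {r})
           + (\<Sum>q\<in>S0. fermi_sign q (insert r S0) * x \<tau> q * \<omega> \<tau> (insert r S0 - {q}))"
        unfolding \<eta>_def wedge_def using r by (subst sum.insert) auto
      also have "insert r S0 - {r} = S0" using r by auto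
      also have "\<omega> \<tau> S0 = 1" using \<omega>(2)[OF S0_sector] by simp
      also have "(\<Sum>q\<in>S0. fermi_sign q (insert r S0) * x \<tau> q * \<omega> \<tau> (insert r S0 - {q})) = 0"
      proof (intro sum.neutral ballI)
        fix q assume q: "q \<in> S0"
        have "card (insert r S0 - {q}) = j - 1" using r q by (simp add: card_Diff_singleton_if)
        moreover have "S0 \<subseteq> {1..N}" using j by auto
        ultimately have "insert r S0 - {q} \<in> sector (j - 1)" using r unfolding sector_def by auto
        moreover have "q \<notin> insert r S0 - {q}" by simp
        then have "insert r S0 - {q} \<noteq> S0" using q by metis
        ultimately show "fermi_sign q (insert r S0) * x \<tau> q * \<omega> \<tau> (insert r S0 - {q}) = 0" using \<omega>(2) by simp
      qed
      finally have "cmod (\<eta> \<tau> (insert r S0)) = cmod (x \<tau> r)" by (simp add: norm_mult)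
      then show "((\<lambda>S. (cmod (\<eta> \<tau> S))\<^sup>2) \<circ> (\<lambda>r. insert r S0)) r = (cmod (x \<tau> r))\<^sup>2" by simp
    qed
    also have "\<dots> \<le> (\<Sum>r=1..N. (cmod (x \<tau> r))\<^sup>2)" by (intro sum_mono2) auto
    also have "\<dots> \<le> 1" by (rule x(2)) simp
    finally show ?thesis .
  qed
  have hv: "cmod (ip (h T) (\<eta> T) - ip (v T) (\<eta> T)) \<le> sqrt d"
  proof -
    have "ip (h T) (\<eta> T) - ip (v T) (\<eta> T) = (\<Sum>S\<in>sector j. cnj (h T S - v T S) * \<eta> T S)"
      by (simp add: ip_def sum_subtractf algebra_simps)
    also have "(cmod \<dots>)\<^sup>2 \<le> (\<Sum>S\<in>sector j. (cmod (cnj (h T S - v T S)))\<^sup>2) * (\<Sum>S\<in>sector j. (cmod (\<eta> T S))\<^sup>2)"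
      by (rule norm_sum_mult_le)
    also have "(\<Sum>S\<in>sector j. (cmod (cnj (h T S - v T S)))\<^sup>2) = d"
      unfolding d_def complex_mod_cnj by (simp add: norm_minus_commute)
    also have "d * (\<Sum>S\<in>sector j. (cmod (\<eta> T S))\<^sup>2) \<le> d" using \<eta>norm d0 mult_left_le by blast
    finally show ?thesis by (rule real_le_rsqrt)
  qed
  have \<psi>T: "(cmod (\<psi>1 T))\<^sup>2 + (cmod (\<psi>2 T))\<^sup>2 = 1" using \<psi> \<tau> by (simp add: mid_pair_def)
  have \<psi>1: "cmod (\<psi>1 T) \<le> 1" "cmod (\<psi>2 T) \<le> 1"
  proof -
    have "(cmod (\<psi>1 T))\<^sup>2 \<le> 1\<^sup>2" "(cmod (\<psi>2 T))\<^sup>2 \<le> 1\<^sup>2"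
      using \<psi>T zero_le_power2[of "cmod (\<psi>1 T)"] zero_le_power2[of "cmod (\<psi>2 T)"] unfolding one_power2 by linarith+
    then show "cmod (\<psi>1 T) \<le> 1" "cmod (\<psi>2 T) \<le> 1" using power2_le_imp_le zero_le_one by blast+
  qed
  have QT: "cmod (Q T) \<le> 1"
  proof -
    have "(cmod (Q T))\<^sup>2 = (cmod (\<Sum>b\<in>{True,False}. (if b then cnj (\<psi>1 T) else cnj (\<psi>2 T)) * (if b then x T j else x T (j + 1))))\<^sup>2"
      by (simp add: Q_def)
    also have "\<dots> \<le> (\<Sum>b\<in>{True,False}. (cmod (if b then cnj (\<psi>1 T) else cnj (\<psi>2 T)))\<^sup>2) * (\<Sum>b\<in>{True,False}. (cmod (if b then x T j else x T (j + 1)))\<^sup>2)"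
      by (rule norm_sum_mult_le)
    also have "\<dots> = (\<Sum>r\<in>{j, j + 1}. (cmod (x T r))\<^sup>2)" using \<psi>T by simp
    also have "\<dots> \<le> (\<Sum>r=1..N. (cmod (x T r))\<^sup>2)" using j by (intro sum_mono2) auto
    also have "\<dots> \<le> 1" using \<tau> by (intro x(2))
    finally show ?thesis using power2_le_imp_le[OF _ zero_le_one, of "cmod (Q T)"] unfolding one_power2 by blast
  qed
  have eS0: "cmod (1 - \<omega> T S0) \<le> sqrt e"
  proof -
    have "(cmod (\<omega> T S0 - (if S0 = S0 then 1 else 0)))\<^sup>2 \<le> e"
      unfolding e_def using S0_sector finite_sector by (intro member_le_sum[where f = "\<lambda>S. (cmod (\<omega> T S - (if S = S0 then 1 else 0)))\<^sup>2"]) auto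
    then show ?thesis by (intro real_le_rsqrt) (simp add: norm_minus_commute)
  qed
  have hop: "cmod (\<Sum>r\<in>S0. fermi_sign r (insert a S0) * x T r * \<omega> T (insert a S0 - {r})) \<le> sqrt e" if a: "a = j \<or> a = j + 1" for a
  proof -
    have "(cmod (\<Sum>r\<in>S0. (fermi_sign r (insert a S0) * x T r) * \<omega> T (insert a S0 - {r})))\<^sup>2
       \<le> (\<Sum>r\<in>S0. (cmod (fermi_sign r (insert a S0) * x T r))\<^sup>2) * (\<Sum>r\<in>S0. (cmod (\<omega> T (insert a S0 - {r})))\<^sup>2)"
      by (rule norm_sum_mult_le)
    also have "(\<Sum>r\<in>S0. (cmod (fermi_sign r (insert a S0) * x T r))\<^sup>2) \<le> 1"
    proof -
      have "(\<Sum>r\<in>S0. (cmod (fermi_sign r (insert a S0) * x T r))\<^sup>2) = (\<Sum>r\<in>S0. (cmod (x T r))\<^sup>2)" by (simp add: norm_mult)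
      also have "\<dots> \<le> (\<Sum>r=1..N. (cmod (x T r))\<^sup>2)" using j by (intro sum_mono2) auto
      also have "\<dots> \<le> 1" using \<tau> by (intro x(2))
      finally show ?thesis .
    qed
    also have "(\<Sum>r\<in>S0. (cmod (\<omega> T (insert a S0 - {r})))\<^sup>2) \<le> e"
    proof -
      have "(\<Sum>r\<in>S0. (cmod (\<omega> T (insert a S0 - {r})))\<^sup>2) = (\<Sum>r\<in>S0. (cmod (\<omega> T (insert a S0 - {r}) - (if insert a S0 - {r} = S0 then 1 else 0)))\<^sup>2)"
        using rem[OF a] by (intro sum.cong refl) simp
      also have "\<dots> = (\<Sum>S\<in>(\<lambda>r. insert a S0 - {r}) ` S0. (cmod (\<omega> T S - (if S = S0 then 1 else 0)))\<^sup>2)"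
      proof (subst sum.reindex)
        show "inj_on (\<lambda>r. insert a S0 - {r}) S0" by (rule inj_onI) blast
      qed simp
      also have "\<dots> \<le> e"
        unfolding e_def using finite_sector rem[OF a] by (intro sum_mono2) auto
      finally show ?thesis .
    qed
    finally show ?thesis using e0 by (intro real_le_rsqrt) (simp add: mult_right_mono sum_nonneg)
  qed
  have b: "cmod (Q T * \<omega> T S0 - ip (h T) (\<eta> T)) \<le> 2 * sqrt e"
  proof -
    have eq: "Q T * \<omega> T S0 - ip (h T) (\<eta> T) = - (cnj (\<psi>1 T) * (\<Sum>r\<in>S0. fermi_sign r A1 * x T r * \<omega> T (A1 - {r})))
         - cnj (\<psi>2 T) * (\<Sum>r\<in>S0. fermi_sign r A2 * x T r * \<omega> T (A2 - {r}))"
      unfolding ip_h Q_def \<eta>_A by (simp add: algebra_simps)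
    have "cmod (Q T * \<omega> T S0 - ip (h T) (\<eta> T)) \<le> cmod (\<psi>1 T) * cmod (\<Sum>r\<in>S0. fermi_sign r A1 * x T r * \<omega> T (A1 - {r}))
        + cmod (\<psi>2 T) * cmod (\<Sum>r\<in>S0. fermi_sign r A2 * x T r * \<omega> T (A2 - {r}))"
      unfolding eq by (rule order.trans[OF norm_triangle_ineq4]) (simp only: norm_minus_cancel norm_mult complex_mod_cnj order.refl)
    also have "\<dots> \<le> 1 * sqrt e + 1 * sqrt e"
    proof (rule add_mono; rule mult_mono)
      show "cmod (\<Sum>r\<in>S0. fermi_sign r A1 * x T r * \<omega> T (A1 - {r})) \<le> sqrt e"
        using hop[OF disjI1[OF refl]] unfolding A_facts(2)[symmetric] .
      show "cmod (\<Sum>r\<in>S0. fermi_sign r A2 * x T r * \<omega> T (A2 - {r})) \<le> sqrt e"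
        by (rule hop[OF disjI2[OF refl]])
    qed (rule zero_le_one norm_ge_zero \<psi>1)+
    finally show ?thesis by simp
  qed
  have a: "cmod (Q T - Q T * \<omega> T S0) \<le> sqrt e"
  proof -
    have "cmod (Q T - Q T * \<omega> T S0) = cmod (Q T) * cmod (1 - \<omega> T S0)"
      by (simp add: norm_mult[symmetric] algebra_simps)
    also have "\<dots> \<le> 1 * sqrt e" using QT eS0 by (intro mult_mono) auto
    finally show ?thesis by simp
  qed
  have "cmod (Q T - Q \<tau>) \<le> 3 * sqrt e + sqrt d"
  proof -
    have tri: "cmod (a + b + c) \<le> cmod a + cmod b + cmod c" for a b c
      using norm_triangle_ineq[of "a + b" c] norm_triangle_ineq[of a b] by linarith
    have "Q T - Q \<tau> = (Q T - Q T * \<omega> T S0) + (Q T * \<omega> T S0 - ip (h T) (\<eta> T)) + (ip (h T) (\<eta> T) - ip (v T) (\<eta> T))"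
      using Q\<tau> by simp
    then have "cmod (Q T - Q \<tau>) \<le> cmod (Q T - Q T * \<omega> T S0) + cmod (Q T * \<omega> T S0 - ip (h T) (\<eta> T)) + cmod (ip (h T) (\<eta> T) - ip (v T) (\<eta> T))"
      using tri by metis
    then show ?thesis using a b hv by linarith
  qed
  then have "(cmod (Q T - Q \<tau>))\<^sup>2 \<le> (3 * sqrt e + sqrt d)\<^sup>2" by (intro power_mono) auto
  also have "\<dots> \<le> 18 * e + 2 * d"
  proof -
    have "(3 * sqrt e + sqrt d)\<^sup>2 + (3 * sqrt e - sqrt d)\<^sup>2 = 18 * (sqrt e)\<^sup>2 + 2 * (sqrt d)\<^sup>2"
      by (simp add: power2_eq_square algebra_simps)
    then show ?thesis using zero_le_power2[of "3 * sqrt e - sqrt d"]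
      unfolding real_sqrt_pow2[OF e0] real_sqrt_pow2[OF d0] by linarith
  qed
  finally show ?thesis by (simp add: e_def d_def h_def)
qed

text \<open>
  The constant is \<open>18 * 3 \<pi> + 2 * (2 * 3 \<pi>) = 66 \<pi>\<close>, from \<open>adiabatic_estimate\<close> for the two particle numbers.
\<close>

lemma mid_pair_drift:
  assumes \<tau>: "0 \<le> \<tau>" "\<tau> \<le> T" and \<psi>: "mid_pair \<psi>1 \<psi>2"
    and x: "\<And>k r. r \<in> {1..N} \<Longrightarrow> primitive \<tau> (\<lambda>t. x k t r) (\<lambda>t. \<i> * (of_real k * of_real (\<mu> r) * x k t r + (\<Sum>q\<in>{1..N}. V t r q * x k t q)))"
      "\<And>k t. \<tau> \<le> t \<Longrightarrow> (\<Sum>r=1..N. (cmod (x k t r))\<^sup>2) \<le> 1"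
  defines "Q \<equiv> \<lambda>k t. cnj (\<psi>1 t) * x k t j + cnj (\<psi>2 t) * x k t (j + 1)"
  shows "(\<integral>\<^sup>+k. ennreal ((cmod (Q k T - Q k \<tau>))\<^sup>2) \<partial>lborel) \<le> ennreal (66 * pi * integral {\<tau>..T} gap_density)"
proof -
  interpret G0: ground_path "sector (j - 1)" excess "\<lambda>t. dGamma (V t)" \<tau> "\<lambda>t S. if S = S0 then 1 else 0"
    by (rule ground_path_S0[OF \<tau>(1)])
  interpret G: ground_path "sector j" excess "\<lambda>t. dGamma (V t)" \<tau> "pair_path \<psi>1 \<psi>2"
    by (rule ground_path_pair[OF \<tau>(1) \<psi>])
  obtain \<omega> :: "real \<Rightarrow> real \<Rightarrow> nat set \<Rightarrow> complex" where \<omega>: "\<And>k. G0.evol (of_real k) (\<omega> k)"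
    "\<And>k S. S \<in> sector (j - 1) \<Longrightarrow> \<omega> k \<tau> S = (if S = S0 then 1 else 0)"
    "\<And>S. S \<in> sector (j - 1) \<Longrightarrow> continuous_on UNIV (\<lambda>k. \<omega> k T S)"
    "(\<integral>\<^sup>+k. ennreal (\<Sum>S\<in>sector (j - 1). (cmod (\<omega> k T S - (if S = S0 then 1 else 0)))\<^sup>2) \<partial>lborel) \<le> ennreal (3 * pi * G0.coupling \<tau> T)"
    using G0.adiabatic_estimate \<tau>(2) by blast
  obtain v :: "real \<Rightarrow> real \<Rightarrow> nat set \<Rightarrow> complex" where v: "\<And>k. G.evol (of_real k) (v k)"
    "\<And>k S. S \<in> sector j \<Longrightarrow> v k \<tau> S = pair_path \<psi>1 \<psi>2 \<tau> S"
    "\<And>S. S \<in> sector j \<Longrightarrow> continuous_on UNIV (\<lambda>k. v k T S)"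
    "(\<integral>\<^sup>+k. ennreal (\<Sum>S\<in>sector j. (cmod (v k T S - pair_path \<psi>1 \<psi>2 T S))\<^sup>2) \<partial>lborel) \<le> ennreal (3 * pi * G.coupling \<tau> T)"
    using G.adiabatic_estimate \<tau>(2) by blast
  define e where "e = (\<lambda>k. \<Sum>S\<in>sector (j - 1). (cmod (\<omega> k T S - (if S = S0 then 1 else 0)))\<^sup>2)"
  define d where "d = (\<lambda>k. \<Sum>S\<in>sector j. (cmod (v k T S - pair_path \<psi>1 \<psi>2 T S))\<^sup>2)"
  have e0: "0 \<le> e k" and d0: "0 \<le> d k" for k by (auto simp: e_def d_def sum_nonneg)
  have "continuous_on UNIV e" "continuous_on UNIV d"
    unfolding e_def d_def by (intro continuous_intros \<omega>(3) v(3); assumption)+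
  then have me: "e \<in> borel_measurable lborel" "d \<in> borel_measurable lborel"
    unfolding measurable_lborel2 by (auto intro: borel_measurable_continuous_onI)
  have mE: "(\<lambda>k. ennreal (e k)) \<in> borel_measurable lborel" "(\<lambda>k. ennreal (d k)) \<in> borel_measurable lborel"
    using me by (auto intro: measurable_compose[OF _ measurable_ennreal])
  have "(\<integral>\<^sup>+k. ennreal ((cmod (Q k T - Q k \<tau>))\<^sup>2) \<partial>lborel) \<le> (\<integral>\<^sup>+k. ennreal 18 * ennreal (e k) + ennreal 2 * ennreal (d k) \<partial>lborel)"
  proof (rule nn_integral_mono)
    fix k
    have "(cmod (Q k T - Q k \<tau>))\<^sup>2 \<le> 18 * e k + 2 * d k"
      unfolding Q_def e_def d_def
      by (rule mid_pair_drift_pointwise[OF \<tau> \<psi> \<omega>(1,2) v(1,2) x])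
    then have "ennreal ((cmod (Q k T - Q k \<tau>))\<^sup>2) \<le> ennreal (18 * e k + 2 * d k)" by (rule ennreal_leI)
    also have "\<dots> = ennreal 18 * ennreal (e k) + ennreal 2 * ennreal (d k)"
      using e0 d0 by (simp only: ennreal_plus ennreal_mult' mult_nonneg_nonneg zero_le_numeral)
    finally show "ennreal ((cmod (Q k T - Q k \<tau>))\<^sup>2) \<le> ennreal 18 * ennreal (e k) + ennreal 2 * ennreal (d k)" .
  qed
  also have "\<dots> = ennreal 18 * (\<integral>\<^sup>+k. ennreal (e k) \<partial>lborel) + ennreal 2 * (\<integral>\<^sup>+k. ennreal (d k) \<partial>lborel)"
    using mE by (simp only: nn_integral_add nn_integral_cmult borel_measurable_times_ennreal borel_measurable_const)
  also have "\<dots> \<le> ennreal 18 * ennreal (3 * pi * integral {\<tau>..T} gap_density) + ennreal 2 * ennreal (3 * pi * (2 * integral {\<tau>..T} gap_density))"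
  proof (intro add_mono mult_left_mono)
    have "3 * pi * G0.coupling \<tau> T \<le> 3 * pi * integral {\<tau>..T} gap_density"
      by (intro mult_left_mono coupling_S0[OF \<tau>]) auto
    then show "(\<integral>\<^sup>+k. ennreal (e k) \<partial>lborel) \<le> ennreal (3 * pi * integral {\<tau>..T} gap_density)"
      unfolding e_def by (intro order.trans[OF \<omega>(4)] ennreal_leI)
    have "3 * pi * G.coupling \<tau> T \<le> 3 * pi * (2 * integral {\<tau>..T} gap_density)"
      by (intro mult_left_mono coupling_pair[OF \<tau> \<psi>]) auto
    then show "(\<integral>\<^sup>+k. ennreal (d k) \<partial>lborel) \<le> ennreal (3 * pi * (2 * integral {\<tau>..T} gap_density))"
      unfolding d_def by (intro order.trans[OF v(4)] ennreal_leI)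
  qed auto
  also have "\<dots> = ennreal (66 * pi * integral {\<tau>..T} gap_density)"
  proof -
    define a b where "a = 3 * pi * integral {\<tau>..T} gap_density" and "b = 3 * pi * (2 * integral {\<tau>..T} gap_density)"
    have "0 \<le> integral {\<tau>..T} gap_density" by (intro integral_nonneg gap_density_integrable \<tau> gap_density_nonneg)
    then have ab: "0 \<le> a" "0 \<le> b" by (simp_all add: a_def b_def)
    have "66 * pi * integral {\<tau>..T} gap_density = 18 * a + 2 * b" by (simp add: a_def b_def)
    also have "ennreal (18 * a + 2 * b) = ennreal 18 * ennreal a + ennreal 2 * ennreal b"
      using ab by (simp only: ennreal_plus ennreal_mult' mult_nonneg_nonneg zero_le_numeral)
    finally show ?thesis by (simp only: a_def b_def)
  qed
  finally show ?thesis .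
qed

end

section \<open>Limits in square mean\<close>

text \<open>
  The Riesz--Fischer argument.  Along times \<open>s\<^sub>n\<close> at which \<open>g\<close> is within \<open>8\<^sup>-\<^sup>n\<close> of its limit, the
  increments \<open>d\<^sub>n\<close> satisfy \<open>\<integral>2\<^sup>n norm (d\<^sub>n)\<^sup>2 \<le> 4\<^sup>-\<^sup>n\<close>, so \<open>\<Sum>norm (d\<^sub>n)\<close> converges almost everywhere.
  Fatou's lemma transfers the estimates to the pointwise limit.
\<close>

lemma L2_limit:
  fixes F :: "real \<Rightarrow> real \<Rightarrow> 'b :: {banach, second_countable_topology}" and g :: "real \<Rightarrow> real"
  assumes meas: "\<And>t. 0 \<le> t \<Longrightarrow> F t \<in> borel_measurable borel"
    and est: "\<And>\<tau> T. 0 \<le> \<tau> \<Longrightarrow> \<tau> \<le> T \<Longrightarrow> (\<integral>\<^sup>+k. ennreal ((norm (F T k - F \<tau> k))\<^sup>2) \<partial>lborel) \<le> ennreal (g T - g \<tau>)"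
    and mono: "\<And>\<tau> T. 0 \<le> \<tau> \<Longrightarrow> \<tau> \<le> T \<Longrightarrow> g \<tau> \<le> g T"
    and bound: "\<And>t. 0 \<le> t \<Longrightarrow> g t \<le> B"
  shows "\<exists>Finf \<in> borel_measurable borel. \<exists>G \<le> B. (g \<longlongrightarrow> G) at_top \<and>
     (\<forall>\<tau>\<ge>0. (\<integral>\<^sup>+k. ennreal ((norm (F \<tau> k - Finf k))\<^sup>2) \<partial>lborel) \<le> ennreal (G - g \<tau>))"
proof -
  define G where "G = (SUP t\<in>{0..}. g t)"
  have bdd: "bdd_above (g ` {0..})" using bound by (auto intro!: bdd_aboveI[of _ B])
  have gG: "g t \<le> G" if "0 \<le> t" for t unfolding G_def using that bdd by (intro cSUP_upper) auto
  have GB: "G \<le> B" unfolding G_def using bound by (intro cSUP_least) auto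
  have near: "\<exists>t\<ge>0. a < g t" if "a < G" for a
    using that bdd unfolding G_def by (subst (asm) less_cSUP_iff) auto
  have lim: "(g \<longlongrightarrow> G) at_top"
  proof (rule order_tendstoI)
    fix a assume "a < G"
    then obtain t where t: "0 \<le> t" "a < g t" using near by blast
    show "\<forall>\<^sub>F x in at_top. a < g x"
      using eventually_ge_at_top[of t] by eventually_elim (use t mono in \<open>meson less_le_trans\<close>)
  next
    fix a assume "G < a"
    show "\<forall>\<^sub>F x in at_top. g x < a"
      using eventually_ge_at_top[of 0] by eventually_elim (use gG \<open>G < a\<close> in \<open>meson le_less_trans\<close>)
  qed
  have "\<exists>t. real n \<le> t \<and> G - (1/8) ^ n < g t" for n
  proof -
    have "G - (1/8) ^ n < G" by simp
    then obtain t where t: "0 \<le> t" "G - (1/8) ^ n < g t" using near by blast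
    have "g t \<le> g (max t (real n))" using t by (intro mono) auto
    then show ?thesis using t by (intro exI[of _ "max t (real n)"]) auto
  qed
  then obtain T where T: "\<And>n. real n \<le> T n" "\<And>n. G - (1/8) ^ n < g (T n)" by metis
  \<comment> \<open>partial sums make the chosen times increasing\<close>
  define s where "s = (\<lambda>n. \<Sum>i\<le>n. T i)"
  have T0: "0 \<le> T n" for n using T(1)[of n] by (meson of_nat_0_le_iff order.trans)
  have sT: "T n \<le> s n" for n unfolding s_def using T0 by (intro member_le_sum) auto
  have s0: "0 \<le> s n" for n using T0 sT order.trans by blast
  have sS: "s n \<le> s (Suc n)" for n using T0[of "Suc n"] by (simp add: s_def)
  define d where "d = (\<lambda>n k. F (s (Suc n)) k - F (s n) k)"
  have Fm [measurable]: "F (s n) \<in> borel_measurable borel" for n by (rule meas[OF s0])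
  have dm [measurable]: "d n \<in> borel_measurable borel" for n unfolding d_def by measurable
  have dint: "(\<integral>\<^sup>+k. ennreal (2 ^ n * (norm (d n k))\<^sup>2) \<partial>lborel) \<le> ennreal ((1/4) ^ n)" for n
  proof -
    have "(\<integral>\<^sup>+k. ennreal (2 ^ n * (norm (d n k))\<^sup>2) \<partial>lborel) = (\<integral>\<^sup>+k. ennreal (2 ^ n) * ennreal ((norm (d n k))\<^sup>2) \<partial>lborel)"
      by (intro nn_integral_cong ennreal_mult) auto
    also have "\<dots> = ennreal (2 ^ n) * (\<integral>\<^sup>+k. ennreal ((norm (d n k))\<^sup>2) \<partial>lborel)"
      by (rule nn_integral_cmult) measurable
    also have "\<dots> \<le> ennreal (2 ^ n) * ennreal ((1/8) ^ n)"
    proof (rule mult_left_mono)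
      have "g (s (Suc n)) - g (s n) \<le> (1/8) ^ n"
        using gG[OF s0, of "Suc n"] mono[OF T0 sT, of n] T(2)[of n] by linarith
      then show "(\<integral>\<^sup>+k. ennreal ((norm (d n k))\<^sup>2) \<partial>lborel) \<le> ennreal ((1/8) ^ n)"
        unfolding d_def by (intro order.trans[OF est[OF s0 sS]] ennreal_leI)
    qed simp
    also have "\<dots> = ennreal ((1/4) ^ n)"
      by (subst ennreal_mult[symmetric]) (auto simp flip: power_mult_distrib)
    finally show ?thesis .
  qed
  have "(\<integral>\<^sup>+k. (\<Sum>n. ennreal (2 ^ n * (norm (d n k))\<^sup>2)) \<partial>lborel) = (\<Sum>n. \<integral>\<^sup>+k. ennreal (2 ^ n * (norm (d n k))\<^sup>2) \<partial>lborel)"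
    by (rule nn_integral_suminf) measurable
  also have "\<dots> \<le> (\<Sum>n. ennreal ((1/4) ^ n))" by (intro suminf_le dint) auto
  also have "\<dots> < \<infinity>"
    by (subst suminf_ennreal2) (auto simp: summable_geometric)
  finally have "(\<integral>\<^sup>+k. (\<Sum>n. ennreal (2 ^ n * (norm (d n k))\<^sup>2)) \<partial>lborel) \<noteq> \<infinity>" by simp
  then have "AE k in lborel. (\<Sum>n. ennreal (2 ^ n * (norm (d n k))\<^sup>2)) \<noteq> \<infinity>"
    by (intro nn_integral_PInf_AE) measurable
  then have conv: "AE k in lborel. convergent (\<lambda>n. F (s n) k)"
  proof eventually_elim
    case (elim k)
    have "summable (\<lambda>n. 2 ^ n * (norm (d n k))\<^sup>2)"
      using elim by (intro summable_suminf_not_top) auto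
    then have "summable (\<lambda>n. (2 ^ n * (norm (d n k))\<^sup>2 + (1/2) ^ n) / 2)"
      by (intro summable_divide summable_add summable_geometric) auto
    then have "summable (\<lambda>n. d n k)"
    proof (rule summable_comparison_test'[where N = 0])
      fix n
      have "0 \<le> (2 ^ n * norm (d n k) - 1)\<^sup>2 / 2 ^ n" by simp
      also have "\<dots> = 2 ^ n * (norm (d n k))\<^sup>2 - 2 * norm (d n k) + (1/2) ^ n"
        by (simp add: power2_eq_square field_simps)
      finally show "norm (d n k) \<le> (2 ^ n * (norm (d n k))\<^sup>2 + (1/2) ^ n) / 2" by simp
    qed
    then have "convergent (\<lambda>n. \<Sum>i<n. d i k)" by (simp add: summable_iff_convergent)
    moreover have "(\<Sum>i<n. d i k) = F (s n) k - F (s 0) k" for n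
      unfolding d_def by (induction n) auto
    ultimately have "convergent (\<lambda>n. F (s n) k - F (s 0) k)" by simp
    from convergent_add[OF this convergent_const[of "F (s 0) k"]] show ?case by simp
  qed
  define Finf where "Finf = (\<lambda>k. lim (\<lambda>n. F (s n) k))"
  have Finf [measurable]: "Finf \<in> borel_measurable borel"
    unfolding Finf_def by (rule borel_measurable_lim_metric) (rule Fm)
  have fin: "(\<integral>\<^sup>+k. ennreal ((norm (F \<tau> k - Finf k))\<^sup>2) \<partial>lborel) \<le> ennreal (G - g \<tau>)" if \<tau>: "0 \<le> \<tau>" for \<tau>
  proof -
    have [measurable]: "F \<tau> \<in> borel_measurable borel" by (rule meas[OF \<tau>])
    have "(\<integral>\<^sup>+k. ennreal ((norm (F \<tau> k - Finf k))\<^sup>2) \<partial>lborel) = (\<integral>\<^sup>+k. liminf (\<lambda>n. ennreal ((norm (F (s n) k - F \<tau> k))\<^sup>2)) \<partial>lborel)"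
    proof (rule nn_integral_cong_AE)
      show "AE k in lborel. ennreal ((norm (F \<tau> k - Finf k))\<^sup>2) = liminf (\<lambda>n. ennreal ((norm (F (s n) k - F \<tau> k))\<^sup>2))"
        using conv
      proof eventually_elim
        case (elim k)
        then have "(\<lambda>n. F (s n) k) \<longlonglongrightarrow> Finf k" by (simp add: Finf_def convergent_LIMSEQ_iff)
        then have "(\<lambda>n. ennreal ((norm (F (s n) k - F \<tau> k))\<^sup>2)) \<longlonglongrightarrow> ennreal ((norm (Finf k - F \<tau> k))\<^sup>2)"
          by (intro tendsto_ennrealI tendsto_intros)
        from lim_imp_Liminf[OF trivial_limit_sequentially this] show ?case
          unfolding norm_minus_commute[of "F \<tau> k" "Finf k"] by (rule sym)
      qed
    qed
    also have "\<dots> \<le> liminf (\<lambda>n. \<integral>\<^sup>+k. ennreal ((norm (F (s n) k - F \<tau> k))\<^sup>2) \<partial>lborel)"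
      by (rule nn_integral_liminf) measurable
    also have "\<dots> \<le> liminf (\<lambda>n. ennreal (G - g \<tau>))"
    proof (rule Liminf_mono)
      obtain m where m: "\<tau> \<le> real m" using real_arch_simple by blast
      show "\<forall>\<^sub>F n in sequentially. (\<integral>\<^sup>+k. ennreal ((norm (F (s n) k - F \<tau> k))\<^sup>2) \<partial>lborel) \<le> ennreal (G - g \<tau>)"
        using eventually_ge_at_top[of m]
      proof eventually_elim
        case (elim n)
        have "\<tau> \<le> s n" using m elim T(1)[of n] sT[of n] by simp
        then have "(\<integral>\<^sup>+k. ennreal ((norm (F (s n) k - F \<tau> k))\<^sup>2) \<partial>lborel) \<le> ennreal (g (s n) - g \<tau>)"
          by (rule est[OF \<tau>])
        also have "\<dots> \<le> ennreal (G - g \<tau>)" using gG[OF s0, of n] by (intro ennreal_leI) simp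
        finally show ?case .
      qed
    qed
    also have "\<dots> = ennreal (G - g \<tau>)" by (simp add: Liminf_const)
    finally show ?thesis .
  qed
  show ?thesis using Finf GB lim fin by blast
qed

section \<open>The matrix norms and the integral equations\<close>

lemma norm_mat_square: "(norm (A :: complex^2^2))\<^sup>2 = (\<Sum>a\<in>UNIV. \<Sum>b\<in>UNIV. (cmod (A $ a $ b))\<^sup>2)"
  by (simp add: norm_vec_def L2_set_def sum_nonneg)

lemma mat_mult_norm_le:
  fixes A B :: "complex^2^2"
  shows "norm (A ** B) \<le> norm A * norm B"
proof -
  have "(cmod ((A ** B) $ a $ b))\<^sup>2 \<le> (\<Sum>c\<in>UNIV. (cmod (A $ a $ c))\<^sup>2) * (\<Sum>c\<in>UNIV. (cmod (B $ c $ b))\<^sup>2)" for a b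
    unfolding matrix_matrix_mult_def by (simp only: vec_lambda_beta norm_sum_mult_le)
  then have "(norm (A ** B))\<^sup>2 \<le> (\<Sum>a\<in>UNIV. \<Sum>b\<in>UNIV. (\<Sum>c\<in>UNIV. (cmod (A $ a $ c))\<^sup>2) * (\<Sum>c\<in>UNIV. (cmod (B $ c $ b))\<^sup>2))"
    unfolding norm_mat_square by (intro sum_mono)
  also have "\<dots> = (\<Sum>a\<in>UNIV. \<Sum>c\<in>UNIV. (cmod (A $ a $ c))\<^sup>2) * (\<Sum>b\<in>UNIV. \<Sum>c\<in>UNIV. (cmod (B $ c $ b))\<^sup>2)"
    by (simp only: sum_product)
  also have "(\<Sum>b\<in>UNIV. \<Sum>c\<in>UNIV. (cmod (B $ c $ b))\<^sup>2) = (norm B)\<^sup>2"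
    unfolding norm_mat_square by (rule sum.swap)
  finally have "(norm (A ** B))\<^sup>2 \<le> (norm A * norm B)\<^sup>2"
    by (simp only: norm_mat_square power_mult_distrib)
  then show ?thesis by (rule power2_le_imp_le) simp
qed

text \<open>
  The integrals in \<open>solves_ivp\<close> run over open intervals, which differ from the closed ones by a null
  set.
\<close>

lemma solves_ivp_primitive:
  assumes X: "solves_ivp I H 0 X" and ml: "m \<in> I" "l \<in> I"
  shows "primitive 0 (\<lambda>t. X t m l) (\<lambda>s. \<i> * (\<Sum>p\<in>I. H s m p * X s p l))"
    and "X 0 m l = (if m = l then 1 else 0)"
proof -
  define f where "f = (\<lambda>s. \<i> * (\<Sum>p\<in>I. H s m p * X s p l))"
  have a: "f absolutely_integrable_on {0..t} \<and> X t m l = (if m = l then 1 else 0) + integral {0..t} f" if t: "0 \<le> t" for t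
  proof -
    have i: "interval_lebesgue_integrable lebesgue (ereal 0) (ereal t) f"
      and e: "X t m l = (if m = l then 1 else 0) + interval_lebesgue_integral lebesgue (ereal 0) (ereal t) f"
      using X ml t unfolding solves_ivp_def f_def by auto
    have ai: "f absolutely_integrable_on {0<..<t}"
      using i t by (simp add: interval_lebesgue_integrable_def)
    have "interval_lebesgue_integral lebesgue (ereal 0) (ereal t) f = set_lebesgue_integral lebesgue {0<..<t} f"
      using t by (simp add: interval_lebesgue_integral_def)
    also have "\<dots> = integral {0<..<t} f" using ai by (rule set_lebesgue_integral_eq_integral(2))
    also have "\<dots> = integral {0..t} f" by (rule integral_open_interval_real[symmetric])
    finally show ?thesis using ai e by (simp add: absolutely_integrable_on_Icc_iff_Ioo)
  qed
  show init: "X 0 m l = (if m = l then 1 else 0)" using a[of 0] by simp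
  show "primitive 0 (\<lambda>t. X t m l) (\<lambda>s. \<i> * (\<Sum>p\<in>I. H s m p * X s p l))"
    unfolding primitive_def f_def[symmetric] init using a by blast
qed

text \<open>
  Test the operator norm on a unit vector.  The supremum has to be shown finite first, as it would
  otherwise have no meaning.
\<close>

lemma cmod_entry_le_opnorm:
  assumes m: "m \<in> {1..N}" and l: "l \<in> {1..N}"
  shows "cmod (A m l) \<le> opnorm N A"
proof -
  define B where "B = {x :: nat \<Rightarrow> complex. L2_set (\<lambda>l. cmod (x l)) {1..N} \<le> 1}"
  define f where "f = (\<lambda>x :: nat \<Rightarrow> complex. L2_set (\<lambda>m. cmod (\<Sum>l=1..N. A m l * x l)) {1..N})"
  have "f x \<le> (\<Sum>m=1..N. \<Sum>l=1..N. cmod (A m l))" if x: "x \<in> B" for x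
  proof -
    have x1: "cmod (x l) \<le> 1" if "l \<in> {1..N}" for l
    proof -
      have "cmod (x l) \<le> L2_set (\<lambda>l. cmod (x l)) {1..N}"
        by (rule member_le_L2_set[OF _ that, of "\<lambda>l. cmod (x l)"]) simp
      then show ?thesis using x by (simp add: B_def)
    qed
    have "f x \<le> (\<Sum>m=1..N. cmod (\<Sum>l=1..N. A m l * x l))"
      unfolding f_def by (rule L2_set_le_sum) simp
    also have "\<dots> \<le> (\<Sum>m=1..N. \<Sum>l=1..N. cmod (A m l))"
    proof (intro sum_mono sum_norm_le)
      fix m l assume "l \<in> {1..N}"
      then show "cmod (A m l * x l) \<le> cmod (A m l)" using x1 by (simp add: norm_mult mult_left_le)
    qed
    finally show ?thesis .
  qed
  then have bdd: "bdd_above (f ` B)" by (auto intro!: bdd_aboveI)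
  define e where "e = (\<lambda>l'. if l' = l then 1 else 0 :: complex)"
  have "L2_set (\<lambda>l. cmod (e l)) {1..N} = 1"
  proof -
    have "(\<Sum>l'\<in>{1..N}. (cmod (e l'))\<^sup>2) = (\<Sum>l'\<in>{1..N}. if l' = l then 1 else 0)"
      by (intro sum.cong) (auto simp: e_def)
    then show ?thesis using l by (simp add: L2_set_def)
  qed
  then have eB: "e \<in> B" by (simp add: B_def)
  have "cmod (A m l) = cmod (\<Sum>l'=1..N. A m l' * e l')"
    using l by (simp add: e_def if_distrib[of "\<lambda>x. _ * x"] cong: if_cong)
  also have "\<dots> \<le> f e"
    unfolding f_def by (rule member_le_L2_set[OF _ m, of "\<lambda>m. cmod (\<Sum>l'=1..N. A m l' * e l')"]) simp
  also have "\<dots> \<le> opnorm N A"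
    unfolding opnorm_def B_def[symmetric] f_def[symmetric] by (rule cSUP_upper[OF eB bdd])
  finally show ?thesis .
qed

lemma L2_loc_l2loc:
  assumes V: "L2_loc N V" and ml: "m \<in> {1..N}" "l \<in> {1..N}"
  shows "l2loc 0 (\<lambda>t. if 0 \<le> t then V t m l else 0)"
proof (rule l2loc_bound[where g = "\<lambda>t s. (opnorm N (V s))\<^sup>2"])
  fix t :: real assume t: "0 \<le> t"
  have "set_borel_measurable lebesgue {0..} (\<lambda>t. V t m l)" using V ml by (simp add: L2_loc_def)
  moreover have "(\<lambda>t. indicat_real {0..} t *\<^sub>R V t m l) = (\<lambda>t. if 0 \<le> t then V t m l else 0)"
    by (auto simp: indicator_def)
  ultimately have "(\<lambda>t. if 0 \<le> t then V t m l else 0) \<in> borel_measurable lebesgue"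
    by (simp add: set_borel_measurable_def)
  then show "(\<lambda>t. if 0 \<le> t then V t m l else 0) \<in> borel_measurable (lebesgue_on {0..t})"
    by (rule measurable_restrict_space1)
  have "(\<lambda>s. (opnorm N (V s))\<^sup>2) absolutely_integrable_on {0..t}" using V t by (simp add: L2_loc_def)
  then show "(\<lambda>s. (opnorm N (V s))\<^sup>2) integrable_on {0..t}" by (simp add: absolutely_integrable_on_def)
next
  fix t s :: real assume "0 \<le> s" "s \<le> t"
  then show "(cmod (if 0 \<le> s then V s m l else 0))\<^sup>2 \<le> (opnorm N (V s))\<^sup>2"
    using cmod_entry_le_opnorm[OF ml, of "V s"] by (simp add: power_mono)
qed

lemma mnorm_le: "mnorm A \<le> norm A" "0 \<le> mnorm A"
proof -
  have "norm (A *v x) \<le> norm A * norm x" for x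
  proof -
    have v: "(norm (y :: complex^2))\<^sup>2 = (\<Sum>a\<in>UNIV. (cmod (y $ a))\<^sup>2)" for y
      by (simp add: norm_vec_def L2_set_def sum_nonneg)
    have "(norm (A *v x))\<^sup>2 \<le> (\<Sum>a\<in>UNIV. (\<Sum>b\<in>UNIV. (cmod (A $ a $ b))\<^sup>2) * (\<Sum>b\<in>UNIV. (cmod (x $ b))\<^sup>2))"
      unfolding v matrix_vector_mult_def by (intro sum_mono) (simp only: vec_lambda_beta norm_sum_mult_le)
    also have "\<dots> = (norm A * norm x)\<^sup>2"
      unfolding power_mult_distrib norm_mat_square v by (rule sum_distrib_right[symmetric])
    finally show ?thesis by (rule power2_le_imp_le) simp
  qed
  then show "mnorm A \<le> norm A" unfolding mnorm_def by (rule onorm_le)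
  show "0 \<le> mnorm A" unfolding mnorm_def by (rule onorm_pos_le) simp
qed

lemma L2_sq_le: "L2_sq F \<le> (\<integral>\<^sup>+k. ennreal ((norm (F k))\<^sup>2) \<partial>lborel)"
  unfolding L2_sq_def by (intro nn_integral_mono ennreal_leI power_mono mnorm_le)

lemma continuous_on_mat:
  fixes F :: "real \<Rightarrow> complex^2^2"
  assumes "\<And>a b. continuous_on S (\<lambda>k. F k $ a $ b)"
  shows "continuous_on S F"
proof -
  have "continuous_on S (\<lambda>k. \<chi> a b. F k $ a $ b)"
    by (intro continuous_on_vec_lambda assms)
  then show ?thesis by (simp add: vec_lambda_eta)
qed

lemma matrix_inv_eqI:
  fixes A B :: "complex^2^2"
  assumes "B ** A = mat 1"
  shows "matrix_inv A = B"
proof -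
  have AB: "A ** B = mat 1" using assms matrix_left_right_inverse by blast
  show ?thesis
    unfolding matrix_inv_def
  proof (rule some_equality)
    show "A ** B = mat 1 \<and> B ** A = mat 1" using AB assms by blast
    fix A' assume "A ** A' = mat 1 \<and> A' ** A = mat 1"
    then have "B ** (A ** A') = B ** mat 1" by simp
    then show "A' = B" by (simp only: matrix_mul_assoc assms matrix_mul_lid matrix_mul_rid)
  qed
qed

section \<open>The block of the evolution\<close>

text \<open>
  The data of the theorem with the integral equations in the form of primitives; \<open>\<Psi>\<close> is the
  solution with initial time \<open>0\<close>.
\<close>

locale mid_block_evolution = mid_block +
  fixes X :: "real \<Rightarrow> real \<Rightarrow> nat \<Rightarrow> nat \<Rightarrow> complex" and \<Psi> :: "real \<Rightarrow> real \<Rightarrow> complex^2^2"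
  assumes lam1: "lam 1 = 0"
    and X_primitive: "\<And>k m l. m \<in> {1..N} \<Longrightarrow> l \<in> {1..N} \<Longrightarrow>
       primitive 0 (\<lambda>t. X t k m l) (\<lambda>t. \<i> * (of_real k * of_real (lam m) * X t k m l + (\<Sum>p\<in>{1..N}. V t m p * X t k p l)))"
    and X_init: "\<And>k m l. m \<in> {1..N} \<Longrightarrow> l \<in> {1..N} \<Longrightarrow> X 0 k m l = (if m = l then 1 else 0)"
    and \<Psi>_primitive: "\<And>k b. primitive 0 (\<lambda>t. \<Psi> t k $ 1 $ b) (\<lambda>t. \<i> * (of_real (k * lam j) * \<Psi> t k $ 1 $ b + V t j (j + 1) * \<Psi> t k $ 2 $ b))"
      "\<And>k b. primitive 0 (\<lambda>t. \<Psi> t k $ 2 $ b) (\<lambda>t. \<i> * (of_real (k * lam j) * \<Psi> t k $ 2 $ b + V t (j + 1) j * \<Psi> t k $ 1 $ b))"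
    and \<Psi>_init: "\<And>k. \<Psi> 0 k = mat 1"
begin

sublocale full: hermitian_system "{1..N}" lam V 0
proof
  show "0 \<le> lam i" if "i \<in> {1..N}" for i using lam_le[of 1 i] lam1 that by auto
  show "V t m i = cnj (V t i m)" if "i \<in> {1..N}" "m \<in> {1..N}" for i m t using that by (rule V_herm)
  show "l2loc 0 (\<lambda>t. V t i m)" if "i \<in> {1..N}" "m \<in> {1..N}" for i m using that by (rule V_l2)
qed simp

lemma X_evol:
  assumes "b \<in> {1..N}"
  shows "full.evol (of_real k) (\<lambda>t r. X t k r b)"
  unfolding full.evol_def full.rhs_def using X_primitive assms by blast

lemma X_norm:
  assumes "b \<in> {1..N}" "0 \<le> t"
  shows "(\<Sum>r=1..N. (cmod (X t k r b))\<^sup>2) = 1"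
proof -
  have "(\<Sum>r=1..N. (cmod (X t k r b))\<^sup>2) = (\<Sum>r=1..N. (cmod (X 0 k r b))\<^sup>2)"
    by (rule full.norm_conserved[OF X_evol[OF assms(1)] assms(2)])
  also have "\<dots> = (\<Sum>r=1..N. if r = b then 1 else 0)"
    using X_init assms by (intro sum.cong refl) auto
  also have "\<dots> = 1" using assms by simp
  finally show ?thesis .
qed

text \<open>
  By uniqueness \<open>X\<close> is the restriction to the real line of the solution that is entire in \<open>k\<close>.
\<close>

lemma X_continuous:
  assumes "r \<in> {1..N}" "b \<in> {1..N}" "0 \<le> t"
  shows "continuous_on UNIV (\<lambda>k. X t k r b)"
proof -
  obtain u :: "complex \<Rightarrow> real \<Rightarrow> nat \<Rightarrow> complex" where u: "\<And>k. full.evol k (u k)"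
    "\<And>k i. i \<in> {1..N} \<Longrightarrow> u k 0 i = (if i = b then 1 else 0)"
    "\<And>t i. 0 \<le> t \<Longrightarrow> i \<in> {1..N} \<Longrightarrow> (\<lambda>k. u k t i) holomorphic_on UNIV"
    using full.solution_exists[of "\<lambda>i. if i = b then 1 else 0"] by blast
  have "X t k r b = u (of_real k) t r" for k
  proof (rule full.evol_unique[OF X_evol[OF assms(2)] u(1)])
    fix i assume "i \<in> {1..N}"
    then show "X 0 k i b = u (of_real k) 0 i" using X_init assms u(2) by simp
  qed (use assms in auto)
  moreover have "continuous_on UNIV (\<lambda>k::real. u (of_real k) t r)"
    by (intro continuous_on_compose2[OF holomorphic_on_imp_continuous_on[OF u(3)[OF assms(3,1)]]] continuous_intros) auto
  ultimately show ?thesis by simp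
qed

text \<open>
  The coupling of the \<open>2 \<times> 2\<close> system; its diagonal part \<open>k lam j\<close> is a multiple of the identity and is
  carried by the phase instead.
\<close>

definition W2 :: "real \<Rightarrow> 2 \<Rightarrow> 2 \<Rightarrow> complex" where
  "W2 t a b = (if a = b then 0 else if a = 1 then V t j (j + 1) else V t (j + 1) j)"

sublocale pair: hermitian_system "UNIV :: 2 set" "\<lambda>_. 0" W2 0
proof
  have jN: "j \<in> {1..N}" "j + 1 \<in> {1..N}" using j by auto
  show "W2 t b a = cnj (W2 t a b)" for a b :: 2 and t
  proof -
    have h: "V t (j + 1) j = cnj (V t j (j + 1))" by (rule V_herm[OF jN])
    show ?thesis using h exhaust_2[of a] exhaust_2[of b] by (auto simp: W2_def)
  qed
  show "l2loc 0 (\<lambda>t. W2 t a b)" for a b :: 2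
    using exhaust_2[of a] exhaust_2[of b] V_l2[OF jN] V_l2[OF jN(2,1)] by (auto simp: W2_def l2loc_zero)
qed auto

text \<open>
  Multiplication by this factor shifts the energies so that the middle pair is at \<open>0\<close>.
\<close>

definition phase :: "real \<Rightarrow> real \<Rightarrow> complex" where
  "phase k t = exp (- \<i> * of_real (k * lam j) * of_real t)"

lemma phase_primitive: "primitive 0 (phase k) (\<lambda>t. - \<i> * of_real (k * lam j) * phase k t)"
proof (rule primitive_has_vector_derivative)
  fix t
  have "((\<lambda>z. exp (- \<i> * of_real (k * lam j) * z)) has_field_derivative - \<i> * of_real (k * lam j) * phase k t) (at (of_real t))"
    unfolding phase_def by (auto intro!: derivative_eq_intros)
  from has_vector_derivative_real_field[OF this]
  show "(phase k has_vector_derivative - \<i> * of_real (k * lam j) * phase k t) (at t)"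
    by (simp add: phase_def[abs_def] o_def)
next
  show "continuous_on UNIV (\<lambda>t. - \<i> * of_real (k * lam j) * phase k t)"
    unfolding phase_def by (intro continuous_intros)
qed

lemma cnj_phase: "cnj (phase k t) * phase k t = 1" "phase k t * cnj (phase k t) = 1" "cmod (phase k t) = 1"
  by (simp_all add: phase_def exp_cnj flip: exp_add)

text \<open>
  At \<open>k = 0\<close> there is no phase; by \<open>\<Psi>_eq\<close> this matrix determines \<open>\<Psi>\<close> for all \<open>k\<close>.
\<close>

definition \<psi> :: "2 \<Rightarrow> 2 \<Rightarrow> real \<Rightarrow> complex" where "\<psi> a b t = \<Psi> t 0 $ a $ b"

lemma pair_rhs: "pair.rhs k t v a = \<i> * (if a = 1 then V t j (j + 1) * v 2 else V t (j + 1) j * v 1)"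
  using exhaust_2[of a] by (auto simp: pair.rhs_def sum_2 W2_def)

lemma \<psi>_evol: "pair.evol k (\<lambda>t a. \<psi> a b t)"
  unfolding pair.evol_def
proof
  fix a :: 2
  show "primitive 0 (\<lambda>t. \<psi> a b t) (\<lambda>t. pair.rhs k t (\<lambda>a. \<psi> a b t) a)"
    using exhaust_2[of a] \<Psi>_primitive[of 0 b] by (auto simp: pair_rhs \<psi>_def)
qed

lemma gauged_\<Psi>_evol: "pair.evol k' (\<lambda>t a. phase k t * \<Psi> t k $ a $ b)"
  unfolding pair.evol_def
proof
  fix a :: 2
  from primitive_mult[OF phase_primitive[of k] \<Psi>_primitive(1)[of k b]] primitive_mult[OF phase_primitive[of k] \<Psi>_primitive(2)[of k b]] exhaust_2[of a]
  show "primitive 0 (\<lambda>t. phase k t * \<Psi> t k $ a $ b) (\<lambda>t. pair.rhs k' t (\<lambda>a. phase k t * \<Psi> t k $ a $ b) a)"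
    by (auto simp: pair_rhs algebra_simps)
qed

lemma \<Psi>_eq:
  assumes "0 \<le> t"
  shows "\<Psi> t k $ a $ b = cnj (phase k t) * \<psi> a b t"
proof -
  have "phase k t * \<Psi> t k $ a $ b = \<psi> a b t"
    by (rule pair.evol_unique[OF gauged_\<Psi>_evol[of 0] \<psi>_evol])
       (use assms \<Psi>_init in \<open>auto simp: \<psi>_def phase_def\<close>)
  then have "cnj (phase k t) * (phase k t * \<Psi> t k $ a $ b) = cnj (phase k t) * \<psi> a b t" by simp
  then show ?thesis by (simp add: cnj_phase mult.assoc[symmetric])
qed

lemma \<psi>_orthonormal:
  assumes "0 \<le> t"
  shows "(\<Sum>a\<in>UNIV. cnj (\<psi> a b t) * \<psi> a c t) = (if b = c then 1 else 0)"
proof -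
  have "(\<Sum>a\<in>UNIV. cnj (\<psi> a b t) * \<psi> a c t) = (\<Sum>a\<in>UNIV. cnj (\<psi> a b 0) * \<psi> a c 0)"
    by (rule pair.inner_conserved[OF \<psi>_evol[of "of_real 0"] \<psi>_evol assms])
  also have "\<dots> = (if b = c then 1 else 0)"
    using exhaust_2[of b] exhaust_2[of c] by (auto simp: \<psi>_def \<Psi>_init mat_def sum_2)
  finally show ?thesis .
qed

lemma mid_pair_\<psi>: "mid_pair (\<psi> 1 b) (\<psi> 2 b)"
  unfolding mid_pair_def
proof (intro conjI allI impI)
  show "primitive 0 (\<psi> 1 b) (\<lambda>t. \<i> * (V t j (j + 1) * \<psi> 2 b t))"
    using pair.evolD[OF \<psi>_evol[of 0 b] UNIV_I[of 1]] by (simp add: pair_rhs)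
  show "primitive 0 (\<psi> 2 b) (\<lambda>t. \<i> * (V t (j + 1) j * \<psi> 1 b t))"
    using pair.evolD[OF \<psi>_evol[of 0 b] UNIV_I[of 2]] by (simp add: pair_rhs)
  fix t :: real assume "0 \<le> t"
  from \<psi>_orthonormal[OF this, of b b]
  have "complex_of_real ((cmod (\<psi> 1 b t))\<^sup>2 + (cmod (\<psi> 2 b t))\<^sup>2) = of_real 1"
    by (simp add: sum_2 cnj_mult_self)
  then show "(cmod (\<psi> 1 b t))\<^sup>2 + (cmod (\<psi> 2 b t))\<^sup>2 = 1" by (simp only: of_real_eq_iff)
qed

text \<open>
  The conjugate transpose of \<open>\<Psi>\<close>, which is its inverse.
\<close>

definition \<Psi>_adj :: "real \<Rightarrow> real \<Rightarrow> complex^2^2" where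
  "\<Psi>_adj t k = (\<chi> a b. cnj (\<Psi> t k $ b $ a))"

lemma \<Psi>_adj_left: 
  assumes "0 \<le> t"
  shows "\<Psi>_adj t k ** \<Psi> t k = mat 1"
proof -
  have "(\<Psi>_adj t k ** \<Psi> t k) $ b $ c = mat 1 $ b $ c" for b c
  proof -
    have "(\<Psi>_adj t k ** \<Psi> t k) $ b $ c = (\<Sum>a\<in>UNIV. cnj (\<Psi> t k $ a $ b) * \<Psi> t k $ a $ c)"
      by (simp add: matrix_matrix_mult_def \<Psi>_adj_def)
    also have "\<dots> = (\<Sum>a\<in>UNIV. cnj (\<psi> a b t) * \<psi> a c t)"
    proof (rule sum.cong[OF refl])
      fix a
      have "cnj (\<Psi> t k $ a $ b) * \<Psi> t k $ a $ c = (phase k t * cnj (phase k t)) * (cnj (\<psi> a b t) * \<psi> a c t)"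
        unfolding \<Psi>_eq[OF assms] by simp
      then show "cnj (\<Psi> t k $ a $ b) * \<Psi> t k $ a $ c = cnj (\<psi> a b t) * \<psi> a c t"
        by (simp only: cnj_phase mult_1_left)
    qed
    also have "\<dots> = mat 1 $ b $ c" using \<psi>_orthonormal[OF assms] by (simp add: mat_def)
    finally show ?thesis .
  qed
  then show ?thesis by (simp add: vec_eq_iff)
qed

lemma norm_\<Psi>:
  assumes "0 \<le> t"
  shows "(norm (\<Psi> t k))\<^sup>2 = 2"
proof -
  have "(norm (\<Psi> t k))\<^sup>2 = (\<Sum>a\<in>UNIV. \<Sum>b\<in>UNIV. (cmod (\<psi> a b t))\<^sup>2)"
    unfolding norm_mat_square \<Psi>_eq[OF assms] by (simp add: norm_mult cnj_phase)
  also have "\<dots> = 2"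
  proof -
    have "(cmod (\<psi> 1 b t))\<^sup>2 + (cmod (\<psi> 2 b t))\<^sup>2 = 1" for b
      using mid_pair_\<psi>[of b] assms unfolding mid_pair_def by blast
    from this[of 1] this[of 2] show ?thesis unfolding sum_2 by linarith
  qed
  finally show ?thesis .
qed

text \<open>
  \<open>\<Psi>\<^sup>-\<^sup>1 Y\<close>, written with the adjoint so that its entries are inner products.
\<close>

definition Q :: "real \<Rightarrow> real \<Rightarrow> complex^2^2" where
  "Q t k = \<Psi>_adj t k ** block j (X t k)"

definition col :: "2 \<Rightarrow> nat" where "col c = (if c = 1 then j else j + 1)"

lemma col_in: "col c \<in> {1..N}"
  using j by (auto simp: col_def)

lemma Q_entry:
  assumes "0 \<le> t"
  shows "Q t k $ b $ c = cnj (\<psi> 1 b t) * (phase k t * X t k j (col c)) + cnj (\<psi> 2 b t) * (phase k t * X t k (j + 1) (col c))"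
proof -
  have "Q t k $ b $ c = cnj (\<Psi> t k $ 1 $ b) * X t k j (col c) + cnj (\<Psi> t k $ 2 $ b) * X t k (j + 1) (col c)"
    using exhaust_2[of c] by (auto simp: Q_def matrix_matrix_mult_def \<Psi>_adj_def sum_2 block_def col_def)
  then show ?thesis unfolding \<Psi>_eq[OF assms] by (simp add: mult_ac)
qed

lemma Q_start: "Q 0 k = mat 1"
proof -
  have "\<Psi>_adj 0 k = mat 1" by (auto simp: \<Psi>_adj_def \<Psi>_init mat_def vec_eq_iff)
  moreover have "block j (X 0 k) = mat 1"
    using j by (auto simp: block_def mat_def vec_eq_iff X_init forall_2)
  ultimately show ?thesis by (simp add: Q_def)
qed

lemma Q_continuous:
  assumes "0 \<le> t"
  shows "continuous_on UNIV (Q t)"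
proof (rule continuous_on_mat)
  fix b c
  have jN: "j \<in> {1..N}" "j + 1 \<in> {1..N}" using j by auto
  show "continuous_on UNIV (\<lambda>k. Q t k $ b $ c)"
    unfolding Q_entry[OF assms] phase_def
    by (intro continuous_intros X_continuous[OF jN(1) col_in assms] X_continuous[OF jN(2) col_in assms])
qed

lemma Q_drift_entry:
  assumes "0 \<le> \<tau>" "\<tau> \<le> T"
  shows "(\<integral>\<^sup>+k. ennreal ((cmod (Q T k $ b $ c - Q \<tau> k $ b $ c))\<^sup>2) \<partial>lborel) \<le> ennreal (66 * pi * integral {\<tau>..T} gap_density)"
proof -
  define x where "x = (\<lambda>k t r. phase k t * X t k r (col c))"
  have 0: "0 \<le> T" using assms by simp
  have "primitive \<tau> (\<lambda>t. x k t r) (\<lambda>t. \<i> * (of_real k * of_real (\<mu> r) * x k t r + (\<Sum>q\<in>{1..N}. V t r q * x k t q)))"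
    if r: "r \<in> {1..N}" for k r
  proof (rule primitive_restart[OF primitive_cong assms(1)])
    show "primitive 0 (\<lambda>t. phase k t * X t k r (col c))
       (\<lambda>t. (- \<i> * of_real (k * lam j) * phase k t) * X t k r (col c) +
           phase k t * (\<i> * (of_real k * of_real (lam r) * X t k r (col c) + (\<Sum>p\<in>{1..N}. V t r p * X t k p (col c)))))"
      by (rule primitive_mult[OF phase_primitive X_primitive[OF r col_in]])
    fix t
    have "(\<Sum>q\<in>{1..N}. V t r q * x k t q) = phase k t * (\<Sum>q\<in>{1..N}. V t r q * X t k q (col c))"
      by (simp add: x_def sum_distrib_left mult_ac)
    then show "(- \<i> * of_real (k * lam j) * phase k t) * X t k r (col c) +
           phase k t * (\<i> * (of_real k * of_real (lam r) * X t k r (col c) + (\<Sum>p\<in>{1..N}. V t r p * X t k p (col c))))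
        = \<i> * (of_real k * of_real (\<mu> r) * x k t r + (\<Sum>q\<in>{1..N}. V t r q * x k t q))"
      by (simp add: x_def \<mu>_def algebra_simps)
  qed (simp add: x_def)
  moreover have "(\<Sum>r=1..N. (cmod (x k t r))\<^sup>2) \<le> 1" if "\<tau> \<le> t" for k t
    using X_norm[OF col_in, of t k c] that assms by (simp add: x_def norm_mult cnj_phase)
  ultimately have "(\<integral>\<^sup>+k. ennreal ((cmod ((cnj (\<psi> 1 b T) * x k T j + cnj (\<psi> 2 b T) * x k T (j + 1))
      - (cnj (\<psi> 1 b \<tau>) * x k \<tau> j + cnj (\<psi> 2 b \<tau>) * x k \<tau> (j + 1))))\<^sup>2) \<partial>lborel) \<le> ennreal (66 * pi * integral {\<tau>..T} gap_density)"
    by (rule mid_pair_drift[OF assms mid_pair_\<psi>])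
  then show ?thesis unfolding Q_entry[OF assms(1)] Q_entry[OF 0] x_def .
qed

lemma Q_drift:
  assumes "0 \<le> \<tau>" "\<tau> \<le> T"
  shows "(\<integral>\<^sup>+k. ennreal ((norm (Q T k - Q \<tau> k))\<^sup>2) \<partial>lborel) \<le> ennreal (264 * pi * integral {\<tau>..T} gap_density)"
proof -
  have 0: "0 \<le> T" using assms by simp
  define f where "f = (\<lambda>a b k. ennreal ((cmod (Q T k $ a $ b - Q \<tau> k $ a $ b))\<^sup>2))"
  have [measurable]: "f a b \<in> borel_measurable lborel" for a b
  proof -
    have "continuous_on UNIV (\<lambda>k. (cmod (Q T k $ a $ b - Q \<tau> k $ a $ b))\<^sup>2)"
      by (intro continuous_intros Q_continuous assms(1) 0)
    then have "(\<lambda>k. (cmod (Q T k $ a $ b - Q \<tau> k $ a $ b))\<^sup>2) \<in> borel_measurable lborel"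
      unfolding measurable_lborel2 by (rule borel_measurable_continuous_onI)
    then show ?thesis unfolding f_def by (rule measurable_compose[OF _ measurable_ennreal])
  qed
  have "(\<integral>\<^sup>+k. ennreal ((norm (Q T k - Q \<tau> k))\<^sup>2) \<partial>lborel) = (\<integral>\<^sup>+k. (\<Sum>a\<in>UNIV. \<Sum>b\<in>UNIV. f a b k) \<partial>lborel)"
    unfolding norm_mat_square f_def by (intro nn_integral_cong) (simp add: sum_nonneg)
  also have "\<dots> = (\<Sum>a\<in>UNIV. \<Sum>b\<in>UNIV. \<integral>\<^sup>+k. f a b k \<partial>lborel)"
    by (simp add: nn_integral_sum)
  also have "\<dots> \<le> (\<Sum>a\<in>(UNIV :: 2 set). \<Sum>b\<in>(UNIV :: 2 set). ennreal (66 * pi * integral {\<tau>..T} gap_density))"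
    unfolding f_def by (intro sum_mono Q_drift_entry assms)
  also have "\<dots> = ennreal (264 * pi * integral {\<tau>..T} gap_density)"
  proof -
    define c where "c = 66 * pi * integral {\<tau>..T} gap_density"
    have "0 \<le> integral {\<tau>..T} gap_density" by (intro integral_nonneg gap_density_integrable assms gap_density_nonneg)
    then have c0: "0 \<le> c" by (simp add: c_def)
    have "264 * pi * integral {\<tau>..T} gap_density = (c + c) + (c + c)" by (simp add: c_def)
    also have "ennreal ((c + c) + (c + c)) = (ennreal c + ennreal c) + (ennreal c + ennreal c)"
      using c0 by (simp only: ennreal_plus add_nonneg_nonneg)
    finally show ?thesis by (simp only: sum_2 c_def)
  qed
  finally show ?thesis .
qed

lemma matrix_inv_\<Psi>: "0 \<le> t \<Longrightarrow> matrix_inv (\<Psi> t k) = \<Psi>_adj t k"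
  by (intro matrix_inv_eqI \<Psi>_adj_left)

lemma block_minus_\<Psi>:
  assumes "0 \<le> t"
  shows "block j (X t k) - \<Psi> t k = \<Psi> t k ** (Q t k - mat 1)"
proof -
  have "\<Psi> t k ** \<Psi>_adj t k = mat 1" using \<Psi>_adj_left[OF assms] matrix_left_right_inverse by blast
  then have 1: "\<Psi> t k ** Q t k = block j (X t k)" by (simp add: Q_def matrix_mul_assoc)
  have "\<Psi> t k ** (Q t k - mat 1) + \<Psi> t k ** mat 1 = \<Psi> t k ** (Q t k - mat 1 + mat 1)"
    by (rule matrix_add_ldistrib[symmetric])
  then show ?thesis using 1 by (simp add: algebra_simps)
qed

text \<open>
  The constant is \<open>2 * 4 * 66 \<pi>\<close>: four entries of \<open>Q\<close>, and \<open>2\<close> for the squared Frobenius norm of \<open>\<Psi>\<close>.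
\<close>

theorem block_estimates:
  assumes B: "\<And>t. 0 \<le> t \<Longrightarrow> integral {0..t} gap_density \<le> B"
  shows "\<forall>t\<ge>0. (\<lambda>k. block j (X t k) - \<Psi> t k) \<in> borel_measurable borel \<and>
        L2_sq (\<lambda>k. block j (X t k) - \<Psi> t k) \<le> ennreal (528 * pi * B)"
    and "\<exists>Yinf :: real \<Rightarrow> complex^2^2. Yinf \<in> borel_measurable borel \<and>
        ((\<lambda>t. L2_sq (\<lambda>k. matrix_inv (\<Psi> t k) ** block j (X t k) - Yinf k)) \<longlongrightarrow> 0) at_top \<and>
        L2_sq (\<lambda>k. Yinf k - mat 1) \<le> ennreal (528 * pi * B)"
proof -
  have B0: "0 \<le> B" using B[of 0] by simp
  define g where "g = (\<lambda>t. 264 * pi * integral {0..t} gap_density)"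
  have gdiff: "g T - g \<tau> = 264 * pi * integral {\<tau>..T} gap_density" if "0 \<le> \<tau>" "\<tau> \<le> T" for \<tau> T
  proof -
    have "integral {0..\<tau>} gap_density + integral {\<tau>..T} gap_density = integral {0..T} gap_density"
      using that by (intro Henstock_Kurzweil_Integration.integral_combine gap_density_integrable) auto
    then have "integral {0..T} gap_density - integral {0..\<tau>} gap_density = integral {\<tau>..T} gap_density" by linarith
    then show ?thesis unfolding g_def by (simp only: right_diff_distrib[symmetric])
  qed
  have gmono: "g \<tau> \<le> g T" if "0 \<le> \<tau>" "\<tau> \<le> T" for \<tau> T
  proof -
    have "0 \<le> integral {\<tau>..T} gap_density" by (intro integral_nonneg gap_density_integrable that gap_density_nonneg)
    then have "0 \<le> 264 * pi * integral {\<tau>..T} gap_density" by simp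
    then show ?thesis using gdiff[OF that] by linarith
  qed
  have gB: "g t \<le> 264 * pi * B" if "0 \<le> t" for t
    unfolding g_def by (intro mult_left_mono B that) auto
  have g0: "g 0 = 0" by (simp add: g_def)
  have est: "(\<integral>\<^sup>+k. ennreal ((norm (Q T k - Q \<tau> k))\<^sup>2) \<partial>lborel) \<le> ennreal (g T - g \<tau>)" if "0 \<le> \<tau>" "\<tau> \<le> T" for \<tau> T
    unfolding gdiff[OF that] by (rule Q_drift[OF that])
  have Qm: "Q t \<in> borel_measurable borel" if "0 \<le> t" for t
    by (rule borel_measurable_continuous_onI[OF Q_continuous[OF that]])
  show "\<forall>t\<ge>0. (\<lambda>k. block j (X t k) - \<Psi> t k) \<in> borel_measurable borel \<and>
        L2_sq (\<lambda>k. block j (X t k) - \<Psi> t k) \<le> ennreal (528 * pi * B)"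
  proof (intro allI impI conjI)
    fix t :: real assume t: "0 \<le> t"
    have jN: "j \<in> {1..N}" "j + 1 \<in> {1..N}" using j by auto
    have "continuous_on UNIV (\<lambda>k. block j (X t k) - \<Psi> t k)"
    proof (rule continuous_on_mat)
      fix a b :: 2
      have "continuous_on UNIV (\<lambda>k. block j (X t k) $ a $ b)"
        using exhaust_2[of a] exhaust_2[of b] X_continuous[OF _ _ t] jN by (auto simp: block_def)
      moreover have "continuous_on UNIV (\<lambda>k. \<Psi> t k $ a $ b)"
        unfolding \<Psi>_eq[OF t] phase_def by (intro continuous_intros)
      ultimately show "continuous_on UNIV (\<lambda>k. (block j (X t k) - \<Psi> t k) $ a $ b)"
        by (simp add: continuous_on_diff)
    qed
    then show "(\<lambda>k. block j (X t k) - \<Psi> t k) \<in> borel_measurable borel" by (rule borel_measurable_continuous_onI)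
    have [measurable]: "Q t \<in> borel_measurable borel" by (rule Qm[OF t])
    have "L2_sq (\<lambda>k. block j (X t k) - \<Psi> t k) \<le> (\<integral>\<^sup>+k. ennreal ((norm (block j (X t k) - \<Psi> t k))\<^sup>2) \<partial>lborel)"
      by (rule L2_sq_le)
    also have "\<dots> \<le> (\<integral>\<^sup>+k. ennreal 2 * ennreal ((norm (Q t k - Q 0 k))\<^sup>2) \<partial>lborel)"
    proof (rule nn_integral_mono)
      fix k
      have "(norm (block j (X t k) - \<Psi> t k))\<^sup>2 \<le> (norm (\<Psi> t k) * norm (Q t k - mat 1))\<^sup>2"
        unfolding block_minus_\<Psi>[OF t] by (intro power_mono mat_mult_norm_le norm_ge_zero)
      also have "\<dots> = 2 * (norm (Q t k - Q 0 k))\<^sup>2"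
        by (simp only: power_mult_distrib norm_\<Psi>[OF t] Q_start)
      finally have "ennreal ((norm (block j (X t k) - \<Psi> t k))\<^sup>2) \<le> ennreal (2 * (norm (Q t k - Q 0 k))\<^sup>2)"
        by (rule ennreal_leI)
      then show "ennreal ((norm (block j (X t k) - \<Psi> t k))\<^sup>2) \<le> ennreal 2 * ennreal ((norm (Q t k - Q 0 k))\<^sup>2)"
        by (simp add: ennreal_mult')
    qed
    also have "\<dots> = ennreal 2 * (\<integral>\<^sup>+k. ennreal ((norm (Q t k - Q 0 k))\<^sup>2) \<partial>lborel)"
      unfolding Q_start by (rule nn_integral_cmult) measurable
    also have "\<dots> \<le> ennreal 2 * ennreal (264 * pi * B)"
    proof (rule mult_left_mono)
      have "g t - g 0 \<le> 264 * pi * B" using gB[OF t] g0 by linarith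
      then show "(\<integral>\<^sup>+k. ennreal ((norm (Q t k - Q 0 k))\<^sup>2) \<partial>lborel) \<le> ennreal (264 * pi * B)"
        by (intro order.trans[OF est[OF order.refl t]] ennreal_leI)
    qed simp
    also have "\<dots> = ennreal (528 * pi * B)" using B0 by (subst ennreal_mult'[symmetric]) auto
    finally show "L2_sq (\<lambda>k. block j (X t k) - \<Psi> t k) \<le> ennreal (528 * pi * B)" .
  qed
  obtain Yinf :: "real \<Rightarrow> complex^2^2" and G where Yinf: "Yinf \<in> borel_measurable borel" and G: "G \<le> 264 * pi * B" "(g \<longlongrightarrow> G) at_top"
    and close: "\<And>\<tau>. 0 \<le> \<tau> \<Longrightarrow> (\<integral>\<^sup>+k. ennreal ((norm (Q \<tau> k - Yinf k))\<^sup>2) \<partial>lborel) \<le> ennreal (G - g \<tau>)"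
    using L2_limit[of Q g "264 * pi * B", OF Qm est gmono gB] by blast
  have "((\<lambda>t. L2_sq (\<lambda>k. matrix_inv (\<Psi> t k) ** block j (X t k) - Yinf k)) \<longlongrightarrow> 0) at_top"
  proof (rule tendsto_sandwich[OF _ _ tendsto_const])
    show "\<forall>\<^sub>F t in at_top. L2_sq (\<lambda>k. matrix_inv (\<Psi> t k) ** block j (X t k) - Yinf k) \<le> ennreal (G - g t)"
      using eventually_ge_at_top[of 0]
    proof eventually_elim
      case (elim t)
      have "L2_sq (\<lambda>k. matrix_inv (\<Psi> t k) ** block j (X t k) - Yinf k) = L2_sq (\<lambda>k. Q t k - Yinf k)"
        using elim by (simp add: matrix_inv_\<Psi> Q_def)
      also have "\<dots> \<le> ennreal (G - g t)" by (rule order.trans[OF L2_sq_le close[OF elim]])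
      finally show ?case .
    qed
    have "((\<lambda>t. ennreal (G - g t)) \<longlongrightarrow> ennreal (G - G)) at_top"
      by (intro tendsto_ennrealI tendsto_diff tendsto_const G(2))
    then show "((\<lambda>t. ennreal (G - g t)) \<longlongrightarrow> 0) at_top" by simp
  qed simp
  moreover have "L2_sq (\<lambda>k. Yinf k - mat 1) \<le> ennreal (528 * pi * B)"
  proof -
    have "L2_sq (\<lambda>k. Yinf k - mat 1) \<le> (\<integral>\<^sup>+k. ennreal ((norm (Yinf k - mat 1))\<^sup>2) \<partial>lborel)" by (rule L2_sq_le)
    also have "\<dots> = (\<integral>\<^sup>+k. ennreal ((norm (Q 0 k - Yinf k))\<^sup>2) \<partial>lborel)"
      by (simp only: Q_start norm_minus_commute)
    also have "\<dots> \<le> ennreal (G - g 0)" by (rule close) simp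
    also have "\<dots> \<le> ennreal (528 * pi * B)"
    proof (rule ennreal_leI)
      have "0 \<le> pi * B" using B0 by simp
      then show "G - g 0 \<le> 528 * pi * B" using G(1) g0 by linarith
    qed
    finally show ?thesis .
  qed
  ultimately show "\<exists>Yinf :: real \<Rightarrow> complex^2^2. Yinf \<in> borel_measurable borel \<and>
        ((\<lambda>t. L2_sq (\<lambda>k. matrix_inv (\<Psi> t k) ** block j (X t k) - Yinf k)) \<longlongrightarrow> 0) at_top \<and>
        L2_sq (\<lambda>k. Yinf k - mat 1) \<le> ennreal (528 * pi * B)"
    using Yinf by blast
qed

end

section \<open>From the integral equations to the abstract setting\<close>

lemma (in mid_block) integral_gap_density:
  assumes "0 \<le> t"
  shows "integral {0..t} gap_density =
     (\<Sum>m=1..j-1. \<Sum>l=j..j+1. inverse \<bar>lam l - lam m\<bar> * integral {0..t} (\<lambda>s. (cmod (V s m l))\<^sup>2))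
   + (\<Sum>m=1..j+1. \<Sum>l=j+2..N. inverse \<bar>lam l - lam m\<bar> * integral {0..t} (\<lambda>s. (cmod (V s m l))\<^sup>2))"
proof -
  have i: "(\<lambda>s. inverse \<bar>lam l - lam m\<bar> * (cmod (V s m l))\<^sup>2) integrable_on {0..t}"
    if "m \<in> {1..N}" "l \<in> {1..N}" for m l
    by (intro integrable_on_mult_right l2locD(2)[OF V_l2[OF that] assms])
  have s: "((\<lambda>s. \<Sum>m\<in>P. \<Sum>l\<in>R. inverse \<bar>lam l - lam m\<bar> * (cmod (V s m l))\<^sup>2) has_integral
       (\<Sum>m\<in>P. \<Sum>l\<in>R. inverse \<bar>lam l - lam m\<bar> * integral {0..t} (\<lambda>s. (cmod (V s m l))\<^sup>2))) {0..t}"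
    if "finite P" "finite R" "P \<subseteq> {1..N}" "R \<subseteq> {1..N}" for P R
  proof (intro has_integral_sum that)
    fix m l assume ml: "m \<in> P" "l \<in> R"
    have "m \<in> {1..N}" "l \<in> {1..N}" using ml that by auto
    from integrable_integral[OF i[OF this]]
    show "((\<lambda>s. inverse \<bar>lam l - lam m\<bar> * (cmod (V s m l))\<^sup>2) has_integral inverse \<bar>lam l - lam m\<bar> * integral {0..t} (\<lambda>s. (cmod (V s m l))\<^sup>2)) {0..t}"
      by simp
  qed
  show ?thesis
    unfolding gap_density_def[abs_def] by (intro integral_unique has_integral_add s) (use j in auto)
qed

lemma ennreal_weighted_sum_le:
  fixes c a :: "'m \<Rightarrow> 'l \<Rightarrow> real" and n :: "'m \<Rightarrow> 'l \<Rightarrow> ennreal"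
  assumes "\<And>m l. 0 \<le> c m l" "\<And>m l. 0 \<le> a m l" "\<And>m l. ennreal (a m l) \<le> n m l"
  shows "ennreal (\<Sum>m\<in>P. \<Sum>l\<in>R. c m l * a m l) \<le> (\<Sum>m\<in>P. \<Sum>l\<in>R. ennreal (c m l) * n m l)"
proof -
  have "ennreal (\<Sum>m\<in>P. \<Sum>l\<in>R. c m l * a m l) = (\<Sum>m\<in>P. \<Sum>l\<in>R. ennreal (c m l * a m l))"
    using assms by (simp add: sum_nonneg flip: sum_ennreal)
  also have "\<dots> \<le> (\<Sum>m\<in>P. \<Sum>l\<in>R. ennreal (c m l) * n m l)"
    using assms by (intro sum_mono) (simp add: ennreal_mult' mult_left_mono)
  finally show ?thesis .
qed

text \<open>
  Each summand of \<open>I''\<close> integrates a nonnegative function over the whole half-line.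
\<close>

lemma integral_gap_density_le_I2:
  assumes mb: "mid_block N j lam (\<lambda>t m l. if 0 \<le> t then V t m l else 0)" and t: "0 \<le> t"
  shows "ennreal (integral {0..t} (mid_block.gap_density N j lam (\<lambda>t m l. if 0 \<le> t then V t m l else 0))) \<le> I2 N lam V j"
proof -
  define V0 where "V0 = (\<lambda>t m l. if 0 \<le> t then V t m l else 0 :: complex)"
  interpret mid_block N j lam V0 unfolding V0_def by (rule mb)
  define a where "a = (\<lambda>m l. integral {0..t} (\<lambda>s. (cmod (V0 s m l))\<^sup>2))"
  define n where "n = (\<lambda>m l. \<integral>\<^sup>+\<tau>\<in>{0..}. ennreal ((cmod (V \<tau> m l))\<^sup>2) \<partial>lebesgue)"
  have a_eq: "integral {0..t} (\<lambda>s. (cmod (V0 s m l))\<^sup>2) = a m l"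
    and n_eq: "(\<integral>\<^sup>+\<tau>\<in>{0..}. ennreal ((cmod (V \<tau> m l))\<^sup>2) \<partial>lebesgue) = n m l" for m l
    by (simp_all add: a_def n_def)
  have a0: "0 \<le> a m l" for m l
    unfolding a_def by (cases "(\<lambda>s. (cmod (V0 s m l))\<^sup>2) integrable_on {0..t}")
      (auto intro!: integral_nonneg simp: not_integrable_integral)
  have an: "ennreal (a m l) \<le> n m l" for m l
  proof (cases "(\<lambda>s. (cmod (V0 s m l))\<^sup>2) integrable_on {0..t}")
    case True
    have "(\<integral>\<^sup>+x. ennreal ((cmod (V0 x m l))\<^sup>2) * indicator {0..t} x \<partial>lborel) = ennreal (a m l)"
      unfolding a_def by (rule nn_integral_has_integral_lebesgue'[OF _ integrable_integral[OF True]]) simp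
    then have "ennreal (a m l) = (\<integral>\<^sup>+x. ennreal ((cmod (V0 x m l))\<^sup>2) * indicator {0..t} x \<partial>lebesgue)"
      by (simp add: nn_integral_completion)
    also have "\<dots> \<le> n m l"
      unfolding n_def by (intro nn_integral_mono) (auto simp: V0_def indicator_def)
    finally show ?thesis .
  next
    case False
    then show ?thesis by (simp add: a_def not_integrable_integral)
  qed
  have "ennreal (integral {0..t} gap_density) = ennreal (\<Sum>m=1..j-1. \<Sum>l=j..j+1. inverse \<bar>lam l - lam m\<bar> * a m l)
      + ennreal (\<Sum>m=1..j+1. \<Sum>l=j+2..N. inverse \<bar>lam l - lam m\<bar> * a m l)"
    unfolding integral_gap_density[OF t] a_eq
    by (intro ennreal_plus sum_nonneg mult_nonneg_nonneg a0) auto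
  also have "\<dots> \<le> I2 N lam V j"
    unfolding I2_def n_eq
    by (intro add_mono ennreal_weighted_sum_le a0 an) auto
  finally show ?thesis by (simp add: V0_def)
qed

text \<open>
  Replacing \<open>V\<close> by \<open>0\<close> at negative times changes no integral over \<open>[0, t]\<close>.
\<close>

lemma mid_block_evolutionI:
  assumes "lam 1 = 0" "mono_on {1..N} lam" "\<forall>t\<ge>0. zero_diag_hermitian N (V t)" "L2_loc N V"
    and X: "is_X N lam V X" and \<Psi>: "is_Psi lam V j \<Psi>"
    and "1 < j" "j + 2 \<le> N" "lam (j - 1) < lam j" "lam j = lam (j + 1)" "lam (j + 1) < lam (j + 2)"
  shows "mid_block_evolution N j lam (\<lambda>t m l. if 0 \<le> t then V t m l else 0) X (\<Psi> 0)"
proof -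
  define V0 where "V0 = (\<lambda>t m l. if 0 \<le> t then V t m l else 0 :: complex)"
  have herm: "V t l m = cnj (V t m l)" and diag: "V t m m = 0"
    if "0 \<le> t" "m \<in> {1..N}" "l \<in> {1..N}" for t m l
    using assms(3) that unfolding zero_diag_hermitian_def by blast+
  have Xs: "solves_ivp {1..N} (full_gen lam V k) 0 (\<lambda>t. X t k)" for k using X by (simp add: is_X_def)
  have \<Psi>s: "solves_ivp (UNIV :: 2 set) (\<lambda>t m l. block_gen lam V j k t $ m $ l) 0 (\<lambda>t m l. \<Psi> 0 t k $ m $ l)" for k
    using \<Psi> by (simp add: is_Psi_def)
  have "mid_block_evolution N j lam V0 X (\<Psi> 0)"
  proof
    show "V0 t l m = cnj (V0 t m l)" if "m \<in> {1..N}" "l \<in> {1..N}" for t m l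
    proof (cases "0 \<le> t")
      case True
      from herm[OF this that] show ?thesis unfolding V0_def if_P[OF True] .
    qed (simp add: V0_def)
    show "V0 t m m = 0" if "m \<in> {1..N}" for t m
      using diag[OF _ that that] unfolding V0_def by simp
    show "l2loc 0 (\<lambda>t. V0 t m l)" if "m \<in> {1..N}" "l \<in> {1..N}" for m l
      unfolding V0_def using assms(4) that by (rule L2_loc_l2loc)
    show "X 0 k m l = (if m = l then 1 else 0)" if "m \<in> {1..N}" "l \<in> {1..N}" for k m l
      by (rule solves_ivp_primitive(2)[OF Xs that])
    show "primitive 0 (\<lambda>t. X t k m l) (\<lambda>t. \<i> * (of_real k * of_real (lam m) * X t k m l + (\<Sum>p\<in>{1..N}. V0 t m p * X t k p l)))"
      if ml: "m \<in> {1..N}" "l \<in> {1..N}" for k m l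
    proof (rule primitive_cong[OF solves_ivp_primitive(1)[OF Xs ml]])
      fix t :: real assume t: "0 \<le> t"
      have "(\<Sum>p\<in>{1..N}. full_gen lam V k t m p * X t k p l)
          = (\<Sum>p\<in>{1..N}. (if p = m then of_real (k * lam m) * X t k m l else 0) + V t m p * X t k p l)"
        by (intro sum.cong refl) (auto simp: full_gen_def distrib_right)
      also have "\<dots> = of_real k * of_real (lam m) * X t k m l + (\<Sum>p\<in>{1..N}. V0 t m p * X t k p l)"
        using ml t by (simp add: sum.distrib V0_def)
      finally show "\<i> * (\<Sum>p\<in>{1..N}. full_gen lam V k t m p * X t k p l)
          = \<i> * (of_real k * of_real (lam m) * X t k m l + (\<Sum>p\<in>{1..N}. V0 t m p * X t k p l))" by simp
    qed simp
    show "\<Psi> 0 0 k = mat 1" for k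
    proof -
      have "\<Psi> 0 0 k $ a $ b = mat 1 $ a $ b" for a b
        using solves_ivp_primitive(2)[OF \<Psi>s UNIV_I UNIV_I, of k a b] by (simp add: mat_def)
      then show ?thesis by (simp add: vec_eq_iff)
    qed
    show "primitive 0 (\<lambda>t. \<Psi> 0 t k $ 1 $ b) (\<lambda>t. \<i> * (of_real (k * lam j) * \<Psi> 0 t k $ 1 $ b + V0 t j (j + 1) * \<Psi> 0 t k $ 2 $ b))" for k b
      by (rule primitive_cong[OF solves_ivp_primitive(1)[OF \<Psi>s UNIV_I UNIV_I, of k 1 b]])
         (simp_all add: sum_2 block_gen_def mat_def V0_def)
    show "primitive 0 (\<lambda>t. \<Psi> 0 t k $ 2 $ b) (\<lambda>t. \<i> * (of_real (k * lam j) * \<Psi> 0 t k $ 2 $ b + V0 t (j + 1) j * \<Psi> 0 t k $ 1 $ b))" for k b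
      by (rule primitive_cong[OF solves_ivp_primitive(1)[OF \<Psi>s UNIV_I UNIV_I, of k 2 b]])
         (simp_all add: sum_2 block_gen_def mat_def V0_def)
  qed (use assms in simp_all)
  then show ?thesis by (simp add: V0_def)
qed

theorem theorem3p3:
  "\<exists>C::real. \<forall>(N::nat) (lam :: nat \<Rightarrow> real) (V :: real \<Rightarrow> nat \<Rightarrow> nat \<Rightarrow> complex)
      (X :: real \<Rightarrow> real \<Rightarrow> nat \<Rightarrow> nat \<Rightarrow> complex)
      (j::nat) (\<Psi> :: real \<Rightarrow> real \<Rightarrow> real \<Rightarrow> complex^2^2).
     lam 1 = 0 \<and> mono_on {1..N} lam \<and>
     (\<forall>t\<ge>0. zero_diag_hermitian N (V t)) \<and> L2_loc N V \<and>
     is_X N lam V X \<and> is_Psi lam V j \<Psi> \<and>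
     1 < j \<and> j + 2 \<le> N \<and>
     lam (j - 1) < lam j \<and> lam j = lam (j + 1) \<and> lam (j + 1) < lam (j + 2) \<and>
     I2 N lam V j < \<infinity>
     \<longrightarrow>
     (\<forall>t\<ge>0. (\<lambda>k. block j (X t k) - \<Psi> 0 t k) \<in> borel_measurable borel \<and>
        L2_sq (\<lambda>k. block j (X t k) - \<Psi> 0 t k) \<le> ennreal C * I2 N lam V j) \<and>
     (\<exists>Yinf :: real \<Rightarrow> complex^2^2.
        Yinf \<in> borel_measurable borel \<and>
        ((\<lambda>t. L2_sq (\<lambda>k. matrix_inv (\<Psi> 0 t k) ** block j (X t k) - Yinf k)) \<longlongrightarrow> 0) at_top \<and>
        L2_sq (\<lambda>k. Yinf k - mat 1) \<le> ennreal C * I2 N lam V j)"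
proof (intro exI[of _ "528 * pi"] allI impI, elim conjE)
  fix N :: nat and lam :: "nat \<Rightarrow> real" and V :: "real \<Rightarrow> nat \<Rightarrow> nat \<Rightarrow> complex"
    and X :: "real \<Rightarrow> real \<Rightarrow> nat \<Rightarrow> nat \<Rightarrow> complex" and j :: nat and \<Psi> :: "real \<Rightarrow> real \<Rightarrow> real \<Rightarrow> complex^2^2"
  assume hyps: "lam 1 = 0" "mono_on {1..N} lam" "\<forall>t\<ge>0. zero_diag_hermitian N (V t)" "L2_loc N V"
    "is_X N lam V X" "is_Psi lam V j \<Psi>" "1 < j" "j + 2 \<le> N"
    "lam (j - 1) < lam j" "lam j = lam (j + 1)" "lam (j + 1) < lam (j + 2)"
    and finite: "I2 N lam V j < \<infinity>"
  \<comment> \<open>the hypotheses say nothing about \<open>V\<close> at negative times\<close>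
  define V0 where "V0 = (\<lambda>t m l. if 0 \<le> t then V t m l else 0 :: complex)"
  interpret mid_block_evolution N j lam V0 X "\<Psi> 0"
    unfolding V0_def by (rule mid_block_evolutionI[OF hyps])
  have mb: "mid_block N j lam V0" by unfold_locales
  define B where "B = enn2real (I2 N lam V j)"
  have B: "ennreal B = I2 N lam V j" using finite by (simp add: B_def)
  have "integral {0..t} gap_density \<le> B" if "0 \<le> t" for t
  proof -
    have "ennreal (integral {0..t} gap_density) \<le> ennreal B"
      unfolding B V0_def by (rule integral_gap_density_le_I2[OF mb[unfolded V0_def] that])
    then show ?thesis by (simp add: B_def)
  qed
  note est = block_estimates[OF this]
  have "ennreal (528 * pi * B) = ennreal (528 * pi) * I2 N lam V j"
    unfolding B[symmetric] by (rule ennreal_mult) (simp_all add: B_def)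
  then show "(\<forall>t\<ge>0. (\<lambda>k. block j (X t k) - \<Psi> 0 t k) \<in> borel_measurable borel \<and>
        L2_sq (\<lambda>k. block j (X t k) - \<Psi> 0 t k) \<le> ennreal (528 * pi) * I2 N lam V j) \<and>
     (\<exists>Yinf :: real \<Rightarrow> complex^2^2.
        Yinf \<in> borel_measurable borel \<and>
        ((\<lambda>t. L2_sq (\<lambda>k. matrix_inv (\<Psi> 0 t k) ** block j (X t k) - Yinf k)) \<longlongrightarrow> 0) at_top \<and>
        L2_sq (\<lambda>k. Yinf k - mat 1) \<le> ennreal (528 * pi) * I2 N lam V j)"
    using est by simp
qed

end
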